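(* If $(I,\cdot)$ is the Cartan datum associated to $\Omega$, then there is a Hopf algebra isomorphism over $\mathbb{Q}(v,t)$ $$(U_{v,t},\ast,\Delta^*,\varepsilon^*,S^* )\simeq(U_{v,t}(I,\cdot),\cdot,\Delta_1,\varepsilon_1,S_1)$$ sending the generators $E_i,F_i,K_i^{\pm1},K_i'^{\pm1}$ of $U_{v,t}$ to the respective generators of $U_{v,t}(I,\cdot)$.
   Context: **Datum.** $I$ is a finite set and $\Omega=(\Omega_{ij})_{i,j\in I}$ an integer matrix such that (a) $\Omega_{ii}\in\mathbb{Z}_{>0}$ and $\Omega_{ij}\in\mathbb{Z}_{\le0}$ for $i\neq j$; (b) $\frac{\Omega_{ij}+\Omega_{ji}}{\Omega_{ii}}\in\mathbb{Z}_{\le0}$ for $i\ne j$; (c) $\gcd_i(\Omega_{ii})=1$. Bilinear forms on $\mathbb{Z}^I$: $\langle i,j\rangle=\Omega_{ij}$, $[i,j]=2\delta_{ij}\Omega_{ii}-\Omega_{ij}$, $i\cdot j=\langle i,j\rangle+\langle j,i\rangle$; $(I,\cdot)$ is the Cartan datum associated to $\Omega$. For indeterminates $v,t$: $v_i=v^{i\cdot i/2}$, $t_i=t^{i\cdot i/2}$, $[n]_v=\frac{v^n-v^{-n}}{v-v^{-1}}$, $[n]_{v,t}=\frac{(vt)^n-(vt^{-1})^{-n}}{vt-(vt^{-1})^{-1}}=t^{n-1}[n]_v$, with factorials $[n]^!$ and binomials $\begin{bmatrix} n \\ k \end{bmatrix}$ as usual. **$U_{v,t}$** is the unital associative $\mathbb{Q}(v,t)$-algebra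 generated by $E_i,F_i,K_i^{\pm1},K_i'^{\pm1}$ ($i\in I$) with relations: (R1) all $K_i^{\pm1},K_j'^{\pm1}$ commute with each other, $K_iK_i^{-1}=1=K_i'K_i'^{-1}$; (R2) $K_iE_jK_i^{-1}=v^{i\cdot j}t^{\langle i,j\rangle-\langle j,i\rangle}E_j$, $K_i'E_jK_i'^{-1}=v^{-i\cdot j}t^{\langle i,j\rangle-\langle j,i\rangle}E_j$, $K_iF_jK_i^{-1}=v^{-i\cdot j}t^{\langle j,i\rangle-\langle i,j\rangle}F_j$, $K_i'F_jK_i'^{-1}=v^{i\cdot j}t^{\langle j,i\rangle-\langle i,j\rangle}F_j$; (R3) $E_iF_j-F_jE_i=\delta_{ij}\frac{K_i-K_i'}{v_i-v_i^{-1}}$; (R4) for $i\ne j$, the sums over $p+p'=1-2\frac{i\cdot j}{i\cdot i}$, $p,p'\ge 0$: $\sum(-1)^pt_i^{-p(p'-2\frac{\langle i,j\rangle}{i\cdot i}+2\frac{\langle j,i\rangle}{i\cdot i})}E_i^{(p')}E_jE_i^{(p)}=0$ and $\sum(-1)^pt_i^{-p(p'-2\frac{\langle i,j\rangle}{i\cdot i}+2\frac{\langle j,i\rangle}{i\cdot i})}F_i^{(p)}F_jF_i^{(p')}=0$, where $E_i^{(p)}=E_i^p/[p]^!_{v_i,t_i}$ and similarly for $F$. **The product $\ast$.** $U_{v,t}$ is $\mathbb{Z}^I\times\mathbb{Z}^I$-graded by $\deg E_i=(i,0)$, $\deg F_i=(0,i)$, $\deg K_i=\deg K_i'=(i,i)$,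 $\deg K_i^{-1}=\deg K_i'^{-1}=(-i,-i)$. Put $[\gamma,\eta]'=[\gamma_2,\eta_2]-[\gamma_1,\eta_1]$ for $\gamma=(\gamma_1,\gamma_2)$, $\eta=(\eta_1,\eta_2)$, and $x\ast y=t^{-[|x|,|y|]'}xy$ for homogeneous $x,y$. On $U_{v,t}\otimes U_{v,t}$ put $(x\otimes y)\ast(x'\otimes y')=(x\ast x')\otimes(y\ast y')$. $(U_{v,t},\ast)$ is a Hopf algebra with structure maps determined (with respect to $\ast$) by $\Delta^*(K_i^{\pm1})=K_i^{\pm1}\otimes K_i^{\pm1}$, $\Delta^*(K_i'^{\pm1})=K_i'^{\pm1}\otimes K_i'^{\pm1}$, $\Delta^*(E_i)=E_i\otimes1+K_i\otimes E_i$, $\Delta^*(F_i)=1\otimes F_i+F_i\otimes K_i'$, $\varepsilon^*(K_i^{\pm1})=\varepsilon^*(K_i'^{\pm1})=1$, $\varepsilon^*(E_i)=\varepsilon^*(F_i)=0$, $S^*(K_i^{\pm1})=K_i^{\mp1}$, $S^*(K_i'^{\pm1})=K_i'^{\mp1}$, $S^*(E_i)=-K_i^{-1}\ast E_i$, $S^*(F_i)=-F_i\ast K_i'^{-1}$. **The one-parameter algebra.** $U_v(I,\cdot)$ is the unital associative $\mathbb{Q}(v)$-algebra generated by $E_i,F_i,K_i^{\pm1},K_i'^{\pm1}$ with relations: (R1); $K_iE_jK_i^{-1}=v^{i\cdot j}E_j$, $K_i'E_jK_i'^{-1}=v^{-i\cdot j}E_j$, $K_iF_jK_i^{-1}=v^{-i\cdot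 j}F_j$, $K_i'F_jK_i'^{-1}=v^{i\cdot j}F_j$; (R3); and for $i\ne j$, with $a_{ij}=2\frac{i\cdot j}{i\cdot i}$, $\sum_{p+p'=1-a_{ij}}(-1)^p\begin{bmatrix} 1-a_{ij} \\ p \end{bmatrix}_{v_i}E_i^pE_jE_i^{p'}=0$ and the same with $F$ in place of $E$. It is a Hopf algebra with $\Delta_1,\varepsilon_1,S_1$ given on generators by the same formulas as $\Delta^*,\varepsilon^*,S^*$ (with the product of $U_v(I,\cdot)$ in place of $\ast$). $U_{v,t}(I,\cdot)=U_v(I,\cdot)\otimes_{\mathbb{Q}(v)}\mathbb{Q}(v,t)$ with the extended Hopf structure. *)

theory Defs
  imports
    "HOL-Algebra.Algebra"
    "HOL-Algebra.Algebraic_Closure_Type"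
    "HOL-Computational_Algebra.Computational_Algebra"
    "HOL-Library.Poly_Mapping"
begin

section \<open>Associative algebras over a field\<close>

text \<open>
  Scalars are elements of a type of class \<^class>\<open>field\<close>; algebras are carrier-based records of
  type \<open>('k, 'a) module\<close>.  The library locale \<open>algebra\<close> is restricted to commutative rings, hence
  the predicate below.
\<close>

definition assoc_algebra :: "('k::field, 'a, 'm) module_scheme \<Rightarrow> bool" where
  "assoc_algebra A \<longleftrightarrow>
     module (ring_of_type_algebra :: 'k ring) A \<and> ring A \<and>
     (\<forall>c. \<forall>x\<in>carrier A. \<forall>y\<in>carrier A.
        (c \<odot>\<^bsub>A\<^esub> x) \<otimes>\<^bsub>A\<^esub> y = c \<odot>\<^bsub>A\<^esub> (x \<otimes>\<^bsub>A\<^esub> y) \<and>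
        x \<otimes>\<^bsub>A\<^esub> (c \<odot>\<^bsub>A\<^esub> y) = c \<odot>\<^bsub>A\<^esub> (x \<otimes>\<^bsub>A\<^esub> y))"

definition alg_hom ::
    "('k, 'a, 'm) module_scheme \<Rightarrow> ('k, 'b, 'n) module_scheme \<Rightarrow> ('a \<Rightarrow> 'b) set" where
  "alg_hom A B = {h \<in> ring_hom A B. \<forall>c. \<forall>x\<in>carrier A. h (c \<odot>\<^bsub>A\<^esub> x) = c \<odot>\<^bsub>B\<^esub> h x}"

definition opposite :: "('k, 'a, 'm) module_scheme \<Rightarrow> ('k, 'a, 'm) module_scheme" where
  "opposite A = A\<lparr>monoid.mult := \<lambda>x y. y \<otimes>\<^bsub>A\<^esub> x\<rparr>"

definition with_smult :: "('a, 'm) ring_scheme \<Rightarrow> ('k \<Rightarrow> 'a \<Rightarrow> 'a) \<Rightarrow> ('k, 'a) module" where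
  "with_smult R s = ring.extend (ring.truncate R) (module.fields s)"

definition restrict_scalars ::
    "('k \<Rightarrow> 'l) \<Rightarrow> ('l, 'a, 'm) module_scheme \<Rightarrow> ('k, 'a) module" where
  "restrict_scalars \<sigma> A = with_smult A (\<lambda>c x. \<sigma> c \<odot>\<^bsub>A\<^esub> x)"

text \<open>The field \<open>'l\<close> as an algebra over \<open>'k\<close> by means of a field homomorphism \<open>\<sigma>\<close>.\<close>

definition scalar_algebra :: "('k \<Rightarrow> 'l::field) \<Rightarrow> ('k, 'l) module" where
  "scalar_algebra \<sigma> = with_smult ring_of_type_algebra (\<lambda>c x. \<sigma> c * x)"

definition quot_algebra :: "('k, 'a, 'm) module_scheme \<Rightarrow> 'a set \<Rightarrow> ('k, 'a set) module" where
  "quot_algebra A J = with_smult (A Quot J) (\<lambda>c Z. \<Union>x\<in>Z. J +>\<^bsub>A\<^esub> (c \<odot>\<^bsub>A\<^esub> x))"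

text \<open>The monoid algebra \<open>k[M]\<close>; \<open>Poly_Mapping.single m c\<close> is the scalar multiple
  \<open>c \<cdot> m\<close> of the basis element \<open>m\<close>.\<close>

definition monoid_algebra :: "('m, 'z) monoid_scheme \<Rightarrow> ('k::field, 'm \<Rightarrow>\<^sub>0 'k) module" where
  "monoid_algebra M =
    \<lparr>carrier = {f. Poly_Mapping.keys f \<subseteq> carrier M},
     monoid.mult = (\<lambda>f g. \<Sum>x\<in>Poly_Mapping.keys f. \<Sum>y\<in>Poly_Mapping.keys g.
       Poly_Mapping.single (x \<otimes>\<^bsub>M\<^esub> y) (Poly_Mapping.lookup f x * Poly_Mapping.lookup g y)),
     one = Poly_Mapping.single \<one>\<^bsub>M\<^esub> 1,
     ring.zero = 0,
     add = (+),
     module.smult = (\<lambda>c. Poly_Mapping.map ((*) c))\<rparr>"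


section \<open>Tensor products of algebras\<close>

definition bilinear_rels ::
    "('k::field, 'a, 'm) module_scheme \<Rightarrow> ('k, 'b, 'n) module_scheme \<Rightarrow> ('a \<times> 'b \<Rightarrow>\<^sub>0 'k) set" where
  "bilinear_rels A B =
     {Poly_Mapping.single (a \<oplus>\<^bsub>A\<^esub> a', b) 1 - Poly_Mapping.single (a, b) 1
        - Poly_Mapping.single (a', b) 1
      | a a' b. a \<in> carrier A \<and> a' \<in> carrier A \<and> b \<in> carrier B} \<union>
     {Poly_Mapping.single (a, b \<oplus>\<^bsub>B\<^esub> b') 1 - Poly_Mapping.single (a, b) 1
        - Poly_Mapping.single (a, b') 1
      | a b b'. a \<in> carrier A \<and> b \<in> carrier B \<and> b' \<in> carrier B} \<union>
     {Poly_Mapping.single (c \<odot>\<^bsub>A\<^esub> a, b) 1 - Poly_Mapping.single (a, b) c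
      | c a b. a \<in> carrier A \<and> b \<in> carrier B} \<union>
     {Poly_Mapping.single (a, c \<odot>\<^bsub>B\<^esub> b) 1 - Poly_Mapping.single (a, b) c
      | c a b. a \<in> carrier A \<and> b \<in> carrier B}"

text \<open>
  \<open>A \<otimes> B\<close> is the free vector space on \<open>A \<times> B\<close> modulo the bilinearity relations.  The free vector
  space carries the product \<open>(a, b) (a', b') = (a a', b b')\<close> of the monoid algebra of \<open>A \<times> B\<close>; as
  the set of bilinearity relations is mapped into its linear span by multiplication with any
  \<open>(a, b)\<close> on either side, the ideal it generates is just its linear span.
\<close>

definition tensor_ideal ::
    "('k::field, 'a, 'm) module_scheme \<Rightarrow> ('k, 'b, 'n) module_scheme \<Rightarrow> ('a \<times> 'b \<Rightarrow>\<^sub>0 'k) set" where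
  "tensor_ideal A B = Idl\<^bsub>monoid_algebra (A \<times>\<times> B)\<^esub> (bilinear_rels A B)"

definition tensor ::
    "('k::field, 'a, 'm) module_scheme \<Rightarrow> ('k, 'b, 'n) module_scheme
      \<Rightarrow> ('k, ('a \<times> 'b \<Rightarrow>\<^sub>0 'k) set) module" where
  "tensor A B = quot_algebra (monoid_algebra (A \<times>\<times> B)) (tensor_ideal A B)"

definition pure_tensor ::
    "('k::field, 'a, 'm) module_scheme \<Rightarrow> ('k, 'b, 'n) module_scheme
      \<Rightarrow> 'a \<Rightarrow> 'b \<Rightarrow> ('a \<times> 'b \<Rightarrow>\<^sub>0 'k) set" where
  "pure_tensor A B a b =
     tensor_ideal A B +>\<^bsub>monoid_algebra (A \<times>\<times> B)\<^esub> Poly_Mapping.single (a, b) 1"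

text \<open>The linear map \<open>a \<otimes> b \<mapsto> \<beta> a b\<close> into \<open>M\<close> induced by a bilinear map \<open>\<beta>\<close>: the linear extension
  of \<open>\<beta>\<close> to the free vector space is constant on each coset \<open>Z\<close>.\<close>

definition tensor_lift ::
    "('k::field, 'c, 'm) module_scheme \<Rightarrow> ('a \<Rightarrow> 'b \<Rightarrow> 'c) \<Rightarrow> ('a \<times> 'b \<Rightarrow>\<^sub>0 'k) set \<Rightarrow> 'c" where
  "tensor_lift M \<beta> Z =
     the_elem ((\<lambda>f. \<Oplus>\<^bsub>M\<^esub>p\<in>Poly_Mapping.keys f.
       Poly_Mapping.lookup f p \<odot>\<^bsub>M\<^esub> \<beta> (fst p) (snd p)) ` Z)"

text \<open>The map \<open>f \<otimes> g\<close> with values in \<open>C \<otimes> D\<close>.\<close>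

definition tensor_map ::
    "('k::field, 'c, 'm) module_scheme \<Rightarrow> ('k, 'd, 'n) module_scheme
      \<Rightarrow> ('a \<Rightarrow> 'c) \<Rightarrow> ('b \<Rightarrow> 'd) \<Rightarrow> ('a \<times> 'b \<Rightarrow>\<^sub>0 'k) set \<Rightarrow> ('c \<times> 'd \<Rightarrow>\<^sub>0 'k) set" where
  "tensor_map C D f g = tensor_lift (tensor C D) (\<lambda>a b. pure_tensor C D (f a) (g b))"

text \<open>The canonical map \<open>(A \<otimes> A) \<otimes> A \<rightarrow> A \<otimes> (A \<otimes> A)\<close>.\<close>

definition tensor_assoc ::
    "('k::field, 'a, 'm) module_scheme
      \<Rightarrow> (('a \<times> 'a \<Rightarrow>\<^sub>0 'k) set \<times> 'a \<Rightarrow>\<^sub>0 'k) set \<Rightarrow> ('a \<times> ('a \<times> 'a \<Rightarrow>\<^sub>0 'k) set \<Rightarrow>\<^sub>0 'k) set" where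
  "tensor_assoc A =
     (let T = tensor A (tensor A A) in
      tensor_lift T (\<lambda>x c. tensor_lift T
        (\<lambda>a b. pure_tensor A (tensor A A) a (pure_tensor A A b c)) x))"


section \<open>Hopf algebras\<close>

record (overloaded) ('k::zero, 'a) hopf = "('k, 'a) module" +
  comult :: "'a \<Rightarrow> ('a \<times> 'a \<Rightarrow>\<^sub>0 'k) set"
  counit :: "'a \<Rightarrow> 'k"
  antipode :: "'a \<Rightarrow> 'a"

definition hopf_algebra :: "('k::field, 'a, 'm) hopf_scheme \<Rightarrow> bool" where
  "hopf_algebra H \<longleftrightarrow>
     assoc_algebra H \<and>
     comult H \<in> alg_hom H (tensor H H) \<and>
     counit H \<in> alg_hom H (scalar_algebra id) \<and>
     antipode H \<in> carrier H \<rightarrow> carrier H \<and>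
     (\<forall>x\<in>carrier H. \<forall>y\<in>carrier H. antipode H (x \<oplus>\<^bsub>H\<^esub> y) = antipode H x \<oplus>\<^bsub>H\<^esub> antipode H y) \<and>
     (\<forall>c. \<forall>x\<in>carrier H. antipode H (c \<odot>\<^bsub>H\<^esub> x) = c \<odot>\<^bsub>H\<^esub> antipode H x) \<and>
     (\<forall>x\<in>carrier H.
        tensor_assoc H (tensor_map (tensor H H) H (comult H) id (comult H x))
          = tensor_map H (tensor H H) id (comult H) (comult H x) \<and>
        tensor_lift H (\<lambda>a b. counit H a \<odot>\<^bsub>H\<^esub> b) (comult H x) = x \<and>
        tensor_lift H (\<lambda>a b. counit H b \<odot>\<^bsub>H\<^esub> a) (comult H x) = x \<and>
        tensor_lift H (\<lambda>a b. antipode H a \<otimes>\<^bsub>H\<^esub> b) (comult H x) = counit H x \<odot>\<^bsub>H\<^esub> \<one>\<^bsub>H\<^esub> \<and>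
        tensor_lift H (\<lambda>a b. a \<otimes>\<^bsub>H\<^esub> antipode H b) (comult H x) = counit H x \<odot>\<^bsub>H\<^esub> \<one>\<^bsub>H\<^esub>)"

definition hopf_iso ::
    "('k::field, 'a, 'm) hopf_scheme \<Rightarrow> ('k, 'b, 'n) hopf_scheme \<Rightarrow> ('a \<Rightarrow> 'b) set" where
  "hopf_iso H L =
     {\<phi> \<in> alg_hom H L. bij_betw \<phi> (carrier H) (carrier L) \<and>
       (\<forall>x\<in>carrier H.
          comult L (\<phi> x) = tensor_map L L \<phi> \<phi> (comult H x) \<and>
          counit L (\<phi> x) = counit H x \<and>
          antipode L (\<phi> x) = \<phi> (antipode H x))}"

text \<open>Extension of scalars along \<open>\<sigma>\<close>: \<open>A \<otimes> 'l\<close> with \<open>'l\<close> acting on the second factor.\<close>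

definition extend_scalars ::
    "('k::field \<Rightarrow> 'l::field) \<Rightarrow> ('k, 'a, 'm) module_scheme \<Rightarrow> ('l, ('a \<times> 'l \<Rightarrow>\<^sub>0 'k) set) module" where
  "extend_scalars \<sigma> A =
     with_smult (tensor A (scalar_algebra \<sigma>))
       (\<lambda>c. tensor_map A (scalar_algebra \<sigma>) id ((*) c))"

definition extend_elem ::
    "('k::field \<Rightarrow> 'l::field) \<Rightarrow> ('k, 'a, 'm) module_scheme \<Rightarrow> 'a \<Rightarrow> ('a \<times> 'l \<Rightarrow>\<^sub>0 'k) set" where
  "extend_elem \<sigma> A a = pure_tensor A (scalar_algebra \<sigma>) a 1"

text \<open>
  With \<open>\<iota> a = a \<otimes> 1\<close>, the extended structure maps are
  \<open>\<Delta> (a \<otimes> c) = c \<cdot> (\<iota> \<otimes> \<iota>) (\<Delta> a)\<close>, \<open>\<epsilon> (a \<otimes> c) = \<epsilon> a \<cdot> c\<close> and \<open>S (a \<otimes> c) = S a \<otimes> c\<close>.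
\<close>

definition extend_hopf ::
    "('k::field \<Rightarrow> 'l::field) \<Rightarrow> ('k, 'a, 'm) hopf_scheme \<Rightarrow> ('l, ('a \<times> 'l \<Rightarrow>\<^sub>0 'k) set) hopf" where
  "extend_hopf \<sigma> H =
     (let B = extend_scalars \<sigma> H;
          \<iota> = extend_elem \<sigma> H;
          BB = restrict_scalars \<sigma> (tensor B B);
          \<iota>\<iota> = tensor_lift BB (\<lambda>a b. pure_tensor B B (\<iota> a) (\<iota> b))
      in module.extend B (hopf.fields
           (tensor_lift BB (\<lambda>a c. c \<odot>\<^bsub>tensor B B\<^esub> \<iota>\<iota> (comult H a)))
           (tensor_lift (scalar_algebra \<sigma>) (\<lambda>a c. \<sigma> (counit H a) * c))
           (tensor_map H (scalar_algebra \<sigma>) (antipode H) id)))"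


section \<open>Algebras presented by quantum group generators\<close>

text \<open>\<open>Kinv i\<close> and \<open>Kinv' i\<close> stand for the formal inverses of \<open>K i\<close> and \<open>K' i\<close>.\<close>

datatype 'i gen = E 'i | F 'i | K 'i | Kinv 'i | K' 'i | Kinv' 'i

definition free_monoid :: "'x list monoid" where
  "free_monoid = \<lparr>carrier = UNIV, monoid.mult = (@), one = []\<rparr>"

definition free_algebra :: "('k::field, 'x list \<Rightarrow>\<^sub>0 'k) module" where
  "free_algebra = monoid_algebra free_monoid"

definition presented :: "('x list \<Rightarrow>\<^sub>0 'k::field) set \<Rightarrow> ('k, ('x list \<Rightarrow>\<^sub>0 'k) set) module" where
  "presented R = quot_algebra free_algebra (Idl\<^bsub>free_algebra\<^esub> R)"

definition presented_gen :: "('x list \<Rightarrow>\<^sub>0 'k::field) set \<Rightarrow> 'x \<Rightarrow> ('x list \<Rightarrow>\<^sub>0 'k) set" where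
  "presented_gen R x = Idl\<^bsub>free_algebra\<^esub> R +>\<^bsub>free_algebra\<^esub> Poly_Mapping.single [x] 1"

fun comult_on_gen ::
    "('k::field, 'a, 'm) module_scheme \<Rightarrow> ('i gen \<Rightarrow> 'a) \<Rightarrow> 'i gen \<Rightarrow> ('a \<times> 'a \<Rightarrow>\<^sub>0 'k) set" where
  "comult_on_gen A g (E i) =
     pure_tensor A A (g (E i)) \<one>\<^bsub>A\<^esub> \<oplus>\<^bsub>tensor A A\<^esub> pure_tensor A A (g (K i)) (g (E i))"
| "comult_on_gen A g (F i) =
     pure_tensor A A \<one>\<^bsub>A\<^esub> (g (F i)) \<oplus>\<^bsub>tensor A A\<^esub> pure_tensor A A (g (F i)) (g (K' i))"
| "comult_on_gen A g (K i) = pure_tensor A A (g (K i)) (g (K i))"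
| "comult_on_gen A g (Kinv i) = pure_tensor A A (g (Kinv i)) (g (Kinv i))"
| "comult_on_gen A g (K' i) = pure_tensor A A (g (K' i)) (g (K' i))"
| "comult_on_gen A g (Kinv' i) = pure_tensor A A (g (Kinv' i)) (g (Kinv' i))"

fun counit_on_gen :: "'i gen \<Rightarrow> 'k::field" where
  "counit_on_gen (E i) = 0"
| "counit_on_gen (F i) = 0"
| "counit_on_gen (K i) = 1"
| "counit_on_gen (Kinv i) = 1"
| "counit_on_gen (K' i) = 1"
| "counit_on_gen (Kinv' i) = 1"

fun antipode_on_gen :: "('k::field, 'a, 'm) module_scheme \<Rightarrow> ('i gen \<Rightarrow> 'a) \<Rightarrow> 'i gen \<Rightarrow> 'a" where
  "antipode_on_gen A g (E i) = \<ominus>\<^bsub>A\<^esub> (g (Kinv i) \<otimes>\<^bsub>A\<^esub> g (E i))"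
| "antipode_on_gen A g (F i) = \<ominus>\<^bsub>A\<^esub> (g (F i) \<otimes>\<^bsub>A\<^esub> g (Kinv' i))"
| "antipode_on_gen A g (K i) = g (Kinv i)"
| "antipode_on_gen A g (Kinv i) = g (K i)"
| "antipode_on_gen A g (K' i) = g (Kinv' i)"
| "antipode_on_gen A g (Kinv' i) = g (K' i)"

text \<open>
  The Hopf structure on an algebra \<open>A\<close> generated by \<open>g\<close>: the algebra homomorphisms \<open>\<Delta>\<close>, \<open>\<epsilon>\<close> and the
  algebra antihomomorphism \<open>S\<close> determined by their values on generators.
  Membership in \<^const>\<open>extensional\<close> only fixes the irrelevant values outside the carrier, so that
  there is at most one such map.
\<close>

definition hopf_on_gens ::
    "('k::field, 'a) module \<Rightarrow> ('i gen \<Rightarrow> 'a) \<Rightarrow> ('k, 'a) hopf" where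
  "hopf_on_gens A g =
     module.extend A (hopf.fields
       (THE \<Delta>. \<Delta> \<in> alg_hom A (tensor A A) \<inter> extensional (carrier A) \<and>
          (\<forall>x. \<Delta> (g x) = comult_on_gen A g x))
       (THE \<epsilon>. \<epsilon> \<in> alg_hom A (scalar_algebra id) \<inter> extensional (carrier A) \<and>
          (\<forall>x. \<epsilon> (g x) = counit_on_gen x))
       (THE S. S \<in> alg_hom A (opposite A) \<inter> extensional (carrier A) \<and>
          (\<forall>x. S (g x) = antipode_on_gen A g x)))"


section \<open>The datum and its bilinear forms\<close>

definition cartan_matrix_datum :: "('i::finite \<Rightarrow> 'i \<Rightarrow> int) \<Rightarrow> bool" where
  "cartan_matrix_datum \<Omega> \<longleftrightarrow>
     (\<forall>i. \<Omega> i i > 0) \<and> (\<forall>i j. i \<noteq> j \<longrightarrow> \<Omega> i j \<le> 0) \<and>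
     (\<forall>i j. i \<noteq> j \<longrightarrow> \<Omega> i i dvd \<Omega> i j + \<Omega> j i \<and> (\<Omega> i j + \<Omega> j i) div \<Omega> i i \<le> 0) \<and>
     (GCD i. \<Omega> i i) = 1"

definition dot :: "('i \<Rightarrow> 'i \<Rightarrow> int) \<Rightarrow> 'i \<Rightarrow> 'i \<Rightarrow> int" where
  "dot \<Omega> i j = \<Omega> i j + \<Omega> j i"

definition sq_form :: "('i \<Rightarrow> 'i \<Rightarrow> int) \<Rightarrow> 'i \<Rightarrow> 'i \<Rightarrow> int" where
  "sq_form \<Omega> i j = (if i = j then 2 * \<Omega> i i else 0) - \<Omega> i j"

definition bilinear_ext :: "('i::finite \<Rightarrow> 'i \<Rightarrow> int) \<Rightarrow> ('i \<Rightarrow> int) \<Rightarrow> ('i \<Rightarrow> int) \<Rightarrow> int" where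
  "bilinear_ext b \<mu> \<nu> = (\<Sum>i\<in>UNIV. \<Sum>j\<in>UNIV. \<mu> i * \<nu> j * b i j)"

text \<open>\<open>a\<^sub>i\<^sub>j = 2 (i \<cdot> j) / (i \<cdot> i)\<close>, for a Cartan datum an integer.\<close>

definition cartan_int :: "('i \<Rightarrow> 'i \<Rightarrow> int) \<Rightarrow> 'i \<Rightarrow> 'i \<Rightarrow> int" where
  "cartan_int d i j = (2 * d i j) div d i i"


section \<open>Relations common to both algebras\<close>

definition quantum_int :: "'k::field \<Rightarrow> nat \<Rightarrow> 'k" where
  "quantum_int v n = (v ^ n - inverse v ^ n) / (v - inverse v)"

definition quantum_fact :: "'k::field \<Rightarrow> nat \<Rightarrow> 'k" where
  "quantum_fact v n = (\<Prod>m=1..n. quantum_int v m)"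

definition quantum_binomial :: "'k::field \<Rightarrow> nat \<Rightarrow> nat \<Rightarrow> 'k" where
  "quantum_binomial v n m = quantum_fact v n / (quantum_fact v m * quantum_fact v (n - m))"

definition quantum_int2 :: "'k::field \<Rightarrow> 'k \<Rightarrow> nat \<Rightarrow> 'k" where
  "quantum_int2 v t n =
     ((v * t) ^ n - inverse (v * inverse t) ^ n) / (v * t - inverse (v * inverse t))"

definition quantum_fact2 :: "'k::field \<Rightarrow> 'k \<Rightarrow> nat \<Rightarrow> 'k" where
  "quantum_fact2 v t n = (\<Prod>m=1..n. quantum_int2 v t m)"

text \<open>\<open>root_power d x i\<close> is \<open>x\<^sub>i = x\<^bsup>i \<cdot> i / 2\<^esup>\<close>.\<close>

definition root_power :: "('i \<Rightarrow> 'i \<Rightarrow> int) \<Rightarrow> 'k::field \<Rightarrow> 'i \<Rightarrow> 'k" where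
  "root_power d x i = x powi (d i i div 2)"

definition torus_gens :: "'i gen set" where
  "torus_gens = range K \<union> range Kinv \<union> range K' \<union> range Kinv'"

text \<open>An equation \<open>x = y\<close> between elements of the free algebra enters as \<open>x - y\<close>.\<close>

definition torus_rels :: "('i gen list \<Rightarrow>\<^sub>0 'k::field) set" where
  "torus_rels =
     {Poly_Mapping.single [x, y] 1 - Poly_Mapping.single [y, x] 1
      | x y. x \<in> torus_gens \<and> y \<in> torus_gens} \<union>
     {Poly_Mapping.single [K i, Kinv i] 1 - Poly_Mapping.single [] 1 | i. True} \<union>
     {Poly_Mapping.single [K' i, Kinv' i] 1 - Poly_Mapping.single [] 1 | i. True}"

definition commutator_rels ::
    "('i \<Rightarrow> 'i \<Rightarrow> int) \<Rightarrow> 'k::field \<Rightarrow> ('i gen list \<Rightarrow>\<^sub>0 'k) set" where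
  "commutator_rels d v =
     {Poly_Mapping.single [E i, F j] 1 - Poly_Mapping.single [F j, E i] 1 -
        (if i = j then
           (let c = 1 / (root_power d v i - inverse (root_power d v i)) in
            Poly_Mapping.single [K i] c - Poly_Mapping.single [K' i] c)
         else 0)
      | i j. True}"


section \<open>The one-parameter algebra\<close>

type_synonym Qv = "rat poly fract"

text \<open>\<open>\<rat>(v, t)\<close> is realised as the field \<open>\<rat>(v)(t)\<close> of rational functions in \<open>t\<close> over \<open>\<rat>(v)\<close>.\<close>

type_synonym Qvt = "Qv poly fract"

definition Qv_in_Qvt :: "Qv \<Rightarrow> Qvt" where
  "Qv_in_Qvt c = to_fract [:c:]"

definition v1 :: Qv where
  "v1 = to_fract [:0, 1:]"

definition rels1 :: "('i \<Rightarrow> 'i \<Rightarrow> int) \<Rightarrow> ('i gen list \<Rightarrow>\<^sub>0 Qv) set" where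
  "rels1 d =
     torus_rels \<union>
     {Poly_Mapping.single [K i, E j, Kinv i] 1
        - Poly_Mapping.single [E j] (v1 powi d i j) | i j. True} \<union>
     {Poly_Mapping.single [K' i, E j, Kinv' i] 1
        - Poly_Mapping.single [E j] (v1 powi (- d i j)) | i j. True} \<union>
     {Poly_Mapping.single [K i, F j, Kinv i] 1
        - Poly_Mapping.single [F j] (v1 powi (- d i j)) | i j. True} \<union>
     {Poly_Mapping.single [K' i, F j, Kinv' i] 1
        - Poly_Mapping.single [F j] (v1 powi d i j) | i j. True} \<union>
     commutator_rels d v1 \<union>
     {(\<Sum>p\<le>n. Poly_Mapping.single (replicate p (Z i) @ [Z j] @ replicate (n - p) (Z i))
          ((-1) ^ p * quantum_binomial (root_power d v1 i) n p))
      | Z i j n. Z \<in> {E, F} \<and> i \<noteq> j \<and> n = nat (1 - cartan_int d i j)}"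

definition U1 :: "('i \<Rightarrow> 'i \<Rightarrow> int) \<Rightarrow> (Qv, ('i gen list \<Rightarrow>\<^sub>0 Qv) set) hopf" where
  "U1 d = hopf_on_gens (presented (rels1 d)) (presented_gen (rels1 d))"

text \<open>\<open>U\<^sub>v\<^sub>,\<^sub>t(I, \<cdot>)\<close> with its extended Hopf structure, and its generators.\<close>

definition U1_vt ::
    "('i \<Rightarrow> 'i \<Rightarrow> int) \<Rightarrow> (Qvt, (('i gen list \<Rightarrow>\<^sub>0 Qv) set \<times> Qvt \<Rightarrow>\<^sub>0 Qv) set) hopf" where
  "U1_vt d = extend_hopf Qv_in_Qvt (U1 d)"

definition U1_vt_gen ::
    "('i \<Rightarrow> 'i \<Rightarrow> int) \<Rightarrow> 'i gen \<Rightarrow> (('i gen list \<Rightarrow>\<^sub>0 Qv) set \<times> Qvt \<Rightarrow>\<^sub>0 Qv) set" where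
  "U1_vt_gen d x = extend_elem Qv_in_Qvt (U1 d) (presented_gen (rels1 d) x)"


section \<open>The two-parameter algebra\<close>

definition v2 :: Qvt where
  "v2 = Qv_in_Qvt v1"

definition t2 :: Qvt where
  "t2 = to_fract [:0, 1:]"

text \<open>
  In the Serre relations \<open>t\<^sub>i\<close> occurs with the exponent
  \<open>- p (p' - 2 \<langle>i, j\<rangle> / (i \<cdot> i) + 2 \<langle>j, i\<rangle> / (i \<cdot> i))\<close>, which need not be an integer.  As
  \<open>t\<^sub>i = t\<^bsup>i \<cdot> i / 2\<^esup>\<close>, the power meant is
  \<open>t\<close> to the integer \<open>- p (p' (i \<cdot> i / 2) - \<langle>i, j\<rangle> + \<langle>j, i\<rangle>)\<close>.
  The coefficients \<open>1 / [p]! [p']!\<close> come from the divided powers.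
\<close>

definition serre2_coeff :: "('i \<Rightarrow> 'i \<Rightarrow> int) \<Rightarrow> 'i \<Rightarrow> 'i \<Rightarrow> nat \<Rightarrow> nat \<Rightarrow> Qvt" where
  "serre2_coeff \<Omega> i j p p' =
     (let d = dot \<Omega>; q = quantum_fact2 (root_power d v2 i) (root_power d t2 i) in
      (-1) ^ p * t2 powi (- (int p * (int p' * (d i i div 2) - \<Omega> i j + \<Omega> j i)))
        / (q p * q p'))"

definition rels2 :: "('i \<Rightarrow> 'i \<Rightarrow> int) \<Rightarrow> ('i gen list \<Rightarrow>\<^sub>0 Qvt) set" where
  "rels2 \<Omega> =
     torus_rels \<union>
     {Poly_Mapping.single [K i, E j, Kinv i] 1
        - Poly_Mapping.single [E j] (v2 powi dot \<Omega> i j * t2 powi (\<Omega> i j - \<Omega> j i)) | i j. True} \<union>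
     {Poly_Mapping.single [K' i, E j, Kinv' i] 1
        - Poly_Mapping.single [E j] (v2 powi (- dot \<Omega> i j) * t2 powi (\<Omega> i j - \<Omega> j i)) | i j. True} \<union>
     {Poly_Mapping.single [K i, F j, Kinv i] 1
        - Poly_Mapping.single [F j] (v2 powi (- dot \<Omega> i j) * t2 powi (\<Omega> j i - \<Omega> i j)) | i j. True} \<union>
     {Poly_Mapping.single [K' i, F j, Kinv' i] 1
        - Poly_Mapping.single [F j] (v2 powi dot \<Omega> i j * t2 powi (\<Omega> j i - \<Omega> i j)) | i j. True} \<union>
     commutator_rels (dot \<Omega>) v2 \<union>
     {(\<Sum>p\<le>n. Poly_Mapping.single (replicate (n - p) (E i) @ [E j] @ replicate p (E i))
          (serre2_coeff \<Omega> i j p (n - p)))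
      | i j n. i \<noteq> j \<and> n = nat (1 - cartan_int (dot \<Omega>) i j)} \<union>
     {(\<Sum>p\<le>n. Poly_Mapping.single (replicate p (F i) @ [F j] @ replicate (n - p) (F i))
          (serre2_coeff \<Omega> i j p (n - p)))
      | i j n. i \<noteq> j \<and> n = nat (1 - cartan_int (dot \<Omega>) i j)}"

definition U2 :: "('i \<Rightarrow> 'i \<Rightarrow> int) \<Rightarrow> (Qvt, ('i gen list \<Rightarrow>\<^sub>0 Qvt) set) module" where
  "U2 \<Omega> = presented (rels2 \<Omega>)"

definition U2_gen :: "('i \<Rightarrow> 'i \<Rightarrow> int) \<Rightarrow> 'i gen \<Rightarrow> ('i gen list \<Rightarrow>\<^sub>0 Qvt) set" where
  "U2_gen \<Omega> = presented_gen (rels2 \<Omega>)"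


section \<open>The twisted product\<close>

definition unit_vec :: "'i \<Rightarrow> 'i \<Rightarrow> int" where
  "unit_vec i j = (if i = j then 1 else 0)"

fun gen_deg :: "'i gen \<Rightarrow> ('i \<Rightarrow> int) \<times> ('i \<Rightarrow> int)" where
  "gen_deg (E i) = (unit_vec i, \<lambda>_. 0)"
| "gen_deg (F i) = (\<lambda>_. 0, unit_vec i)"
| "gen_deg (K i) = (unit_vec i, unit_vec i)"
| "gen_deg (K' i) = (unit_vec i, unit_vec i)"
| "gen_deg (Kinv i) = (\<lambda>j. - unit_vec i j, \<lambda>j. - unit_vec i j)"
| "gen_deg (Kinv' i) = (\<lambda>j. - unit_vec i j, \<lambda>j. - unit_vec i j)"

definition word_deg :: "'i gen list \<Rightarrow> ('i \<Rightarrow> int) \<times> ('i \<Rightarrow> int)" where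
  "word_deg w = (\<lambda>j. \<Sum>x\<leftarrow>w. fst (gen_deg x) j, \<lambda>j. \<Sum>x\<leftarrow>w. snd (gen_deg x) j)"

definition deg_form :: "('i::finite \<Rightarrow> 'i \<Rightarrow> int)
    \<Rightarrow> ('i \<Rightarrow> int) \<times> ('i \<Rightarrow> int) \<Rightarrow> ('i \<Rightarrow> int) \<times> ('i \<Rightarrow> int) \<Rightarrow> int" where
  "deg_form \<Omega> \<gamma> \<eta> =
     bilinear_ext (sq_form \<Omega>) (snd \<gamma>) (snd \<eta>) - bilinear_ext (sq_form \<Omega>) (fst \<gamma>) (fst \<eta>)"

text \<open>
  The grading of \<open>U\<^sub>v\<^sub>,\<^sub>t\<close> is induced by the grading of the free algebra by \<^const>\<open>word_deg\<close>,
  since the defining relations are homogeneous.  So the twisted product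
  \<open>x * y = t\<^bsup>-[|x|, |y|]'\<^esup> x y\<close> of homogeneous elements, extended bilinearly, is computed on
  representatives in the free algebra (cf. \<^const>\<open>rcoset_mult\<close> for the untwisted one), where words are
  homogeneous.
\<close>

definition free_star ::
    "('i::finite \<Rightarrow> 'i \<Rightarrow> int) \<Rightarrow> ('i gen list \<Rightarrow>\<^sub>0 Qvt) \<Rightarrow> ('i gen list \<Rightarrow>\<^sub>0 Qvt) \<Rightarrow> 'i gen list \<Rightarrow>\<^sub>0 Qvt" where
  "free_star \<Omega> f g =
     (\<Sum>x\<in>Poly_Mapping.keys f. \<Sum>y\<in>Poly_Mapping.keys g. Poly_Mapping.single (x @ y)
        (t2 powi (- deg_form \<Omega> (word_deg x) (word_deg y))
          * Poly_Mapping.lookup f x * Poly_Mapping.lookup g y))"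

definition U2_star_algebra ::
    "('i::finite \<Rightarrow> 'i \<Rightarrow> int) \<Rightarrow> (Qvt, ('i gen list \<Rightarrow>\<^sub>0 Qvt) set) module" where
  "U2_star_algebra \<Omega> =
     (U2 \<Omega>)\<lparr>monoid.mult := \<lambda>Y Z. \<Union>x\<in>Y. \<Union>y\<in>Z. Idl\<^bsub>free_algebra\<^esub> (rels2 \<Omega>) +>\<^bsub>free_algebra\<^esub> free_star \<Omega> x y\<rparr>"

definition U2_star :: "('i::finite \<Rightarrow> 'i \<Rightarrow> int) \<Rightarrow> (Qvt, ('i gen list \<Rightarrow>\<^sub>0 Qvt) set) hopf" where
  "U2_star \<Omega> = hopf_on_gens (U2_star_algebra \<Omega>) (U2_gen \<Omega>)"

end

theory Submission
  imports Defs
begin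

text \<open>
  The form \<open>deg_form\<close> is bilinear in the degrees, so on the free algebra the twist is the coboundary of
  \<open>w \<mapsto> t\<^bsup>\<sigma>(w)\<^esup>\<close>, and \<open>w \<mapsto> t\<^bsup>\<sigma>(w)\<^esup> w\<close> is an isomorphism from the free algebra with concatenation to
  the free algebra with the twisted product.  It carries each defining relation of the one-parameter
  algebra to a multiple of a defining relation of the two-parameter algebra.  These relations are
  homogeneous, hence generate the same ideal for either product, and the isomorphism of algebras
  follows.

  The Hopf structure is constructed only once, for the one-parameter algebra over \<open>\<rat>(v)\<close>; extension of
  scalars and the isomorphism carry it to the two algebras of the theorem, since all its axioms and the
  compatibility of the isomorphism can be checked on generators.  For the quantum Serre relations this
  uses that the Serre sum is an iterated skew commutator of \<open>x\<close> with \<open>y\<close>: the coproduct of the \<open>m\<close>-fold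
  skew commutator has explicit coefficients, and for \<open>m = 1 - a\<^sub>i\<^sub>j\<close> those of the mixed terms vanish.
\<close>

text \<open>Neither algebra is given by a basis, so bijectivity comes from two homomorphisms that
  invert each other on generators. Each needs the relations of one algebra expressed by those of the
  other; hence relations are compared in both directions, up to nonzero scalars.

  The form [i,j] has diagonal entries \<Omega>_ii and off-diagonal entries -\<Omega>_ij. The
  differences [i,j] - [j,i] = \<Omega>_ji - \<Omega>_ij account for the powers of t in (R2), and the
  diagonal for the powers of t by which the factorials in v and t differ from those in v alone.
  Torus generators have degrees (\<mu>,\<mu>), on which the two halves of [ , ]' cancel, so torus
  relations are untouched.

  The structure maps of \<open>hopf_on_gens\<close> are definite descriptions: nothing can be said
  about them before homomorphisms with the prescribed values are exhibited. Over Q(v) the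
  presentation supplies them once the images of the generators satisfy the relations. For U_{v,t}
  they are conjugates of the maps on the other side, so the algebra isomorphism has to come before
  the Hopf structure.\<close>

abbreviation "single \<equiv> Poly_Mapping.single"
abbreviation "keys \<equiv> Poly_Mapping.keys"
abbreviation "lookup \<equiv> Poly_Mapping.lookup"

section \<open>Associative algebras\<close>

lemma ring_of_type_algebra_simps [simp]:
  "carrier ring_of_type_algebra = UNIV"
  "x \<otimes>\<^bsub>ring_of_type_algebra\<^esub> y = x * y"
  "\<one>\<^bsub>ring_of_type_algebra\<^esub> = 1"
  "\<zero>\<^bsub>ring_of_type_algebra\<^esub> = 0"
  "x \<oplus>\<^bsub>ring_of_type_algebra\<^esub> y = x + y"
  by (simp_all add: ring_of_type_algebra_def)

lemma assoc_algebraI: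
  fixes A :: "('k::field, 'a, 'm) module_scheme" (structure)
  assumes "ring A"
    "\<And>c x. x \<in> carrier A \<Longrightarrow> c \<odot> x \<in> carrier A"
    "\<And>c d x. x \<in> carrier A \<Longrightarrow> (c + d) \<odot> x = c \<odot> x \<oplus> d \<odot> x"
    "\<And>c x y. x \<in> carrier A \<Longrightarrow> y \<in> carrier A \<Longrightarrow> c \<odot> (x \<oplus> y) = c \<odot> x \<oplus> c \<odot> y"
    "\<And>c d x. x \<in> carrier A \<Longrightarrow> (c * d) \<odot> x = c \<odot> (d \<odot> x)"
    "\<And>x. x \<in> carrier A \<Longrightarrow> 1 \<odot> x = x"
    "\<And>c x y. x \<in> carrier A \<Longrightarrow> y \<in> carrier A \<Longrightarrow> (c \<odot> x) \<otimes> y = c \<odot> (x \<otimes> y)"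
    "\<And>c x y. x \<in> carrier A \<Longrightarrow> y \<in> carrier A \<Longrightarrow> x \<otimes> (c \<odot> y) = c \<odot> (x \<otimes> y)"
  shows "assoc_algebra A"
proof -
  have "cring (ring_of_type_algebra :: 'k ring)" by rule
  moreover have "abelian_group A" using assms(1) by (rule ring.axioms)
  ultimately have "module (ring_of_type_algebra :: 'k ring) A"
    using assms by (intro moduleI) simp_all
  then show ?thesis using assms by (simp add: assoc_algebra_def)
qed

locale alg =
  fixes A :: "('k::field, 'a, 'm) module_scheme" (structure)
  assumes assoc_algebra: "assoc_algebra A"
begin

sublocale ring A
  using assoc_algebra by (simp add: assoc_algebra_def)

lemma module: "module (ring_of_type_algebra :: 'k ring) A"
  using assoc_algebra by (simp add: assoc_algebra_def)

lemma smult_cl [simp, intro]: "x \<in> carrier A \<Longrightarrow> c \<odot> x \<in> carrier A"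
  using module.smult_closed[OF module] by simp

lemma smult_add_l: "x \<in> carrier A \<Longrightarrow> (c + d) \<odot> x = c \<odot> x \<oplus> d \<odot> x"
  using module.smult_l_distr[OF module] by simp

lemma smult_add_r:
  "x \<in> carrier A \<Longrightarrow> y \<in> carrier A \<Longrightarrow> c \<odot> (x \<oplus> y) = c \<odot> x \<oplus> c \<odot> y"
  using module.smult_r_distr[OF module] by simp

lemma smult_smult [simp]: "x \<in> carrier A \<Longrightarrow> c \<odot> (d \<odot> x) = (c * d) \<odot> x"
  using module.smult_assoc1[OF module] by simp

lemma one_smult [simp]: "x \<in> carrier A \<Longrightarrow> 1 \<odot> x = x"
  using module.smult_one[OF module] by simp

lemma zero_smult [simp]: "x \<in> carrier A \<Longrightarrow> 0 \<odot> x = \<zero>"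
  using module.smult_l_null[OF module] by simp

lemma smult_zero [simp]: "c \<odot> \<zero> = \<zero>"
  using module.smult_r_null[OF module] by simp

lemma smult_mult_l [simp]:
  "x \<in> carrier A \<Longrightarrow> y \<in> carrier A \<Longrightarrow> (c \<odot> x) \<otimes> y = c \<odot> (x \<otimes> y)"
  using assoc_algebra by (simp add: assoc_algebra_def)

lemma smult_mult_r [simp]:
  "x \<in> carrier A \<Longrightarrow> y \<in> carrier A \<Longrightarrow> x \<otimes> (c \<odot> y) = c \<odot> (x \<otimes> y)"
  using assoc_algebra by (simp add: assoc_algebra_def)

lemma minus_smult: "x \<in> carrier A \<Longrightarrow> (- c) \<odot> x = \<ominus> (c \<odot> x)"
  using smult_add_l[of x "- c" c] by (simp add: minus_equality)

text \<open>With negatives as multiples of -1, differences are handled by the linearity rules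
  alone.\<close>

lemma minus_eq_smult: "x \<in> carrier A \<Longrightarrow> \<ominus> x = (- 1) \<odot> x"
  by (simp add: minus_smult)

lemma smult_diff_r:
  "x \<in> carrier A \<Longrightarrow> y \<in> carrier A \<Longrightarrow> c \<odot> (x \<ominus> y) = c \<odot> x \<ominus> c \<odot> y"
  by (simp add: a_minus_def minus_eq_smult smult_add_r)

lemma smult_finsum:
  "f \<in> V \<rightarrow> carrier A \<Longrightarrow> c \<odot> (\<Oplus>x\<in>V. f x) = (\<Oplus>x\<in>V. c \<odot> f x)"
proof (induction V rule: infinite_finite_induct)
  case (insert x V)
  then have "f \<in> V \<rightarrow> carrier A" "f x \<in> carrier A" by auto
  with insert show ?case
    by (simp add: finsum_insert finsum_closed smult_add_r Pi_iff)
qed (simp_all add: finsum_infinite)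

end

section \<open>Linear extension of maps on a basis\<close>

abbreviation scale :: "'k::field \<Rightarrow> ('x \<Rightarrow>\<^sub>0 'k) \<Rightarrow> ('x \<Rightarrow>\<^sub>0 'k)" where
  "scale c \<equiv> Poly_Mapping.map ((*) c)"

lemma lookup_scale [simp]: "lookup (scale c f) x = c * lookup f x"
  by (simp add: map.rep_eq when_def)

lemma keys_scale: "keys (scale c f) \<subseteq> keys f"
  by (auto simp: in_keys_iff)

lemma scale_single [simp]: "scale c (single x d) = single x (c * d)"
  by (rule poly_mapping_eqI) (simp add: lookup_single when_def)

lemma scale_add: "scale c (f + g) = scale c f + scale c g"
  by (rule poly_mapping_eqI) (simp add: lookup_add algebra_simps)

lemma scale_zero [simp]: "scale c 0 = 0"
  by (rule poly_mapping_eqI) simp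

lemma scale_sum: "scale c (sum f V) = (\<Sum>x\<in>V. scale c (f x))"
  by (induction V rule: infinite_finite_induct) (auto simp: scale_add)

lemma scale_scale: "scale c (scale d f) = scale (c * d) f"
  by (rule poly_mapping_eqI) (simp add: mult.assoc)

lemma scale_one [simp]: "scale 1 f = f"
  by (rule poly_mapping_eqI) simp

lemma scale_minus_one: "scale (- 1) f = - f"
  by (rule poly_mapping_eqI) simp

lemma scale_diff: "scale c (f - g) = scale c f - scale c g"
  by (rule poly_mapping_eqI) (simp add: lookup_minus algebra_simps)

lemma scale_add_left: "scale (c + d) f = scale c f + scale d f"
  by (rule poly_mapping_eqI) (simp add: lookup_add algebra_simps)

lemma poly_mapping_as_sum:
  "f = (\<Sum>x\<in>keys f. single x (lookup f x))"
  by (rule poly_mapping_eqI)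
    (auto simp: lookup_sum lookup_single when_def in_keys_iff sum.delta)

text \<open>The bound on supports stays available in the sum case, because additivity of
  \<open>lin_ext\<close> is stated for supports on which the basis map takes values in the
  carrier.\<close>

lemma poly_mapping_keys_induct [consumes 1, case_names zero single add]:
  fixes f :: "'x \<Rightarrow>\<^sub>0 'k::field"
  assumes "keys f \<subseteq> S" "P 0"
    and single: "\<And>x c. x \<in> S \<Longrightarrow> P (single x c)"
    and add: "\<And>f g. keys f \<subseteq> S \<Longrightarrow> keys g \<subseteq> S \<Longrightarrow> P f \<Longrightarrow> P g \<Longrightarrow> P (f + g)"
  shows "P f"
proof -
  let ?h = "\<lambda>V. \<Sum>x\<in>V. single x (lookup f x)"
  have "P (?h V) \<and> keys (?h V) \<subseteq> S" if "V \<subseteq> keys f" for V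
    using finite_subset[OF that finite_keys] that
  proof (induction V rule: finite_induct)
    case empty
    then show ?case using assms(2) by simp
  next
    case (insert x V)
    then have x: "x \<in> S" and IH: "P (?h V)" "keys (?h V) \<subseteq> S" using assms(1) by auto
    have k: "keys (single x (lookup f x)) \<subseteq> S"
      using x by (auto simp: keys_single split: if_splits)
    from insert x IH k show ?case
      using keys_add[of "single x (lookup f x)" "?h V"]
      by (auto intro!: add single)
  qed
  from this[of "keys f"] show ?thesis
    using poly_mapping_as_sum[of f] by simp
qed

text \<open>The sum that \<open>tensor_lift\<close> evaluates on the members of a coset is of this
  form, so the facts below serve tensor products as well as presented algebras.\<close>

definition lin_ext ::
    "('k::field, 'c, 'm) module_scheme \<Rightarrow> ('x \<Rightarrow> 'c) \<Rightarrow> ('x \<Rightarrow>\<^sub>0 'k) \<Rightarrow> 'c" where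
  "lin_ext A \<beta> f =
     (\<Oplus>\<^bsub>A\<^esub>p\<in>keys f. lookup f p \<odot>\<^bsub>A\<^esub> \<beta> p)"

context alg
begin

lemma lin_ext_superset:
  assumes "finite V" "keys f \<subseteq> V" "\<beta> \<in> V \<rightarrow> carrier A"
  shows "lin_ext A \<beta> f = (\<Oplus>p\<in>V. lookup f p \<odot> \<beta> p)"
  unfolding lin_ext_def
  using assms by (intro add.finprod_mono_neutral_cong_left) (auto simp: in_keys_iff Pi_iff)

lemma lin_ext_closed [intro]:
  "keys f \<subseteq> S \<Longrightarrow> \<beta> \<in> S \<rightarrow> carrier A \<Longrightarrow> lin_ext A \<beta> f \<in> carrier A"
  unfolding lin_ext_def by (rule finsum_closed) auto

lemma lin_ext_zero [simp]: "lin_ext A \<beta> 0 = \<zero>"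
  by (simp add: lin_ext_def)

lemma lin_ext_single [simp]:
  "\<beta> x \<in> carrier A \<Longrightarrow> lin_ext A \<beta> (single x c) = c \<odot> \<beta> x"
  by (simp add: lin_ext_def keys_single)

lemma lin_ext_add:
  assumes "keys f \<subseteq> S" "keys g \<subseteq> S" "\<beta> \<in> S \<rightarrow> carrier A"
  shows "lin_ext A \<beta> (f + g) = lin_ext A \<beta> f \<oplus> lin_ext A \<beta> g"
proof -
  let ?V = "keys f \<union> keys g"
  have \<beta>: "\<beta> \<in> ?V \<rightarrow> carrier A" using assms by auto
  then have *: "\<And>p. p \<in> ?V \<Longrightarrow> \<beta> p \<in> carrier A" by blast
  have "lin_ext A \<beta> (f + g) = (\<Oplus>p\<in>?V. lookup (f + g) p \<odot> \<beta> p)"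
    by (rule lin_ext_superset[OF _ _ \<beta>]) (auto dest: subsetD[OF keys_add])
  also have "\<dots> = (\<Oplus>p\<in>?V. lookup f p \<odot> \<beta> p \<oplus> lookup g p \<odot> \<beta> p)"
    using * by (intro finsum_cong') (auto simp: lookup_add smult_add_l)
  also have "\<dots> = (\<Oplus>p\<in>?V. lookup f p \<odot> \<beta> p) \<oplus> (\<Oplus>p\<in>?V. lookup g p \<odot> \<beta> p)"
    using * by (intro finsum_addf) auto
  also have "\<dots> = lin_ext A \<beta> f \<oplus> lin_ext A \<beta> g"
    using lin_ext_superset[OF _ _ \<beta>, of f] lin_ext_superset[OF _ _ \<beta>, of g] by simp
  finally show ?thesis .
qed

lemma lin_ext_scale:
  assumes "keys f \<subseteq> S" "\<beta> \<in> S \<rightarrow> carrier A"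
  shows "lin_ext A \<beta> (scale c f) = c \<odot> lin_ext A \<beta> f"
proof -
  have \<beta>: "\<beta> \<in> keys f \<rightarrow> carrier A" using assms by auto
  then have *: "\<And>p. p \<in> keys f \<Longrightarrow> \<beta> p \<in> carrier A" by blast
  show ?thesis
    using lin_ext_superset[OF finite_keys keys_scale[of c f] \<beta>] *
    by (subst lin_ext_def) (auto simp: smult_finsum Pi_iff intro!: finsum_cong')
qed

lemma lin_ext_minus:
  assumes "keys f \<subseteq> S" "\<beta> \<in> S \<rightarrow> carrier A"
  shows "lin_ext A \<beta> (- f) = \<ominus> lin_ext A \<beta> f"
  using lin_ext_scale[OF assms, of "- 1"] lin_ext_closed[OF assms]
  by (simp add: scale_minus_one minus_eq_smult)

lemma lin_ext_diff:
  assumes "keys f \<subseteq> S" "keys g \<subseteq> S" "\<beta> \<in> S \<rightarrow> carrier A"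
  shows "lin_ext A \<beta> (f - g) = lin_ext A \<beta> f \<ominus> lin_ext A \<beta> g"
proof -
  have "keys (- g) \<subseteq> S" using assms(2) by (auto simp: in_keys_iff)
  from lin_ext_add[OF assms(1) this assms(3)] lin_ext_minus[OF assms(2,3)] show ?thesis
    by (simp add: a_minus_def)
qed

lemma lin_ext_sum:
  assumes "\<And>i. i \<in> I \<Longrightarrow> keys (f i) \<subseteq> S" "\<beta> \<in> S \<rightarrow> carrier A"
  shows "lin_ext A \<beta> (sum f I) = (\<Oplus>i\<in>I. lin_ext A \<beta> (f i))"
  using assms(1)
proof (induction I rule: infinite_finite_induct)
  case (insert i I)
  have "keys (sum f I) \<subseteq> S"
    using insert by (intro subset_trans[OF keys_sum]) auto
  with insert lin_ext_add[OF _ _ assms(2)] show ?case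
    by (subst finsum_insert) (auto intro!: lin_ext_closed[OF _ assms(2)])
qed (simp_all add: finsum_infinite)

end

section \<open>Twisted monoid algebras\<close>

text \<open>One product covers all cases: \<alpha> = 1 gives \<open>monoid_algebra\<close>, hence
  the free algebra and the algebra underlying a tensor product, and a power of t as \<alpha> gives
  \<open>free_star\<close>.\<close>

definition tw_mult ::
    "('x, 'z) monoid_scheme \<Rightarrow> ('x \<Rightarrow> 'x \<Rightarrow> 'k::field) \<Rightarrow> ('x \<Rightarrow>\<^sub>0 'k) \<Rightarrow> ('x \<Rightarrow>\<^sub>0 'k) \<Rightarrow> 'x \<Rightarrow>\<^sub>0 'k" where
  "tw_mult M \<alpha> f g = (\<Sum>x\<in>keys f. \<Sum>y\<in>keys g.
     single (x \<otimes>\<^bsub>M\<^esub> y) (\<alpha> x y * (lookup f x * lookup g y)))"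

definition tw_algebra ::
    "('x, 'z) monoid_scheme \<Rightarrow> ('x \<Rightarrow> 'x \<Rightarrow> 'k::field) \<Rightarrow> ('k, 'x \<Rightarrow>\<^sub>0 'k) module" where
  "tw_algebra M \<alpha> = (monoid_algebra M)\<lparr>monoid.mult := tw_mult M \<alpha>\<rparr>"

lemma tw_algebra_simps [simp]:
  "carrier (tw_algebra M \<alpha>) = {f. keys f \<subseteq> carrier M}"
  "monoid.mult (tw_algebra M \<alpha>) = tw_mult M \<alpha>"
  "\<one>\<^bsub>tw_algebra M \<alpha>\<^esub> = single \<one>\<^bsub>M\<^esub> 1"
  "\<zero>\<^bsub>tw_algebra M \<alpha>\<^esub> = 0"
  "ring.add (tw_algebra M \<alpha>) = (+)"
  "module.smult (tw_algebra M \<alpha>) = scale"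
  by (simp_all add: tw_algebra_def monoid_algebra_def)

lemma monoid_algebra_eq_tw_algebra: "monoid_algebra M = tw_algebra M (\<lambda>_ _. 1)"
  by (simp add: tw_algebra_def monoid_algebra_def tw_mult_def fun_eq_iff)

lemma tw_mult_superset:
  assumes "finite V" "finite W" "keys f \<subseteq> V" "keys g \<subseteq> W"
  shows "tw_mult M \<alpha> f g = (\<Sum>x\<in>V. \<Sum>y\<in>W.
     single (x \<otimes>\<^bsub>M\<^esub> y) (\<alpha> x y * (lookup f x * lookup g y)))"
  unfolding tw_mult_def using assms
  by (intro sum.mono_neutral_cong_left) (auto simp: in_keys_iff intro!: sum.mono_neutral_cong_left sum.neutral)

lemma tw_mult_single [simp]:
  "tw_mult M \<alpha> (single x c) (single y d)
    = single (x \<otimes>\<^bsub>M\<^esub> y) (\<alpha> x y * (c * d))"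
  by (subst tw_mult_superset[of "{x}" "{y}"]) (auto simp: keys_single)

lemma tw_mult_zero [simp]: "tw_mult M \<alpha> 0 g = 0" "tw_mult M \<alpha> f 0 = 0"
  by (simp_all add: tw_mult_def)

lemma tw_mult_add_l: "tw_mult M \<alpha> (f + f') g = tw_mult M \<alpha> f g + tw_mult M \<alpha> f' g"
proof -
  let ?V = "keys f \<union> keys f'"
  show ?thesis
    using keys_add[of f f']
    by (simp add: tw_mult_superset[of ?V "keys g"] lookup_add distrib_left distrib_right
        single_add sum.distrib)
qed

lemma tw_mult_add_r: "tw_mult M \<alpha> f (g + g') = tw_mult M \<alpha> f g + tw_mult M \<alpha> f g'"
proof -
  let ?V = "keys g \<union> keys g'"
  show ?thesis
    using keys_add[of g g']
    by (simp add: tw_mult_superset[of "keys f" ?V] lookup_add distrib_left distrib_right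
        single_add sum.distrib)
qed

lemma tw_mult_scale_l: "tw_mult M \<alpha> (scale c f) g = scale c (tw_mult M \<alpha> f g)"
  by (simp add: tw_mult_superset[OF _ _ keys_scale order_refl] scale_sum mult_ac)
    (simp add: tw_mult_def scale_sum mult_ac)

lemma tw_mult_scale_r: "tw_mult M \<alpha> f (scale c g) = scale c (tw_mult M \<alpha> f g)"
  by (simp add: tw_mult_superset[OF _ _ order_refl keys_scale] scale_sum mult_ac)
    (simp add: tw_mult_def scale_sum mult_ac)

text \<open>A normalised 2-cocycle: the three conditions are what associativity and the unit laws
  say on basis elements.\<close>

locale cocycle = monoid M for M :: "('x, 'z) monoid_scheme" (structure) +
  fixes \<alpha> :: "'x \<Rightarrow> 'x \<Rightarrow> 'k::field"
  assumes cocycle: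
      "\<lbrakk>x \<in> carrier M; y \<in> carrier M; z \<in> carrier M\<rbrakk> \<Longrightarrow> \<alpha> x y * \<alpha> (x \<otimes> y) z = \<alpha> x (y \<otimes> z) * \<alpha> y z"
    and cocycle_one_l: "x \<in> carrier M \<Longrightarrow> \<alpha> \<one> x = 1"
    and cocycle_one_r: "x \<in> carrier M \<Longrightarrow> \<alpha> x \<one> = 1"
begin

lemma tw_mult_keys:
  assumes "keys f \<subseteq> carrier M" "keys g \<subseteq> carrier M"
  shows "keys (tw_mult M \<alpha> f g) \<subseteq> carrier M"
  unfolding tw_mult_def using assms
  by (intro subset_trans[OF keys_sum] UN_least) (auto simp: keys_single)

lemma tw_mult_assoc:
  assumes "keys f \<subseteq> carrier M" "keys g \<subseteq> carrier M"
    "keys h \<subseteq> carrier M"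
  shows "tw_mult M \<alpha> (tw_mult M \<alpha> f g) h = tw_mult M \<alpha> f (tw_mult M \<alpha> g h)"
  using assms(1)
proof (induction f rule: poly_mapping_keys_induct)
  case (single x c)
  show ?case using assms(2)
  proof (induction g rule: poly_mapping_keys_induct)
    case (single y d)
    show ?case using assms(3)
    proof (induction h rule: poly_mapping_keys_induct)
      case (single z e)
      have "\<alpha> (x \<otimes> y) z * (\<alpha> x y * (c * d) * e) = (\<alpha> x y * \<alpha> (x \<otimes> y) z) * (c * d * e)"
        by (simp add: algebra_simps)
      also have "\<dots> = \<alpha> x (y \<otimes> z) * (c * (\<alpha> y z * (d * e)))"
        using \<open>x \<in> carrier M\<close> \<open>y \<in> carrier M\<close> \<open>z \<in> carrier M\<close>
        by (simp add: cocycle algebra_simps)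
      finally have eq: "\<alpha> (x \<otimes> y) z * (\<alpha> x y * (c * d) * e) = \<dots>" .
      show ?case
        using \<open>x \<in> carrier M\<close> \<open>y \<in> carrier M\<close> \<open>z \<in> carrier M\<close> by (simp add: m_assoc eq)
    qed (simp_all add: tw_mult_add_r)
  qed (simp_all add: tw_mult_add_l tw_mult_add_r)
qed (simp_all add: tw_mult_add_l)

lemma tw_mult_one:
  assumes "keys f \<subseteq> carrier M"
  shows "tw_mult M \<alpha> (single \<one> 1) f = f" "tw_mult M \<alpha> f (single \<one> 1) = f"
  using assms
  by (induction f rule: poly_mapping_keys_induct)
    (simp_all add: tw_mult_add_l tw_mult_add_r cocycle_one_l cocycle_one_r)

lemma tw_algebra_assoc_algebra: "assoc_algebra (tw_algebra M \<alpha>)"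
proof (rule assoc_algebraI)
  have neg: "keys (- f) = keys f" for f :: "'x \<Rightarrow>\<^sub>0 'k"
    by (auto simp: in_keys_iff)
  show "ring (tw_algebra M \<alpha>)"
  proof (rule ringI)
    show "abelian_group (tw_algebra M \<alpha>)"
    proof (rule abelian_groupI)
      fix f assume "f \<in> carrier (tw_algebra M \<alpha>)"
      then show "\<exists>g\<in>carrier (tw_algebra M \<alpha>). g \<oplus>\<^bsub>tw_algebra M \<alpha>\<^esub> f = \<zero>\<^bsub>tw_algebra M \<alpha>\<^esub>"
        by (intro bexI[of _ "- f"]) (simp_all add: neg)
    qed (use keys_add in \<open>fastforce simp: add_ac\<close>)+
    show "monoid (tw_algebra M \<alpha>)"
      by (rule monoidI) (auto simp: tw_mult_assoc tw_mult_one keys_single dest: subsetD[OF tw_mult_keys])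
  qed (simp_all add: tw_mult_add_l tw_mult_add_r)
qed (use keys_scale in \<open>fastforce simp: tw_mult_scale_l tw_mult_scale_r scale_add scale_add_left scale_scale\<close>)+

end

lemma (in monoid) cocycle_trivial: "cocycle G (\<lambda>_ _. 1)"
  by unfold_locales simp_all

section \<open>Homomorphisms of algebras, in particular out of a twisted monoid algebra\<close>

lemma alg_homI:
  assumes "h \<in> carrier A \<rightarrow> carrier B"
    "\<And>x y. x \<in> carrier A \<Longrightarrow> y \<in> carrier A \<Longrightarrow> h (x \<oplus>\<^bsub>A\<^esub> y) = h x \<oplus>\<^bsub>B\<^esub> h y"
    "\<And>x y. x \<in> carrier A \<Longrightarrow> y \<in> carrier A \<Longrightarrow> h (x \<otimes>\<^bsub>A\<^esub> y) = h x \<otimes>\<^bsub>B\<^esub> h y"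
    "h \<one>\<^bsub>A\<^esub> = \<one>\<^bsub>B\<^esub>"
    "\<And>c x. x \<in> carrier A \<Longrightarrow> h (c \<odot>\<^bsub>A\<^esub> x) = c \<odot>\<^bsub>B\<^esub> h x"
  shows "h \<in> alg_hom A B"
  using assms by (auto simp: alg_hom_def ring_hom_def)

lemma alg_homD:
  assumes "h \<in> alg_hom A B"
  shows "x \<in> carrier A \<Longrightarrow> h x \<in> carrier B"
    "x \<in> carrier A \<Longrightarrow> y \<in> carrier A \<Longrightarrow> h (x \<oplus>\<^bsub>A\<^esub> y) = h x \<oplus>\<^bsub>B\<^esub> h y"
    "x \<in> carrier A \<Longrightarrow> y \<in> carrier A \<Longrightarrow> h (x \<otimes>\<^bsub>A\<^esub> y) = h x \<otimes>\<^bsub>B\<^esub> h y"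
    "h \<one>\<^bsub>A\<^esub> = \<one>\<^bsub>B\<^esub>"
    "x \<in> carrier A \<Longrightarrow> h (c \<odot>\<^bsub>A\<^esub> x) = c \<odot>\<^bsub>B\<^esub> h x"
  using assms by (auto simp: alg_hom_def ring_hom_def)

text \<open>The condition on \<beta> says that it is a projective representation of the monoid with
  cocycle \<alpha>; bilinearity of the twisted product reduces multiplicativity to this.\<close>

lemma lin_ext_alg_hom:
  assumes "cocycle M \<alpha>" "assoc_algebra A"
    and \<beta>: "\<beta> \<in> carrier M \<rightarrow> carrier A"
    and one: "\<beta> \<one>\<^bsub>M\<^esub> = \<one>\<^bsub>A\<^esub>"
    and mult: "\<And>x y. x \<in> carrier M \<Longrightarrow> y \<in> carrier M \<Longrightarrow> \<alpha> x y \<odot>\<^bsub>A\<^esub> \<beta> (x \<otimes>\<^bsub>M\<^esub> y) = \<beta> x \<otimes>\<^bsub>A\<^esub> \<beta> y"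
  shows "lin_ext A \<beta> \<in> alg_hom (tw_algebra M \<alpha>) A"
proof -
  interpret cocycle M \<alpha> by fact
  interpret A: alg A by unfold_locales fact
  have c: "\<beta> x \<in> carrier A" if "x \<in> carrier M" for x using that \<beta> by auto
  note cl = A.lin_ext_closed[OF _ \<beta>]
  show ?thesis
  proof (rule alg_homI)
    fix f g assume "f \<in> carrier (tw_algebra M \<alpha>)" "g \<in> carrier (tw_algebra M \<alpha>)"
    then have f: "keys f \<subseteq> carrier M" and g: "keys g \<subseteq> carrier M" by auto
    from f have "lin_ext A \<beta> (tw_mult M \<alpha> f g) = lin_ext A \<beta> f \<otimes>\<^bsub>A\<^esub> lin_ext A \<beta> g"
    proof (induction f rule: poly_mapping_keys_induct)
      case (single x a)
      from g show ?case
      proof (induction g rule: poly_mapping_keys_induct)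
        case (single y b)
        with \<open>x \<in> carrier M\<close> have "\<beta> x \<otimes>\<^bsub>A\<^esub> \<beta> y = \<alpha> x y \<odot>\<^bsub>A\<^esub> \<beta> (x \<otimes>\<^bsub>M\<^esub> y)"
          by (simp add: mult)
        with single \<open>x \<in> carrier M\<close> show ?case by (simp add: c mult_ac)
      next
        case (add g g')
        then show ?case using \<open>x \<in> carrier M\<close>
          by (simp add: tw_mult_add_r A.lin_ext_add[OF tw_mult_keys tw_mult_keys \<beta>] A.lin_ext_add[OF _ _ \<beta>]
              keys_single c cl A.r_distr)
      qed (use \<open>x \<in> carrier M\<close> in \<open>simp add: c\<close>)
    next
      case (add f f')
      then show ?case using g
        by (simp add: tw_mult_add_l A.lin_ext_add[OF tw_mult_keys tw_mult_keys \<beta>] A.lin_ext_add[OF _ _ \<beta>]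
            cl A.l_distr)
    qed (use g in \<open>simp add: cl\<close>)
    then show "lin_ext A \<beta> (f \<otimes>\<^bsub>tw_algebra M \<alpha>\<^esub> g) = lin_ext A \<beta> f \<otimes>\<^bsub>A\<^esub> lin_ext A \<beta> g" by simp
  qed (use \<beta> in \<open>auto simp: one A.lin_ext_add A.lin_ext_scale intro: cl\<close>)
qed

section \<open>Quotients, opposites and change of scalars\<close>

lemma with_smult_simps [simp]:
  "carrier (with_smult R s) = carrier R"
  "monoid.mult (with_smult R s) = monoid.mult R"
  "\<one>\<^bsub>with_smult R s\<^esub> = \<one>\<^bsub>R\<^esub>"
  "\<zero>\<^bsub>with_smult R s\<^esub> = \<zero>\<^bsub>R\<^esub>"
  "ring.add (with_smult R s) = ring.add R"
  "module.smult (with_smult R s) = s"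
  by (simp_all add: with_smult_def ring.defs module.defs)

lemma ring_with_smult:
  assumes "ring R"
  shows "ring (with_smult R s)"
proof -
  interpret ring R by fact
  show ?thesis
  proof (rule ringI)
    show "abelian_group (with_smult R s)"
      by (rule abelian_groupI) (auto simp: a_ac intro: l_neg)
    show "monoid (with_smult R s)" by (rule monoidI) (auto simp: m_assoc)
  qed (auto simp: l_distr r_distr)
qed

lemma opposite_simps [simp]:
  "carrier (opposite A) = carrier A"
  "x \<otimes>\<^bsub>opposite A\<^esub> y = y \<otimes>\<^bsub>A\<^esub> x"
  "\<one>\<^bsub>opposite A\<^esub> = \<one>\<^bsub>A\<^esub>"
  "\<zero>\<^bsub>opposite A\<^esub> = \<zero>\<^bsub>A\<^esub>"
  "x \<oplus>\<^bsub>opposite A\<^esub> y = x \<oplus>\<^bsub>A\<^esub> y"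
  "c \<odot>\<^bsub>opposite A\<^esub> x = c \<odot>\<^bsub>A\<^esub> x"
  by (simp_all add: opposite_def)

lemma (in alg) opposite_assoc_algebra: "assoc_algebra (opposite A)"
proof (rule assoc_algebraI)
  show "ring (opposite A)"
  proof (rule ringI)
    show "abelian_group (opposite A)"
      by (rule abelian_groupI) (auto simp: a_ac intro: l_neg)
    show "monoid (opposite A)" by (rule monoidI) (auto simp: m_assoc)
  qed (auto simp: l_distr r_distr)
qed (auto simp: smult_add_l smult_add_r)

section \<open>Change of scalars along a field homomorphism\<close>

locale field_hom =
  fixes \<sigma> :: "'k::field \<Rightarrow> 'l::field"
  assumes hom_add: "\<sigma> (x + y) = \<sigma> x + \<sigma> y"
    and hom_mult: "\<sigma> (x * y) = \<sigma> x * \<sigma> y"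
    and hom_one [simp]: "\<sigma> 1 = 1"
begin

lemma hom_zero [simp]: "\<sigma> 0 = 0"
  by (metis add_cancel_right_right add_0 hom_add)

lemma hom_minus: "\<sigma> (- x) = - \<sigma> x"
  using hom_add[of x "- x"] by (simp add: eq_neg_iff_add_eq_0 add.commute)

lemma hom_diff: "\<sigma> (x - y) = \<sigma> x - \<sigma> y"
  using hom_add[of x "- y"] by (simp add: hom_minus)

lemma hom_inverse: "\<sigma> (inverse x) = inverse (\<sigma> x)"
proof (cases "x = 0")
  case False
  then have "\<sigma> x * \<sigma> (inverse x) = 1" by (simp flip: hom_mult)
  then show ?thesis by (simp add: inverse_unique)
qed simp

lemma hom_divide: "\<sigma> (x / y) = \<sigma> x / \<sigma> y"
  by (simp add: divide_inverse hom_mult hom_inverse)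

lemma hom_power: "\<sigma> (x ^ n) = \<sigma> x ^ n"
  by (induction n) (simp_all add: hom_mult)

lemma hom_power_int: "\<sigma> (x powi n) = \<sigma> x powi n"
  by (simp add: power_int_def hom_power hom_inverse)

lemma hom_prod: "\<sigma> (prod f I) = (\<Prod>i\<in>I. \<sigma> (f i))"
  by (induction I rule: infinite_finite_induct) (simp_all add: hom_mult)

lemma restrict_scalars_assoc_algebra:
  assumes "assoc_algebra A"
  shows "assoc_algebra (restrict_scalars \<sigma> A)"
proof -
  interpret alg A by unfold_locales fact
  show ?thesis unfolding restrict_scalars_def
    by (rule assoc_algebraI)
      (simp_all add: ring_with_smult ring_axioms hom_add hom_mult smult_add_l smult_add_r)
qed

lemma scalar_algebra_assoc_algebra: "assoc_algebra (scalar_algebra \<sigma>)"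
  unfolding scalar_algebra_def
  by (rule assoc_algebraI)
    (auto simp: hom_add hom_mult algebra_simps intro!: ring_with_smult ring_from_type_algebra)

end

lemma field_hom_id: "field_hom id"
  by unfold_locales simp_all

lemma scalar_algebra_simps [simp]:
  "carrier (scalar_algebra \<sigma>) = UNIV"
  "x \<otimes>\<^bsub>scalar_algebra \<sigma>\<^esub> y = x * y"
  "\<one>\<^bsub>scalar_algebra \<sigma>\<^esub> = 1"
  "\<zero>\<^bsub>scalar_algebra \<sigma>\<^esub> = 0"
  "x \<oplus>\<^bsub>scalar_algebra \<sigma>\<^esub> y = x + y"
  "c \<odot>\<^bsub>scalar_algebra \<sigma>\<^esub> x = \<sigma> c * x"
  by (simp_all add: scalar_algebra_def)

lemma restrict_scalars_simps [simp]:
  "carrier (restrict_scalars \<sigma> A) = carrier A"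
  "x \<otimes>\<^bsub>restrict_scalars \<sigma> A\<^esub> y = x \<otimes>\<^bsub>A\<^esub> y"
  "\<one>\<^bsub>restrict_scalars \<sigma> A\<^esub> = \<one>\<^bsub>A\<^esub>"
  "\<zero>\<^bsub>restrict_scalars \<sigma> A\<^esub> = \<zero>\<^bsub>A\<^esub>"
  "x \<oplus>\<^bsub>restrict_scalars \<sigma> A\<^esub> y = x \<oplus>\<^bsub>A\<^esub> y"
  "c \<odot>\<^bsub>restrict_scalars \<sigma> A\<^esub> x = \<sigma> c \<odot>\<^bsub>A\<^esub> x"
  by (simp_all add: restrict_scalars_def)

section \<open>Quotients by ideals and their universal property\<close>

lemma (in alg) smult_add_minus:
  "x \<in> carrier A \<Longrightarrow> y \<in> carrier A \<Longrightarrow> c \<odot> (y \<oplus> x) \<ominus> c \<odot> x = c \<odot> y"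
  by (simp add: smult_add_r a_minus_def a_assoc r_neg)

lemma quot_algebra_simps:
  "carrier (quot_algebra A J) = (\<lambda>x. J +>\<^bsub>A\<^esub> x) ` carrier A"
  "monoid.mult (quot_algebra A J) = rcoset_mult A J"
  "\<one>\<^bsub>quot_algebra A J\<^esub> = J +>\<^bsub>A\<^esub> \<one>\<^bsub>A\<^esub>"
  "\<zero>\<^bsub>quot_algebra A J\<^esub> = J"
  "ring.add (quot_algebra A J) = (<+>\<^bsub>A\<^esub>)"
  "module.smult (quot_algebra A J) = (\<lambda>c Z. \<Union>x\<in>Z. J +>\<^bsub>A\<^esub> (c \<odot>\<^bsub>A\<^esub> x))"
  by (auto simp: quot_algebra_def FactRing_def A_RCOSETS_def' a_r_coset_def')

locale alg_ideal = alg A + ideal J A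
  for A :: "('k::field, 'a, 'm) module_scheme" (structure) and J
begin

lemma coset_eq_iff:
  "x \<in> carrier A \<Longrightarrow> y \<in> carrier A \<Longrightarrow> J +> x = J +> y \<longleftrightarrow> x \<ominus> y \<in> J"
  using quotient_eq_iff_same_a_r_cos[OF is_ideal] by blast

lemma coset_add:
  "x \<in> carrier A \<Longrightarrow> y \<in> carrier A \<Longrightarrow> (J +> x) \<oplus>\<^bsub>quot_algebra A J\<^esub> (J +> y) = J +> (x \<oplus> y)"
  by (simp add: quot_algebra_simps a_rcos_sum)

lemma coset_mult:
  "x \<in> carrier A \<Longrightarrow> y \<in> carrier A \<Longrightarrow> (J +> x) \<otimes>\<^bsub>quot_algebra A J\<^esub> (J +> y) = J +> (x \<otimes> y)"
  by (simp add: quot_algebra_simps rcoset_mult_add)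

lemma coset_elems: "x \<in> carrier A \<Longrightarrow> y \<in> J +> x \<Longrightarrow> \<exists>j\<in>J. y = j \<oplus> x"
  by (auto simp: a_r_coset_def')

text \<open>A ring ideal is stable under scalars, since multiplying by c is multiplying by the
  element c 1.\<close>

lemma smult_ideal: "x \<in> J \<Longrightarrow> c \<odot> x \<in> J"
  using I_l_closed[of x "c \<odot> \<one>"] Icarr by simp

text \<open>\<open>quot_algebra\<close> defines the scalar action as a union over representatives.
  As c j lies in J for j in J, all cosets in that union coincide.\<close>

lemma coset_smult:
  assumes x: "x \<in> carrier A"
  shows "c \<odot>\<^bsub>quot_algebra A J\<^esub> (J +> x) = J +> (c \<odot> x)"
proof -
  have "J +> c \<odot> y = J +> c \<odot> x" if "y \<in> J +> x" for y
  proof -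
    from coset_elems[OF x that] obtain j where "j \<in> J" "y = j \<oplus> x" by blast
    then have j: "j \<in> carrier A" using Icarr by blast
    with x have "c \<odot> y \<ominus> c \<odot> x = c \<odot> j"
      using smult_add_minus \<open>y = j \<oplus> x\<close> by blast
    with x \<open>j \<in> J\<close> \<open>y = j \<oplus> x\<close> j smult_ideal[of j c] show ?thesis
      by (simp add: coset_eq_iff)
  qed
  moreover have "x \<in> J +> x" using x by (rule a_rcos_self)
  ultimately show ?thesis unfolding quot_algebra_simps
    by (intro SUP_eq_const) blast+
qed

lemmas coset_ops = coset_add coset_mult coset_smult

lemma coset_closed [simp, intro]: "x \<in> carrier A \<Longrightarrow> J +> x \<in> carrier (quot_algebra A J)"
  by (simp add: quot_algebra_simps)

lemma quot_algebra_assoc_algebra: "assoc_algebra (quot_algebra A J)"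
proof (rule assoc_algebraI)
  show "ring (quot_algebra A J)"
    unfolding quot_algebra_def by (intro ring_with_smult quotient_is_ring)
qed (auto simp: quot_algebra_simps(1) coset_ops smult_add_l smult_add_r)

lemma coset_alg_hom: "(\<lambda>x. J +> x) \<in> alg_hom A (quot_algebra A J)"
  by (rule alg_homI) (auto simp: coset_ops quot_algebra_simps(3))

text \<open>Additive maps are the right generality: the lift of a bilinear map, to which this is
  applied as well, is in general not multiplicative.\<close>

lemma the_elem_coset:
  assumes "\<And>y z. y \<in> carrier A \<Longrightarrow> z \<in> carrier A \<Longrightarrow> h (y \<oplus> z) = h y \<oplus>\<^bsub>B\<^esub> h z"
    and "\<And>y. y \<in> J \<Longrightarrow> h y = \<zero>\<^bsub>B\<^esub>" "h \<in> carrier A \<rightarrow> carrier B" "abelian_monoid B"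
    and x: "x \<in> carrier A"
  shows "the_elem (h ` (J +> x)) = h x"
proof -
  interpret B: abelian_monoid B by fact
  have "h y = h x" if "y \<in> J +> x" for y
  proof -
    from coset_elems[OF x that] obtain j where j: "j \<in> J" "y = j \<oplus> x" by blast
    from j(1) have "j \<in> carrier A" by (rule Icarr)
    then have "h y = h j \<oplus>\<^bsub>B\<^esub> h x" using j(2) x assms(1) by blast
    also have "\<dots> = h x" using assms(2)[OF j(1)] x assms(3) by (simp add: Pi_iff)
    finally show ?thesis .
  qed
  moreover have "x \<in> J +> x" using x by (rule a_rcos_self)
  ultimately have "h ` (J +> x) = {h x}" by blast
  then show ?thesis by simp
qed

lemma quot_lift:
  assumes B: "assoc_algebra B" and h: "h \<in> alg_hom A B"
    and vanish: "\<And>y. y \<in> J \<Longrightarrow> h y = \<zero>\<^bsub>B\<^esub>"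
  obtains h' where "h' \<in> alg_hom (quot_algebra A J) B" "\<And>x. x \<in> carrier A \<Longrightarrow> h' (J +> x) = h x"
proof
  interpret B: alg B by unfold_locales fact
  note hD = alg_homD[OF h]
  let ?h = "\<lambda>Z. the_elem (h ` Z)"
  show *: "?h (J +> x) = h x" if "x \<in> carrier A" for x
    by (rule the_elem_coset[of h B]) (use that vanish hD B.abelian_monoid_axioms in blast)+
  show "?h \<in> alg_hom (quot_algebra A J) B"
    by (rule alg_homI) (auto simp: quot_algebra_simps(1,3) coset_ops * hD)
qed

end

section \<open>Generators\<close>

inductive_set alg_span :: "('k, 'a, 'm) module_scheme \<Rightarrow> 'a set \<Rightarrow> 'a set"
  for A (structure) and G where
  one: "\<one> \<in> alg_span A G"
| gen: "x \<in> G \<Longrightarrow> x \<in> alg_span A G"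
| add: "x \<in> alg_span A G \<Longrightarrow> y \<in> alg_span A G \<Longrightarrow> x \<oplus> y \<in> alg_span A G"
| mult: "x \<in> alg_span A G \<Longrightarrow> y \<in> alg_span A G \<Longrightarrow> x \<otimes> y \<in> alg_span A G"
| smult: "x \<in> alg_span A G \<Longrightarrow> c \<odot> x \<in> alg_span A G"

definition generates :: "('k, 'a, 'm) module_scheme \<Rightarrow> ('x \<Rightarrow> 'a) \<Rightarrow> bool" where
  "generates A g \<longleftrightarrow> range g \<subseteq> carrier A \<and> carrier A \<subseteq> alg_span A (range g)"

lemma generates_closed: "generates A g \<Longrightarrow> g x \<in> carrier A"
  by (auto simp: generates_def)

lemma (in alg) alg_span_closed: "x \<in> alg_span A G \<Longrightarrow> G \<subseteq> carrier A \<Longrightarrow> x \<in> carrier A"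
  by (induction rule: alg_span.induct) auto

lemma (in alg) generates_induct [consumes 2, case_names one gen add mult smult]:
  assumes "x \<in> carrier A" "generates A g"
    and "P \<one>" "\<And>y. P (g y)"
    and "\<And>x y. x \<in> carrier A \<Longrightarrow> y \<in> carrier A \<Longrightarrow> P x \<Longrightarrow> P y \<Longrightarrow> P (x \<oplus> y)"
    and "\<And>x y. x \<in> carrier A \<Longrightarrow> y \<in> carrier A \<Longrightarrow> P x \<Longrightarrow> P y \<Longrightarrow> P (x \<otimes> y)"
    and "\<And>c x. x \<in> carrier A \<Longrightarrow> P x \<Longrightarrow> P (c \<odot> x)"
  shows "P x"
proof -
  have r: "range g \<subseteq> carrier A" "x \<in> alg_span A (range g)"
    using assms(1,2) by (auto simp: generates_def)
  from r(2) show "P x"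
    by induction (use assms(3-) alg_span_closed[OF _ r(1)] in auto)
qed

text \<open>The uniqueness principle of the whole development: identities between structure maps
  become case distinctions over the six kinds of generators.\<close>

lemma alg_hom_eqI:
  assumes "assoc_algebra A" "generates A g" "h \<in> alg_hom A B" "h' \<in> alg_hom A B"
    "\<And>y. h (g y) = h' (g y)" "x \<in> carrier A"
  shows "h x = h' x"
proof -
  interpret alg A by unfold_locales fact
  show ?thesis using assms(6,2)
    by (induction rule: generates_induct) (use assms in \<open>simp_all add: alg_homD\<close>)
qed

lemma alg_hom_comp:
  "h \<in> alg_hom A B \<Longrightarrow> h' \<in> alg_hom B C \<Longrightarrow> (\<lambda>x. h' (h x)) \<in> alg_hom A C"
  by (rule alg_homI) (auto simp: alg_homD)

lemma alg_hom_ident: "(\<lambda>x. x) \<in> alg_hom A A"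
  by (rule alg_homI) auto

lemma alg_hom_zero:
  assumes "h \<in> alg_hom A B" "assoc_algebra A" "assoc_algebra B"
  shows "h \<zero>\<^bsub>A\<^esub> = \<zero>\<^bsub>B\<^esub>"
proof -
  interpret A: alg A by unfold_locales fact
  interpret B: alg B by unfold_locales fact
  have "h (0 \<odot>\<^bsub>A\<^esub> \<one>\<^bsub>A\<^esub>) = 0 \<odot>\<^bsub>B\<^esub> h \<one>\<^bsub>A\<^esub>"
    by (rule alg_homD(5)[OF assms(1) A.one_closed])
  then show ?thesis by (simp add: alg_homD(4)[OF assms(1)])
qed

lemma alg_hom_minus:
  assumes "h \<in> alg_hom A B" "assoc_algebra A" "assoc_algebra B" "x \<in> carrier A"
  shows "h (\<ominus>\<^bsub>A\<^esub> x) = \<ominus>\<^bsub>B\<^esub> h x"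
proof -
  interpret A: alg A by unfold_locales fact
  interpret B: alg B by unfold_locales fact
  show ?thesis
    using alg_homD[OF assms(1)] assms(4) by (simp add: A.minus_eq_smult B.minus_eq_smult)
qed

section \<open>Tensor products\<close>

definition bilinear ::
    "('k, 'a, 'm) module_scheme \<Rightarrow> ('k, 'b, 'n) module_scheme \<Rightarrow> ('k, 'c, 'o) module_scheme
      \<Rightarrow> ('a \<Rightarrow> 'b \<Rightarrow> 'c) \<Rightarrow> bool" where
  "bilinear A B C \<beta> \<longleftrightarrow>
     (\<forall>a\<in>carrier A. \<forall>b\<in>carrier B. \<beta> a b \<in> carrier C \<and>
        (\<forall>a'\<in>carrier A. \<beta> (a \<oplus>\<^bsub>A\<^esub> a') b = \<beta> a b \<oplus>\<^bsub>C\<^esub> \<beta> a' b) \<and>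
        (\<forall>b'\<in>carrier B. \<beta> a (b \<oplus>\<^bsub>B\<^esub> b') = \<beta> a b \<oplus>\<^bsub>C\<^esub> \<beta> a b') \<and>
        (\<forall>c. \<beta> (c \<odot>\<^bsub>A\<^esub> a) b = c \<odot>\<^bsub>C\<^esub> \<beta> a b \<and> \<beta> a (c \<odot>\<^bsub>B\<^esub> b) = c \<odot>\<^bsub>C\<^esub> \<beta> a b))"

lemma bilinearD:
  assumes "bilinear A B C \<beta>" "a \<in> carrier A" "b \<in> carrier B"
  shows "\<beta> a b \<in> carrier C"
    "a' \<in> carrier A \<Longrightarrow> \<beta> (a \<oplus>\<^bsub>A\<^esub> a') b = \<beta> a b \<oplus>\<^bsub>C\<^esub> \<beta> a' b"
    "b' \<in> carrier B \<Longrightarrow> \<beta> a (b \<oplus>\<^bsub>B\<^esub> b') = \<beta> a b \<oplus>\<^bsub>C\<^esub> \<beta> a b'"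
    "\<beta> (c \<odot>\<^bsub>A\<^esub> a) b = c \<odot>\<^bsub>C\<^esub> \<beta> a b"
    "\<beta> a (c \<odot>\<^bsub>B\<^esub> b) = c \<odot>\<^bsub>C\<^esub> \<beta> a b"
  using assms by (auto simp: bilinear_def)

lemma tw_mult_minus: "tw_mult M \<alpha> (- f) g = - tw_mult M \<alpha> f g" "tw_mult M \<alpha> f (- g) = - tw_mult M \<alpha> f g"
  using tw_mult_scale_l[of M \<alpha> "- 1" f g] tw_mult_scale_r[of M \<alpha> f "- 1" g]
  by (simp_all add: scale_minus_one)

lemma tw_mult_diff_l: "tw_mult M \<alpha> (f - f') g = tw_mult M \<alpha> f g - tw_mult M \<alpha> f' g"
  using tw_mult_add_l[of M \<alpha> f "- f'" g] by (simp add: tw_mult_minus)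

lemma tw_mult_diff_r: "tw_mult M \<alpha> f (g - g') = tw_mult M \<alpha> f g - tw_mult M \<alpha> f g'"
  using tw_mult_add_r[of M \<alpha> f g "- g'"] by (simp add: tw_mult_minus)

lemma (in abelian_group) add_minus_minus:
  "x \<in> carrier G \<Longrightarrow> y \<in> carrier G \<Longrightarrow> (x \<oplus> y) \<ominus> x \<ominus> y = \<zero>"
  by (simp add: a_minus_def) (metis a_assoc a_comm a_inv_closed add.m_closed r_neg minus_add)

lemma keys_diff_subset:
  fixes f g :: "'x \<Rightarrow>\<^sub>0 'k::field"
  assumes "keys f \<subseteq> S" "keys g \<subseteq> S"
  shows "keys (f - g) \<subseteq> S"
proof
  fix x assume "x \<in> keys (f - g)"
  then have "x \<in> keys f \<or> x \<in> keys g"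
    by (auto simp: in_keys_iff lookup_minus)
  with assms show "x \<in> S" by blast
qed

locale tensor_product = A: alg A + B: alg B
  for A :: "('k::field, 'a, 'm) module_scheme" and B :: "('k, 'b, 'n) module_scheme"
begin

abbreviation "T \<equiv> tensor A B"
abbreviation "pure \<equiv> pure_tensor A B"
abbreviation "FT \<equiv> tw_algebra (A \<times>\<times> B) (\<lambda>_ _. 1 :: 'k)"

sublocale M: monoid "A \<times>\<times> B"
  by (intro DirProd_monoid A.monoid_axioms B.monoid_axioms)

sublocale cocycle "A \<times>\<times> B" "\<lambda>_ _. 1 :: 'k"
  by (rule M.cocycle_trivial)

sublocale FA: alg FT
  by unfold_locales (rule tw_algebra_assoc_algebra)

lemma carrier_prod [simp]: "carrier (A \<times>\<times> B) = carrier A \<times> carrier B"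
  by (simp add: DirProd_def)

lemma bilinear_rels_carrier:
  "bilinear_rels A B \<subseteq> carrier (FT)"
  unfolding bilinear_rels_def tw_algebra_simps
  by (intro Un_least subsetI; elim CollectE exE conjE; hypsubst; intro CollectI keys_diff_subset;
      simp add: keys_single)

lemma tensor_ideal: "ideal (tensor_ideal A B) (FT)"
  unfolding tensor_ideal_def monoid_algebra_eq_tw_algebra
  by (rule FA.genideal_ideal[OF bilinear_rels_carrier])

sublocale I: alg_ideal FT "tensor_ideal A B"
  by (intro alg_ideal.intro tensor_ideal FA.alg_axioms)

lemma tensor_eq: "T = quot_algebra (FT) (tensor_ideal A B)"
  by (simp add: tensor_def monoid_algebra_eq_tw_algebra)

lemma pure_eq: "pure a b = tensor_ideal A B +>\<^bsub>FT\<^esub> single (a, b) 1"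
  by (simp add: pure_tensor_def monoid_algebra_eq_tw_algebra)

lemma tensor_assoc_algebra: "assoc_algebra T"
  unfolding tensor_eq by (rule I.quot_algebra_assoc_algebra)

sublocale T: alg T
  by unfold_locales (rule tensor_assoc_algebra)

lemma single_carrier:
  "a \<in> carrier A \<Longrightarrow> b \<in> carrier B
    \<Longrightarrow> single (a, b) c \<in> carrier (FT)"
  by (simp add: keys_single)

lemma pure_closed [simp, intro]: "a \<in> carrier A \<Longrightarrow> b \<in> carrier B \<Longrightarrow> pure a b \<in> carrier T"
  unfolding pure_eq tensor_eq by (intro I.coset_closed single_carrier)

lemma pure_mult [simp]:
  "a \<in> carrier A \<Longrightarrow> b \<in> carrier B \<Longrightarrow> a' \<in> carrier A \<Longrightarrow> b' \<in> carrier B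
    \<Longrightarrow> pure a b \<otimes>\<^bsub>T\<^esub> pure a' b' = pure (a \<otimes>\<^bsub>A\<^esub> a') (b \<otimes>\<^bsub>B\<^esub> b')"
  unfolding pure_eq tensor_eq by (simp add: I.coset_mult single_carrier del: tw_algebra_simps(1))

lemma one_tensor: "\<one>\<^bsub>T\<^esub> = pure \<one>\<^bsub>A\<^esub> \<one>\<^bsub>B\<^esub>"
  unfolding pure_eq tensor_eq by (simp add: quot_algebra_simps)

lemma FA_minus:
  fixes g :: "'a \<times> 'b \<Rightarrow>\<^sub>0 'k"
  assumes "keys g \<subseteq> carrier A \<times> carrier B"
  shows "f \<ominus>\<^bsub>FT\<^esub> g = f - g"
  using FA.minus_eq_smult[of g] assms
  by (simp add: a_minus_def scale_minus_one)

lemma tensor_ideal_rel: "x \<in> bilinear_rels A B \<Longrightarrow> x \<in> tensor_ideal A B"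
  unfolding tensor_ideal_def monoid_algebra_eq_tw_algebra
  using FA.genideal_self[OF bilinear_rels_carrier] by blast

lemma coset_eqI:
  fixes f g :: "'a \<times> 'b \<Rightarrow>\<^sub>0 'k"
  assumes "keys f \<subseteq> carrier A \<times> carrier B" "keys g \<subseteq> carrier A \<times> carrier B"
    "f - g \<in> tensor_ideal A B"
  shows "tensor_ideal A B +>\<^bsub>FT\<^esub> f
    = tensor_ideal A B +>\<^bsub>FT\<^esub> g"
  using assms by (simp add: I.coset_eq_iff FA_minus)

lemma pure_bilinear: "bilinear A B T pure"
proof -
  have K: "keys (single (a, b) c) \<subseteq> carrier A \<times> carrier B"
    if "a \<in> carrier A" "b \<in> carrier B" for a b c using that by (simp add: keys_single)
  show ?thesis unfolding bilinear_def
  proof (intro ballI allI conjI)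
    fix a b assume ab: "a \<in> carrier A" "b \<in> carrier B"
    then show "pure a b \<in> carrier T" by simp
    show "pure (a \<oplus>\<^bsub>A\<^esub> a') b = pure a b \<oplus>\<^bsub>T\<^esub> pure a' b" if a': "a' \<in> carrier A" for a'
    proof -
      have "single (a \<oplus>\<^bsub>A\<^esub> a', b) 1 - single (a, b) 1
        - single (a', b) 1 \<in> tensor_ideal A B"
        using ab a' by (intro tensor_ideal_rel) (auto simp: bilinear_rels_def)
      then show ?thesis unfolding pure_eq tensor_eq using ab a'
        using keys_add[of "single (a, b) (1::'k)" "single (a', b) (1::'k)"]
        by (subst I.coset_add; (intro coset_eqI)?) (auto simp: keys_single diff_diff_eq)
    qed
    show "pure a (b \<oplus>\<^bsub>B\<^esub> b') = pure a b \<oplus>\<^bsub>T\<^esub> pure a b'" if b': "b' \<in> carrier B" for b'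
    proof -
      have "single (a, b \<oplus>\<^bsub>B\<^esub> b') 1 - single (a, b) 1
        - single (a, b') 1 \<in> tensor_ideal A B"
        using ab b' by (intro tensor_ideal_rel) (auto simp: bilinear_rels_def)
      then show ?thesis unfolding pure_eq tensor_eq using ab b'
        using keys_add[of "single (a, b) (1::'k)" "single (a, b') (1::'k)"]
        by (subst I.coset_add; (intro coset_eqI)?) (auto simp: keys_single diff_diff_eq)
    qed
    show "pure (c \<odot>\<^bsub>A\<^esub> a) b = c \<odot>\<^bsub>T\<^esub> pure a b" for c
    proof -
      have "single (c \<odot>\<^bsub>A\<^esub> a, b) 1 - single (a, b) c \<in> tensor_ideal A B"
        using ab by (intro tensor_ideal_rel) (auto simp: bilinear_rels_def)
      then show ?thesis unfolding pure_eq tensor_eq using ab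
        by (subst I.coset_smult; (intro coset_eqI)?) (auto simp: keys_single)
    qed
    show "pure a (c \<odot>\<^bsub>B\<^esub> b) = c \<odot>\<^bsub>T\<^esub> pure a b" for c
    proof -
      have "single (a, c \<odot>\<^bsub>B\<^esub> b) 1 - single (a, b) c \<in> tensor_ideal A B"
        using ab by (intro tensor_ideal_rel) (auto simp: bilinear_rels_def)
      then show ?thesis unfolding pure_eq tensor_eq using ab
        by (subst I.coset_smult; (intro coset_eqI)?) (auto simp: keys_single)
    qed
  qed
qed

lemmas pure_add_l = bilinearD(2)[OF pure_bilinear]
lemmas pure_add_r = bilinearD(3)[OF pure_bilinear]
lemmas pure_smult_l [simp] = bilinearD(4)[OF pure_bilinear]
lemmas pure_smult_r [simp] = bilinearD(5)[OF pure_bilinear]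

text \<open>A scalar multiple of a pure tensor is again pure, the scalar being absorbed by the first
  factor, so sums of pure tensors exhaust the tensor product.\<close>

lemma tensor_induct [consumes 1, case_names pure add]:
  assumes "Z \<in> carrier T"
    and p: "\<And>a b. a \<in> carrier A \<Longrightarrow> b \<in> carrier B \<Longrightarrow> P (pure a b)"
    and add: "\<And>Y Z. Y \<in> carrier T \<Longrightarrow> Z \<in> carrier T \<Longrightarrow> P Y \<Longrightarrow> P Z \<Longrightarrow> P (Y \<oplus>\<^bsub>T\<^esub> Z)"
  shows "P Z"
proof -
  let ?c = "\<lambda>f. tensor_ideal A B +>\<^bsub>FT\<^esub> f"
  have term_case: "P (?c (single (a, b) c))" if ab: "a \<in> carrier A" "b \<in> carrier B" for a b c
  proof -
    have "?c (single (a, b) c) = c \<odot>\<^bsub>T\<^esub> pure a b"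
      unfolding pure_eq tensor_eq using ab by (subst I.coset_smult) (auto simp: keys_single)
    also have "\<dots> = pure (c \<odot>\<^bsub>A\<^esub> a) b" using ab by simp
    finally have eq: "?c (single (a, b) c) = pure (c \<odot>\<^bsub>A\<^esub> a) b" .
    show ?thesis unfolding eq using ab by (intro p) auto
  qed
  from assms(1) obtain f where f: "keys f \<subseteq> carrier A \<times> carrier B" "Z = ?c f"
    by (auto simp: tensor_eq quot_algebra_simps)
  from f(1) have "P (?c f)"
  proof (induction f rule: poly_mapping_keys_induct)
    case zero
    \<comment> \<open>Zero is represented by the term with coefficient 0 at the pair of
      zeros.\<close>
    then show ?case using term_case[of "\<zero>\<^bsub>A\<^esub>" "\<zero>\<^bsub>B\<^esub>" 0] by simp
  next
    case (add f g)
    have "?c (f + g) = ?c f \<oplus>\<^bsub>T\<^esub> ?c g" "?c f \<in> carrier T" "?c g \<in> carrier T"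
      unfolding tensor_eq using add(1,2) by (simp_all add: I.coset_add I.coset_closed)
    then show ?case using assms(3)[of "?c f" "?c g"] add(3,4) by (simp only:)
  next
    case (single p c)
    then show ?case by (cases p) (blast intro: term_case)
  qed
  with f(2) show ?thesis by simp
qed

end

section \<open>The universal property of the tensor product\<close>

locale bilinear_lift = tensor_product A B + C: alg C
  for A :: "('k::field, 'a, 'm) module_scheme" and B :: "('k, 'b, 'n) module_scheme"
    and C :: "('k, 'c, 'o) module_scheme" +
  fixes \<beta> :: "'a \<Rightarrow> 'b \<Rightarrow> 'c"
  assumes bilinear: "bilinear A B C \<beta>"
begin

lemmas \<beta> = bilinearD[OF bilinear]

abbreviation "L \<equiv> lin_ext C (\<lambda>p. \<beta> (fst p) (snd p))"

lemma \<beta>_closed: "(\<lambda>p. \<beta> (fst p) (snd p)) \<in> carrier A \<times> carrier B \<rightarrow> carrier C"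
  using \<beta>(1) by auto

lemmas L_add = C.lin_ext_add[OF _ _ \<beta>_closed]
lemmas L_diff = C.lin_ext_diff[OF _ _ \<beta>_closed]
lemmas L_closed = C.lin_ext_closed[OF _ \<beta>_closed]
lemmas L_scale = C.lin_ext_scale[OF _ \<beta>_closed]

text \<open>\<open>tensor_ideal\<close> is generated as a two-sided ideal, while \<open>L\<close> is
  only linear, so that its kernel need not be an ideal. The set N of all f with L (g f h) = 0 for
  all g and h is one. It contains the bilinearity relations, because multiplying such a relation by
  basis elements on both sides gives a multiple of a relation of the same kind.\<close>

lemma L_vanishes:
  assumes "f \<in> tensor_ideal A B"
  shows "L f = \<zero>\<^bsub>C\<^esub>"
proof -
  let ?FA = FT
  let ?m = "tw_mult (A \<times>\<times> B) (\<lambda>_ _. 1 :: 'k)"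
  define N where "N = {f \<in> carrier ?FA. \<forall>g\<in>carrier ?FA. \<forall>h\<in>carrier ?FA. L (?m (?m g f) h) = \<zero>\<^bsub>C\<^esub>}"
  note keys = tw_mult_keys[simplified]
  have neg: "keys (- f) = keys f" for f :: "'a \<times> 'b \<Rightarrow>\<^sub>0 'k"
    by (auto simp: in_keys_iff)
  have fneg: "\<ominus>\<^bsub>?FA\<^esub> f = - f" if "keys f \<subseteq> carrier A \<times> carrier B" for f :: "'a \<times> 'b \<Rightarrow>\<^sub>0 'k"
    using FA.minus_eq_smult[of f] that by (simp add: scale_minus_one)
  have addk: "keys (f + g) \<subseteq> S" if "keys f \<subseteq> S" "keys g \<subseteq> S"
    for f g :: "'a \<times> 'b \<Rightarrow>\<^sub>0 'k" and S using that keys_add[of f g] by blast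
  have "ideal N ?FA"
  proof (rule idealI)
    show "ring ?FA" by (rule FA.ring_axioms)
    show "subgroup N (add_monoid ?FA)"
    proof (rule FA.add.subgroupI)
      show "N \<subseteq> carrier ?FA" by (auto simp: N_def)
      have "0 \<in> N" by (simp add: N_def)
      then show "N \<noteq> {}" by blast
      show "\<ominus>\<^bsub>?FA\<^esub> f \<in> N" if "f \<in> N" for f
        using that C.lin_ext_minus[OF _ \<beta>_closed]
        by (simp add: N_def fneg neg tw_mult_minus keys)
      show "f \<oplus>\<^bsub>?FA\<^esub> h \<in> N" if "f \<in> N" "h \<in> N" for f h
        using that by (simp add: N_def addk tw_mult_add_l tw_mult_add_r L_add keys)
    qed
    fix f x assume f: "f \<in> N" and x: "x \<in> carrier ?FA"
    have "?m (?m g (?m x f)) h = ?m (?m (?m g x) f) h"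
      if "g \<in> carrier ?FA" "h \<in> carrier ?FA" for g h
      using f x that by (simp add: N_def tw_mult_assoc keys)
    with f x show "x \<otimes>\<^bsub>?FA\<^esub> f \<in> N"
      by (simp add: N_def keys)
    have "?m (?m g (?m f x)) h = ?m (?m g f) (?m x h)"
      if "g \<in> carrier ?FA" "h \<in> carrier ?FA" for g h
      using f x that by (simp add: N_def tw_mult_assoc keys)
    with f x show "f \<otimes>\<^bsub>?FA\<^esub> x \<in> N"
      by (simp add: N_def keys)
  qed
  moreover have "bilinear_rels A B \<subseteq> N"
  proof
    fix r assume r: "r \<in> bilinear_rels A B"
    then have rc: "keys r \<subseteq> carrier A \<times> carrier B"
      using bilinear_rels_carrier by auto
    have gens: "L (?m (?m (single (x, y) s) r) (single (x', y') s')) = \<zero>\<^bsub>C\<^esub>"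
      if xy: "x \<in> carrier A" "y \<in> carrier B" "x' \<in> carrier A" "y' \<in> carrier B" for x y x' y' s s'
      using r xy unfolding bilinear_rels_def
      by (elim UnE CollectE exE conjE; simp only:)
        (simp_all add: tw_mult_diff_l tw_mult_diff_r L_diff keys_single keys_diff_subset \<beta>
          A.l_distr A.r_distr B.l_distr B.r_distr C.smult_add_r C.add_minus_minus mult_ac
          C.r_neg a_minus_def[symmetric] C.r_right_minus_eq)
    have "L (?m (?m g r) h) = \<zero>\<^bsub>C\<^esub>" if g: "keys g \<subseteq> carrier A \<times> carrier B"
      and h: "keys h \<subseteq> carrier A \<times> carrier B" for g h
      using g
    proof (induction g rule: poly_mapping_keys_induct)
      case (single p s)
      from h show ?case
      proof (induction h rule: poly_mapping_keys_induct)
        case (single q s')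
        with \<open>p \<in> carrier A \<times> carrier B\<close> show ?case
          by (cases p; cases q) (blast intro: gens)
      next
        case (add h h')
        let ?p = "single p s"
        have "keys ?p \<subseteq> carrier A \<times> carrier B"
          using \<open>p \<in> carrier A \<times> carrier B\<close> by (simp add: keys_single)
        then have "L (?m (?m ?p r) (h + h')) = L (?m (?m ?p r) h) \<oplus>\<^bsub>C\<^esub> L (?m (?m ?p r) h')"
          unfolding tw_mult_add_r using add(1,2) rc by (intro L_add keys)
        then show ?case unfolding add(3,4) by simp
      qed simp
    next
      case (add g g')
      then have "L (?m (?m (g + g') r) h) = L (?m (?m g r) h) \<oplus>\<^bsub>C\<^esub> L (?m (?m g' r) h)"
        unfolding tw_mult_add_l using rc h by (intro L_add keys)
      then show ?case unfolding add(3,4) by simp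
    qed simp
    with rc show "r \<in> N" by (simp add: N_def)
  qed
  ultimately have "tensor_ideal A B \<subseteq> N"
    unfolding tensor_ideal_def monoid_algebra_eq_tw_algebra by (rule FA.genideal_minimal)
  with assms have f: "f \<in> N" by blast
  \<comment> \<open>Taking the unit for both g and h turns membership in N into L f = 0.\<close>
  let ?one = "single \<one>\<^bsub>A \<times>\<times> B\<^esub> (1::'k)"
  from f have k: "keys f \<subseteq> carrier A \<times> carrier B" by (simp add: N_def)
  have "L (?m (?m ?one f) ?one) = \<zero>\<^bsub>C\<^esub>"
    using f by (simp add: N_def keys_single)
  then show ?thesis
    using k tw_mult_one[of f] by simp
qed

lemma lift_coset:
  "keys f \<subseteq> carrier A \<times> carrier B
    \<Longrightarrow> tensor_lift C \<beta> (tensor_ideal A B +>\<^bsub>FT\<^esub> f) = L f"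
  unfolding tensor_lift_def lin_ext_def[symmetric]
  by (rule I.the_elem_coset[of L C])
    (auto simp: L_add L_vanishes C.abelian_monoid_axioms intro: L_closed)

lemma lift_pure [simp]: "a \<in> carrier A \<Longrightarrow> b \<in> carrier B \<Longrightarrow> tensor_lift C \<beta> (pure a b) = \<beta> a b"
  unfolding pure_eq by (subst lift_coset) (auto simp: keys_single \<beta>)

lemma tensor_cosetE:
  assumes "Z \<in> carrier T"
  obtains f where "keys f \<subseteq> carrier A \<times> carrier B"
    "Z = tensor_ideal A B +>\<^bsub>FT\<^esub> f"
  using assms by (auto simp: tensor_eq quot_algebra_simps(1))

lemma lift_closed [simp, intro]: "Z \<in> carrier T \<Longrightarrow> tensor_lift C \<beta> Z \<in> carrier C"
  by (elim tensor_cosetE) (auto simp: lift_coset intro: L_closed)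

lemma lift_add:
  assumes "Y \<in> carrier T" "Z \<in> carrier T"
  shows "tensor_lift C \<beta> (Y \<oplus>\<^bsub>T\<^esub> Z) = tensor_lift C \<beta> Y \<oplus>\<^bsub>C\<^esub> tensor_lift C \<beta> Z"
  using assms(1)
proof (rule tensor_cosetE)
  fix f assume f: "keys f \<subseteq> carrier A \<times> carrier B"
    "Y = tensor_ideal A B +>\<^bsub>FT\<^esub> f"
  from assms(2) obtain g where g: "keys g \<subseteq> carrier A \<times> carrier B"
    "Z = tensor_ideal A B +>\<^bsub>FT\<^esub> g"
    by (rule tensor_cosetE)
  have "keys (f + g) \<subseteq> carrier A \<times> carrier B"
    using f g keys_add[of f g] by blast
  with f g show ?thesis
    using I.coset_add[of f g] by (simp add: tensor_eq[symmetric] lift_coset L_add)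
qed

lemma lift_smult:
  assumes "Z \<in> carrier T"
  shows "tensor_lift C \<beta> (c \<odot>\<^bsub>T\<^esub> Z) = c \<odot>\<^bsub>C\<^esub> tensor_lift C \<beta> Z"
  using assms
proof (rule tensor_cosetE)
  fix f assume f: "keys f \<subseteq> carrier A \<times> carrier B"
    "Z = tensor_ideal A B +>\<^bsub>FT\<^esub> f"
  have "keys (scale c f) \<subseteq> carrier A \<times> carrier B"
    using f(1) keys_scale[of c f] by blast
  with f show ?thesis
    using I.coset_smult[of f c] by (simp add: tensor_eq[symmetric] lift_coset L_scale)
qed

lemma lift_alg_hom:
  assumes mult: "\<And>a a' b b'. a \<in> carrier A \<Longrightarrow> a' \<in> carrier A \<Longrightarrow> b \<in> carrier B \<Longrightarrow> b' \<in> carrier B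
      \<Longrightarrow> \<beta> (a \<otimes>\<^bsub>A\<^esub> a') (b \<otimes>\<^bsub>B\<^esub> b') = \<beta> a b \<otimes>\<^bsub>C\<^esub> \<beta> a' b'"
    and one: "\<beta> \<one>\<^bsub>A\<^esub> \<one>\<^bsub>B\<^esub> = \<one>\<^bsub>C\<^esub>"
  shows "tensor_lift C \<beta> \<in> alg_hom T C"
proof (rule alg_homI)
  fix Y Z assume Y: "Y \<in> carrier T" and Z: "Z \<in> carrier T"
  from Y show "tensor_lift C \<beta> (Y \<otimes>\<^bsub>T\<^esub> Z) = tensor_lift C \<beta> Y \<otimes>\<^bsub>C\<^esub> tensor_lift C \<beta> Z"
  proof (induction Y rule: tensor_induct)
    case (pure a b)
    from Z show ?case
    proof (induction Z rule: tensor_induct)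
      case (pure a' b')
      then show ?case using \<open>a \<in> carrier A\<close> \<open>b \<in> carrier B\<close> by (simp add: mult)
    next
      case (add Z Z')
      then show ?case using \<open>a \<in> carrier A\<close> \<open>b \<in> carrier B\<close>
        by (simp add: T.r_distr lift_add C.r_distr \<beta>)
    qed
  next
    case (add Y Y')
    then show ?case using Z by (simp add: T.l_distr lift_add C.l_distr)
  qed
qed (auto simp: lift_add lift_smult one_tensor one)

end

lemma tensor_map_alg_hom:
  assumes "assoc_algebra A" "assoc_algebra B" "assoc_algebra C" "assoc_algebra D"
    and f: "f \<in> alg_hom A C" and g: "g \<in> alg_hom B D"
  shows "tensor_map C D f g \<in> alg_hom (tensor A B) (tensor C D)"
    and "\<And>a b. a \<in> carrier A \<Longrightarrow> b \<in> carrier B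
      \<Longrightarrow> tensor_map C D f g (pure_tensor A B a b) = pure_tensor C D (f a) (g b)"
proof -
  interpret AB: tensor_product A B using assms by (intro tensor_product.intro alg.intro)
  interpret CD: tensor_product C D using assms by (intro tensor_product.intro alg.intro)
  note hD = alg_homD[OF f] alg_homD[OF g]
  interpret bilinear_lift A B "tensor C D" "\<lambda>a b. pure_tensor C D (f a) (g b)"
    by unfold_locales (auto simp: bilinear_def hD CD.pure_add_l CD.pure_add_r)
  show "tensor_map C D f g \<in> alg_hom (tensor A B) (tensor C D)"
    unfolding tensor_map_def by (rule lift_alg_hom) (simp_all add: hD CD.one_tensor)
  show "tensor_map C D f g (pure_tensor A B a b) = pure_tensor C D (f a) (g b)"
    if "a \<in> carrier A" "b \<in> carrier B" for a b
    unfolding tensor_map_def using that by simp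
qed

section \<open>Hopf algebras determined by their values on generators\<close>

text \<open>The form in which a Hopf structure is built and transported. Demanding that the antipode
  be an antihomomorphism, where \<open>hopf_algebra\<close> asks for linearity, makes all three maps
  determined by the generators; the axioms are then derived.\<close>

definition hopf_generated :: "('k::field, 'a, 'm) hopf_scheme \<Rightarrow> ('i gen \<Rightarrow> 'a) \<Rightarrow> bool" where
  "hopf_generated H g \<longleftrightarrow> assoc_algebra H \<and> generates H g \<and>
     (\<forall>i. g (K i) \<otimes>\<^bsub>H\<^esub> g (Kinv i) = \<one>\<^bsub>H\<^esub> \<and> g (Kinv i) \<otimes>\<^bsub>H\<^esub> g (K i) = \<one>\<^bsub>H\<^esub> \<and>
          g (K' i) \<otimes>\<^bsub>H\<^esub> g (Kinv' i) = \<one>\<^bsub>H\<^esub> \<and> g (Kinv' i) \<otimes>\<^bsub>H\<^esub> g (K' i) = \<one>\<^bsub>H\<^esub>) \<and>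
     comult H \<in> alg_hom H (tensor H H) \<and> (\<forall>x. comult H (g x) = comult_on_gen H g x) \<and>
     counit H \<in> alg_hom H (scalar_algebra id) \<and> (\<forall>x. counit H (g x) = counit_on_gen x) \<and>
     antipode H \<in> alg_hom H (opposite H) \<and> (\<forall>x. antipode H (g x) = antipode_on_gen H g x)"

lemma scalar_id_assoc_algebra: "assoc_algebra (scalar_algebra (id :: 'k \<Rightarrow> 'k::field))"
  by (rule field_hom.scalar_algebra_assoc_algebra[OF field_hom_id])

lemma tensor_assoc_alg_hom:
  assumes A: "assoc_algebra (A :: ('k::field, 'a, 'm) module_scheme)"
  shows "tensor_assoc A \<in> alg_hom (tensor (tensor A A) A) (tensor A (tensor A A))"
    and "\<And>a b c. a \<in> carrier A \<Longrightarrow> b \<in> carrier A \<Longrightarrow> c \<in> carrier A \<Longrightarrow>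
      tensor_assoc A (pure_tensor (tensor A A) A (pure_tensor A A a b) c)
        = pure_tensor A (tensor A A) a (pure_tensor A A b c)"
proof -
  interpret A: alg A by unfold_locales fact
  interpret AA: tensor_product A A by unfold_locales
  interpret T: tensor_product A "tensor A A" by unfold_locales
  interpret AA_A: tensor_product "tensor A A" A by unfold_locales
  let ?T = "tensor A (tensor A A)"
  let ?\<beta> = "\<lambda>c a b. pure_tensor A (tensor A A) a (pure_tensor A A b c)"
  have inner: "bilinear_lift A A ?T (?\<beta> c)" if c: "c \<in> carrier A" for c
    by unfold_locales (simp add: bilinear_def c T.pure_add_l T.pure_add_r AA.pure_add_l)
  let ?\<gamma> = "\<lambda>x c. tensor_lift ?T (?\<beta> c) x"
  note pure = bilinear_lift.lift_pure[OF inner]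
  note closed = bilinear_lift.lift_closed[OF inner]
  note add = bilinear_lift.lift_add[OF inner]
  note smult = bilinear_lift.lift_smult[OF inner]
  \<comment> \<open>The inner lift is linear in x by construction. Linearity in c is not automatic,
    since c parametrises the bilinear map being lifted, and is proved by induction over x.\<close>
  have add_r: "?\<gamma> x (c \<oplus>\<^bsub>A\<^esub> c') = ?\<gamma> x c \<oplus>\<^bsub>?T\<^esub> ?\<gamma> x c'"
    if x: "x \<in> carrier (tensor A A)" and c: "c \<in> carrier A" "c' \<in> carrier A" for x c c'
    using x
  proof (induction x rule: AA.tensor_induct)
    case (add x y)
    then show ?case using c closed by (simp add: bilinear_lift.lift_add[OF inner] T.T.a_ac)
  qed (use c in \<open>simp add: pure AA.pure_add_r T.pure_add_r\<close>)
  have smult_r: "?\<gamma> x (s \<odot>\<^bsub>A\<^esub> c) = s \<odot>\<^bsub>?T\<^esub> ?\<gamma> x c"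
    if x: "x \<in> carrier (tensor A A)" and c: "c \<in> carrier A" for x c s
    using x
  proof (induction x rule: AA.tensor_induct)
    case (add x y)
    then show ?case using c closed by (simp add: bilinear_lift.lift_add[OF inner] T.T.smult_add_r)
  qed (use c in \<open>simp add: pure\<close>)
  interpret L: bilinear_lift "tensor A A" A ?T ?\<gamma>
    by unfold_locales (simp add: bilinear_def closed add smult add_r smult_r)
  have mult: "?\<gamma> (x \<otimes>\<^bsub>tensor A A\<^esub> y) (c \<otimes>\<^bsub>A\<^esub> d) = ?\<gamma> x c \<otimes>\<^bsub>?T\<^esub> ?\<gamma> y d"
    if x: "x \<in> carrier (tensor A A)" and y: "y \<in> carrier (tensor A A)"
      and c: "c \<in> carrier A" "d \<in> carrier A" for x y c d
    using x
  proof (induction x rule: AA.tensor_induct)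
    case (pure a b)
    from y show ?case
    proof (induction y rule: AA.tensor_induct)
      case (pure a' b')
      then show ?case using \<open>a \<in> carrier A\<close> \<open>b \<in> carrier A\<close> c
        by (simp add: bilinear_lift.lift_pure[OF inner])
    next
      case (add y z)
      then show ?case using \<open>a \<in> carrier A\<close> \<open>b \<in> carrier A\<close> c
        by (simp add: AA.T.r_distr bilinear_lift.lift_add[OF inner] T.T.r_distr closed)
    qed
  next
    case (add x z)
    then show ?case using y c
      by (simp add: AA.T.l_distr bilinear_lift.lift_add[OF inner] T.T.l_distr closed)
  qed
  have eq: "tensor_assoc A = tensor_lift ?T ?\<gamma>" by (simp add: tensor_assoc_def Let_def)
  show "tensor_assoc A \<in> alg_hom (tensor (tensor A A) A) ?T"
    unfolding eq by (rule L.lift_alg_hom) (simp_all add: mult AA.one_tensor T.one_tensor pure)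
  show "tensor_assoc A (pure_tensor (tensor A A) A (pure_tensor A A a b) c)
        = pure_tensor A (tensor A A) a (pure_tensor A A b c)"
    if "a \<in> carrier A" "b \<in> carrier A" "c \<in> carrier A" for a b c
    unfolding eq using that by (simp add: pure)
qed

section \<open>Derivation of the Hopf axioms from the generators\<close>

locale hopf_gens =
  fixes H :: "('k::field, 'a, 'm) hopf_scheme" (structure) and g :: "'i gen \<Rightarrow> 'a"
  assumes hopf_generated: "hopf_generated H g"
begin

sublocale H: alg H
  using hopf_generated by unfold_locales (simp add: hopf_generated_def)

sublocale HH: tensor_product H H by unfold_locales

lemma generates: "generates H g"
  using hopf_generated by (simp add: hopf_generated_def)

lemma g_closed [simp, intro]: "g x \<in> carrier H"
  using generates by (rule generates_closed)

lemma inverses [simp]: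
  "g (K i) \<otimes> g (Kinv i) = \<one>" "g (Kinv i) \<otimes> g (K i) = \<one>"
  "g (K' i) \<otimes> g (Kinv' i) = \<one>" "g (Kinv' i) \<otimes> g (K' i) = \<one>"
  using hopf_generated by (simp_all add: hopf_generated_def)

lemma comult_hom: "comult H \<in> alg_hom H (tensor H H)"
  and comult_gen [simp]: "comult H (g x) = comult_on_gen H g x"
  and counit_hom: "counit H \<in> alg_hom H (scalar_algebra id)"
  and counit_gen [simp]: "counit H (g x) = counit_on_gen x"
  and antipode_hom: "antipode H \<in> alg_hom H (opposite H)"
  and antipode_gen [simp]: "antipode H (g x) = antipode_on_gen H g x"
  using hopf_generated by (simp_all add: hopf_generated_def)

lemmas comult = alg_homD[OF comult_hom]
lemmas counit = alg_homD[OF counit_hom, simplified]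
lemmas antipode = alg_homD[OF antipode_hom, simplified]

lemma coassoc:
  assumes x: "x \<in> carrier H"
  shows "tensor_assoc H (tensor_map (tensor H H) H (comult H) id (comult H x))
          = tensor_map H (tensor H H) id (comult H) (comult H x)"
proof -
  interpret T: tensor_product H "tensor H H" by unfold_locales
  interpret HH_H: tensor_product "tensor H H" H by unfold_locales
  note id = alg_hom_ident[of H, folded id_def]
  note m1 = tensor_map_alg_hom[OF H.assoc_algebra H.assoc_algebra HH.T.assoc_algebra H.assoc_algebra comult_hom id]
  note m2 = tensor_map_alg_hom[OF H.assoc_algebra H.assoc_algebra H.assoc_algebra HH.T.assoc_algebra id comult_hom]
  note as = tensor_assoc_alg_hom[OF H.assoc_algebra]
  note m1D = alg_homD[OF m1(1)] and m2D = alg_homD[OF m2(1)] and asD = alg_homD[OF as(1)]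
  have "tensor_assoc H (tensor_map (tensor H H) H (comult H) id (comult H (g y)))
          = tensor_map H (tensor H H) id (comult H) (comult H (g y))" for y
    by (cases y) (simp_all add: m1D m2D m1(2) m2(2) as(2) asD comult HH.one_tensor
        T.pure_add_r HH_H.pure_add_l T.T.a_assoc)
  then show ?thesis
    by (rule alg_hom_eqI[OF H.assoc_algebra generates
          alg_hom_comp[OF alg_hom_comp[OF comult_hom m1(1)] as(1)] alg_hom_comp[OF comult_hom m2(1)] _ x])
qed

lemma counit_laws:
  assumes x: "x \<in> carrier H"
  shows "tensor_lift H (\<lambda>a b. counit H a \<odot> b) (comult H x) = x"
    and "tensor_lift H (\<lambda>a b. counit H b \<odot> a) (comult H x) = x"
proof -
  interpret l: bilinear_lift H H H "\<lambda>a b. counit H a \<odot> b"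
    by unfold_locales (simp add: bilinear_def counit H.smult_add_l H.smult_add_r mult.commute)
  interpret r: bilinear_lift H H H "\<lambda>a b. counit H b \<odot> a"
    by unfold_locales (simp add: bilinear_def counit H.smult_add_l H.smult_add_r mult.commute)
  have l: "tensor_lift H (\<lambda>a b. counit H a \<odot> b) \<in> alg_hom HH.T H"
    by (rule l.lift_alg_hom) (simp_all add: counit mult.commute)
  have r: "tensor_lift H (\<lambda>a b. counit H b \<odot> a) \<in> alg_hom HH.T H"
    by (rule r.lift_alg_hom) (simp_all add: counit mult.commute)
  have "tensor_lift H (\<lambda>a b. counit H a \<odot> b) (comult H (g y)) = g y" for y
    by (cases y) (simp_all add: l.lift_add counit)
  then show "tensor_lift H (\<lambda>a b. counit H a \<odot> b) (comult H x) = x"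
    by (rule alg_hom_eqI[OF H.assoc_algebra generates alg_hom_comp[OF comult_hom l] alg_hom_ident _ x])
  have "tensor_lift H (\<lambda>a b. counit H b \<odot> a) (comult H (g y)) = g y" for y
    by (cases y) (simp_all add: r.lift_add counit)
  then show "tensor_lift H (\<lambda>a b. counit H b \<odot> a) (comult H x) = x"
    by (rule alg_hom_eqI[OF H.assoc_algebra generates alg_hom_comp[OF comult_hom r] alg_hom_ident _ x])
qed

text \<open>The convolution of antipode and identity is not a homomorphism, so checking generators
  is not enough: the identity must be shown to pass to products. This works because S (a' a) b' b =
  S a (S a' b') b: once the inner factor is the scalar c, it can be pulled out.\<close>

lemma antipode_left:
  assumes x: "x \<in> carrier H"
  shows "tensor_lift H (\<lambda>a b. antipode H a \<otimes> b) (comult H x) = counit H x \<odot> \<one>"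
proof -
  let ?L = "tensor_lift H (\<lambda>a b. antipode H a \<otimes> b)"
  interpret L: bilinear_lift H H H "\<lambda>a b. antipode H a \<otimes> b"
    by unfold_locales (simp add: bilinear_def antipode H.l_distr H.r_distr)
  have lift_mult: "?L (Z \<otimes>\<^bsub>HH.T\<^esub> Y) = c \<odot> ?L Y"
    if Z: "Z \<in> carrier HH.T" "?L Z = c \<odot> \<one>" and Y: "Y \<in> carrier HH.T" for Z Y c
    using Y
  proof (induction Y rule: HH.tensor_induct)
    case (pure a b)
    from Z(1) have "?L (Z \<otimes>\<^bsub>HH.T\<^esub> HH.pure a b) = antipode H a \<otimes> ?L Z \<otimes> b"
    proof (induction Z rule: HH.tensor_induct)
      case (pure a' b')
      then show ?case using \<open>a \<in> carrier H\<close> \<open>b \<in> carrier H\<close> by (simp add: antipode H.m_assoc)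
    next
      case (add Z Z')
      then show ?case using \<open>a \<in> carrier H\<close> \<open>b \<in> carrier H\<close>
        by (simp add: HH.T.l_distr L.lift_add H.l_distr H.r_distr antipode)
    qed
    then show ?case using Z(2) \<open>a \<in> carrier H\<close> \<open>b \<in> carrier H\<close> by (simp add: antipode)
  next
    case (add Y Y')
    then show ?case using Z(1) by (simp add: HH.T.r_distr L.lift_add H.smult_add_r)
  qed
  from x generates show ?thesis
  proof (induction rule: H.generates_induct)
    case one
    then show ?case by (simp add: comult counit HH.one_tensor antipode)
  next
    case (gen y)
    show ?case
      by (cases y) (simp_all add: L.lift_add antipode counit HH.T.a_closed H.l_neg H.r_neg H.l_minus H.m_assoc)
  next
    case (add y z)
    then show ?case by (simp add: comult counit L.lift_add H.smult_add_l)
  next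
    case (mult y z)
    then have "?L (comult H y \<otimes>\<^bsub>HH.T\<^esub> comult H z) = counit H y \<odot> ?L (comult H z)"
      by (intro lift_mult) (simp_all add: comult)
    with mult show ?case by (simp add: comult counit)
  next
    case (smult c y)
    then show ?case by (simp add: comult counit L.lift_smult)
  qed
qed

text \<open>Mirror image of the preceding argument: in a' b' = a S b with products inserted, the
  inner pair now comes from the right-hand factor of the product, so the scalar is that of the
  second element.\<close>

lemma antipode_right:
  assumes x: "x \<in> carrier H"
  shows "tensor_lift H (\<lambda>a b. a \<otimes> antipode H b) (comult H x) = counit H x \<odot> \<one>"
proof -
  let ?L = "tensor_lift H (\<lambda>a b. a \<otimes> antipode H b)"
  interpret L: bilinear_lift H H H "\<lambda>a b. a \<otimes> antipode H b"
    by unfold_locales (simp add: bilinear_def antipode H.l_distr H.r_distr)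
  have lift_mult: "?L (Y \<otimes>\<^bsub>HH.T\<^esub> Z) = c \<odot> ?L Y"
    if Z: "Z \<in> carrier HH.T" "?L Z = c \<odot> \<one>" and Y: "Y \<in> carrier HH.T" for Z Y c
    using Y
  proof (induction Y rule: HH.tensor_induct)
    case (pure a b)
    from Z(1) have "?L (HH.pure a b \<otimes>\<^bsub>HH.T\<^esub> Z) = a \<otimes> ?L Z \<otimes> antipode H b"
    proof (induction Z rule: HH.tensor_induct)
      case (pure a' b')
      then show ?case using \<open>a \<in> carrier H\<close> \<open>b \<in> carrier H\<close> by (simp add: antipode H.m_assoc)
    next
      case (add Z Z')
      then show ?case using \<open>a \<in> carrier H\<close> \<open>b \<in> carrier H\<close>
        by (simp add: HH.T.r_distr L.lift_add H.l_distr H.r_distr antipode)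
    qed
    then show ?case using Z(2) \<open>a \<in> carrier H\<close> \<open>b \<in> carrier H\<close> by (simp add: antipode)
  next
    case (add Y Y')
    then show ?case using Z(1) by (simp add: HH.T.l_distr L.lift_add H.smult_add_r)
  qed
  from x generates show ?thesis
  proof (induction rule: H.generates_induct)
    case one
    then show ?case by (simp add: comult counit HH.one_tensor antipode)
  next
    case (gen y)
    show ?case
      by (cases y) (simp_all add: L.lift_add antipode counit HH.T.a_closed H.l_neg H.r_neg H.r_minus
          H.m_assoc[symmetric])
  next
    case (add y z)
    then show ?case by (simp add: comult counit L.lift_add H.smult_add_l)
  next
    case (mult y z)
    then have "?L (comult H y \<otimes>\<^bsub>HH.T\<^esub> comult H z) = counit H z \<odot> ?L (comult H y)"
      by (intro lift_mult) (simp_all add: comult)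
    with mult show ?case by (simp add: comult counit mult.commute)
  next
    case (smult c y)
    then show ?case by (simp add: comult counit L.lift_smult)
  qed
qed

theorem hopf_algebra: "hopf_algebra H"
  unfolding hopf_algebra_def
  by (intro conjI ballI allI H.assoc_algebra comult_hom counit_hom coassoc counit_laws
      antipode_left antipode_right) (simp_all add: antipode)

end

lemma opposite_alg_hom: "h \<in> alg_hom A B \<Longrightarrow> h \<in> alg_hom (opposite A) (opposite B)"
  by (rule alg_homI) (auto simp: alg_homD)

text \<open>All three compatibilities are equations between homomorphisms, for the antipode into the
  opposite of L, and so follow from their values on generators.\<close>

lemma hopf_isoI:
  assumes H: "hopf_generated H g" and L: "hopf_generated L g'"
    and hom: "\<phi> \<in> alg_hom H L" and bij: "bij_betw \<phi> (carrier H) (carrier L)"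
    and gen: "\<And>x. \<phi> (g x) = g' x"
  shows "\<phi> \<in> hopf_iso H L"
proof -
  interpret H: hopf_gens H g by unfold_locales fact
  interpret L: hopf_gens L g' by unfold_locales fact
  note hD = alg_homD[OF hom] and z = alg_hom_minus[OF hom H.H.assoc_algebra L.H.assoc_algebra]
  note m = tensor_map_alg_hom[OF H.H.assoc_algebra H.H.assoc_algebra L.H.assoc_algebra L.H.assoc_algebra hom hom]
  have "comult L (\<phi> (g x)) = tensor_map L L \<phi> \<phi> (comult H (g x))" for x
    by (cases x) (simp_all add: gen m(2) alg_homD[OF m(1)] hD)
  then have "comult L (\<phi> x) = tensor_map L L \<phi> \<phi> (comult H x)" if "x \<in> carrier H" for x
    by (rule alg_hom_eqI[OF H.H.assoc_algebra H.generates alg_hom_comp[OF hom L.comult_hom]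
        alg_hom_comp[OF H.comult_hom m(1)] _ that])
  moreover have "counit L (\<phi> x) = counit H x" if "x \<in> carrier H" for x
    by (rule alg_hom_eqI[OF H.H.assoc_algebra H.generates alg_hom_comp[OF hom L.counit_hom]
        H.counit_hom _ that]) (simp add: gen)
  moreover have "antipode L (\<phi> (g x)) = \<phi> (antipode H (g x))" for x
    by (cases x) (simp_all add: gen hD z)
  then have "antipode L (\<phi> x) = \<phi> (antipode H x)" if "x \<in> carrier H" for x
    by (rule alg_hom_eqI[OF H.H.assoc_algebra H.generates alg_hom_comp[OF hom L.antipode_hom]
        alg_hom_comp[OF H.antipode_hom opposite_alg_hom[OF hom]] _ that])
  ultimately show ?thesis using hom bij by (simp add: hopf_iso_def)
qed

lemma alg_hom_bij:
  assumes "assoc_algebra A" "assoc_algebra B" "generates A g" "generates B g'"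
    and \<phi>: "\<phi> \<in> alg_hom A B" "\<And>x. \<phi> (g x) = g' x"
    and \<psi>: "\<psi> \<in> alg_hom B A" "\<And>x. \<psi> (g' x) = g x"
  shows "bij_betw \<phi> (carrier A) (carrier B)"
proof (rule bij_betw_byWitness[of _ \<psi>])
  show "\<forall>x\<in>carrier A. \<psi> (\<phi> x) = x"
    using alg_hom_eqI[OF assms(1,3) alg_hom_comp[OF \<phi>(1) \<psi>(1)] alg_hom_ident] \<phi>(2) \<psi>(2) by simp
  show "\<forall>x\<in>carrier B. \<phi> (\<psi> x) = x"
    using alg_hom_eqI[OF assms(2,4) alg_hom_comp[OF \<psi>(1) \<phi>(1)] alg_hom_ident] \<phi>(2) \<psi>(2) by simp
qed (use \<phi> \<psi> in \<open>auto simp: alg_homD\<close>)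

section \<open>The Hopf structure chosen by description\<close>

lemma hopf_on_gens_simps [simp]:
  "carrier (hopf_on_gens A g) = carrier A"
  "monoid.mult (hopf_on_gens A g) = monoid.mult A"
  "\<one>\<^bsub>hopf_on_gens A g\<^esub> = \<one>\<^bsub>A\<^esub>"
  "\<zero>\<^bsub>hopf_on_gens A g\<^esub> = \<zero>\<^bsub>A\<^esub>"
  "ring.add (hopf_on_gens A g) = ring.add A"
  "module.smult (hopf_on_gens A g) = module.smult A"
  by (simp_all add: hopf_on_gens_def module.defs)

text \<open>The two records may differ in the fields that extend \<open>module\<close>.\<close>

locale same_algebra =
  fixes H :: "('k::field, 'a, 'm) module_scheme" and A :: "('k, 'a, 'n) module_scheme"
  assumes same [simp]: "carrier H = carrier A" "monoid.mult H = monoid.mult A" "\<one>\<^bsub>H\<^esub> = \<one>\<^bsub>A\<^esub>"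
    "\<zero>\<^bsub>H\<^esub> = \<zero>\<^bsub>A\<^esub>" "ring.add H = ring.add A" "module.smult H = module.smult A"
begin

lemma same_tensor: "tensor H H = tensor A A"
  and same_pure: "pure_tensor H H = pure_tensor A A"
  by (simp_all add: tensor_def pure_tensor_def fun_eq_iff tensor_ideal_def bilinear_rels_def
      monoid_algebra_def DirProd_def)

lemma same_alg_hom: "alg_hom H B = alg_hom A B"
  and same_alg_hom_opposite: "alg_hom A (opposite H) = alg_hom A (opposite A)"
  by (simp_all add: alg_hom_def ring_hom_def)

lemma same_assoc_algebra:
  assumes "assoc_algebra A"
  shows "assoc_algebra H"
proof -
  interpret alg A by unfold_locales fact
  show ?thesis
  proof (rule assoc_algebraI)
    show "ring H"
    proof (rule ringI)
      show "abelian_group H"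
        by (rule abelian_groupI) (auto simp: a_ac intro: l_neg)
      show "monoid H" by (rule monoidI) (auto simp: m_assoc)
    qed (auto simp: l_distr r_distr)
  qed (simp_all add: smult_add_l smult_add_r)
qed

lemma same_alg_span: "x \<in> alg_span A G \<Longrightarrow> x \<in> alg_span H G"
proof (induction rule: alg_span.induct)
  case one then show ?case using alg_span.one[of H] by simp
next
  case gen then show ?case by (rule alg_span.gen)
next
  case add then show ?case using alg_span.add[of _ H] by simp
next
  case mult then show ?case using alg_span.mult[of _ H] by simp
next
  case smult then show ?case using alg_span.smult[of _ H] by simp
qed

lemma same_generates: "generates A g \<Longrightarrow> generates H g"
  by (auto simp: generates_def same_alg_span)

lemma same_comult_on_gen: "comult_on_gen H g x = comult_on_gen A g x"
  by (cases x) (simp_all add: same_tensor same_pure)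

lemma same_antipode_on_gen: "antipode_on_gen H g x = antipode_on_gen A g x"
  by (cases x) (simp_all add: a_inv_def m_inv_def)

end

lemma restrict_alg_hom:
  assumes "assoc_algebra A" "h \<in> alg_hom A B"
  shows "restrict h (carrier A) \<in> alg_hom A B"
proof -
  interpret alg A by unfold_locales fact
  show ?thesis by (rule alg_homI) (use alg_homD[OF assms(2)] in auto)
qed

text \<open>Existence comes from restricting h to the carrier. Uniqueness holds on the carrier
  because generators determine a homomorphism, and off it by extensionality.\<close>

lemma alg_hom_THE:
  assumes "assoc_algebra A" "generates A g" "h \<in> alg_hom A B" "\<And>x. h (g x) = v x"
  shows "(THE h. h \<in> alg_hom A B \<inter> extensional (carrier A) \<and> (\<forall>x. h (g x) = v x)) \<in> alg_hom A B \<and>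
    (\<forall>x. (THE h. h \<in> alg_hom A B \<inter> extensional (carrier A) \<and> (\<forall>x. h (g x) = v x)) (g x) = v x)"
proof -
  have "\<exists>!h. h \<in> alg_hom A B \<inter> extensional (carrier A) \<and> (\<forall>x. h (g x) = v x)"
  proof (rule ex1I[of _ "restrict h (carrier A)"])
    show "restrict h (carrier A) \<in> alg_hom A B \<inter> extensional (carrier A) \<and>
      (\<forall>x. restrict h (carrier A) (g x) = v x)"
      using restrict_alg_hom[OF assms(1,3)] assms(4) generates_closed[OF assms(2)] by simp
    fix h' assume h': "h' \<in> alg_hom A B \<inter> extensional (carrier A) \<and> (\<forall>x. h' (g x) = v x)"
    show "h' = restrict h (carrier A)"
    proof (rule extensionalityI[of _ "carrier A"])
      fix x assume x: "x \<in> carrier A"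
      have "h' x = h x"
        using h' assms(4) by (intro alg_hom_eqI[OF assms(1,2) _ assms(3) _ x]) auto
      with x show "h' x = restrict h (carrier A) x" by simp
    qed (use h' in auto)
  qed
  from theI'[OF this] show ?thesis by blast
qed

lemma hopf_on_gens_hopf_generated:
  assumes A: "assoc_algebra A" "generates A g"
    and inv: "\<And>i. g (K i) \<otimes>\<^bsub>A\<^esub> g (Kinv i) = \<one>\<^bsub>A\<^esub>" "\<And>i. g (Kinv i) \<otimes>\<^bsub>A\<^esub> g (K i) = \<one>\<^bsub>A\<^esub>"
      "\<And>i. g (K' i) \<otimes>\<^bsub>A\<^esub> g (Kinv' i) = \<one>\<^bsub>A\<^esub>" "\<And>i. g (Kinv' i) \<otimes>\<^bsub>A\<^esub> g (K' i) = \<one>\<^bsub>A\<^esub>"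
    and \<Delta>: "\<Delta> \<in> alg_hom A (tensor A A)" "\<And>x. \<Delta> (g x) = comult_on_gen A g x"
    and \<epsilon>: "\<epsilon> \<in> alg_hom A (scalar_algebra id)" "\<And>x. \<epsilon> (g x) = counit_on_gen x"
    and S: "S \<in> alg_hom A (opposite A)" "\<And>x. S (g x) = antipode_on_gen A g x"
  shows "hopf_generated (hopf_on_gens A g) g"
proof -
  interpret same_algebra "hopf_on_gens A g" A by unfold_locales simp_all
  have f: "comult (hopf_on_gens A g) = (THE \<Delta>. \<Delta> \<in> alg_hom A (tensor A A) \<inter> extensional (carrier A) \<and>
          (\<forall>x. \<Delta> (g x) = comult_on_gen A g x))"
    "counit (hopf_on_gens A g) = (THE \<epsilon>. \<epsilon> \<in> alg_hom A (scalar_algebra id) \<inter> extensional (carrier A) \<and>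
          (\<forall>x. \<epsilon> (g x) = counit_on_gen x))"
    "antipode (hopf_on_gens A g) = (THE S. S \<in> alg_hom A (opposite A) \<inter> extensional (carrier A) \<and>
          (\<forall>x. S (g x) = antipode_on_gen A g x))"
    by (simp_all add: hopf_on_gens_def module.defs hopf.defs)
  show ?thesis
    unfolding hopf_generated_def same_tensor same_alg_hom same_comult_on_gen same_antipode_on_gen
      same_alg_hom_opposite same f
    using alg_hom_THE[OF A \<Delta>] alg_hom_THE[OF A \<epsilon>] alg_hom_THE[OF A S] inv
      same_assoc_algebra[OF A(1)] same_generates[OF A(2)]
    by simp
qed

text \<open>Conjugating the structure maps of L by \<phi> and \<psi> produces homomorphisms with the
  prescribed values, which is the existence that the descriptions in \<open>hopf_on_gens A g\<close>
  require.\<close>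

lemma hopf_generated_transfer:
  assumes L: "hopf_generated L g'" and A: "assoc_algebra A" "generates A g"
    and \<phi>: "\<phi> \<in> alg_hom A L" "\<And>x. \<phi> (g x) = g' x"
    and \<psi>: "\<psi> \<in> alg_hom L A" "\<And>x. \<psi> (g' x) = g x"
  shows "hopf_generated (hopf_on_gens A g) g"
proof -
  interpret L: hopf_gens L g' by unfold_locales fact
  note \<psi>D = alg_homD[OF \<psi>(1)] and neg = alg_hom_minus[OF \<psi>(1) L.H.assoc_algebra A(1)]
  note m = tensor_map_alg_hom[OF L.H.assoc_algebra L.H.assoc_algebra A(1) A(1) \<psi>(1) \<psi>(1)]
  have inv: "g x \<otimes>\<^bsub>A\<^esub> g y = \<one>\<^bsub>A\<^esub>" if "g' x \<otimes>\<^bsub>L\<^esub> g' y = \<one>\<^bsub>L\<^esub>" for x y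
  proof -
    have "\<psi> (g' x \<otimes>\<^bsub>L\<^esub> g' y) = \<one>\<^bsub>A\<^esub>" unfolding that by (rule \<psi>D)
    then show ?thesis by (simp add: \<psi>D \<psi>(2))
  qed
  show ?thesis
  proof (rule hopf_on_gens_hopf_generated[OF A])
    show "(\<lambda>x. tensor_map A A \<psi> \<psi> (comult L (\<phi> x))) \<in> alg_hom A (tensor A A)"
      by (rule alg_hom_comp[OF alg_hom_comp[OF \<phi>(1) L.comult_hom] m(1)])
    show "(\<lambda>x. counit L (\<phi> x)) \<in> alg_hom A (scalar_algebra id)"
      by (rule alg_hom_comp[OF \<phi>(1) L.counit_hom])
    show "(\<lambda>x. \<psi> (antipode L (\<phi> x))) \<in> alg_hom A (opposite A)"
      by (rule alg_hom_comp[OF alg_hom_comp[OF \<phi>(1) L.antipode_hom] opposite_alg_hom[OF \<psi>(1)]])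
    show "tensor_map A A \<psi> \<psi> (comult L (\<phi> (g x))) = comult_on_gen A g x" for x
      by (cases x) (simp_all add: \<phi>(2) m(2) alg_homD[OF m(1)] \<psi>D \<psi>(2))
    show "\<psi> (antipode L (\<phi> (g x))) = antipode_on_gen A g x" for x
      by (cases x) (simp_all add: \<phi>(2) \<psi>D \<psi>(2) neg)
  qed (simp_all add: inv \<phi>(2))
qed

section \<open>Extension of scalars\<close>

locale scalar_extension = A: alg A + field_hom \<sigma>
  for A :: "('k::field, 'a, 'm) module_scheme" and \<sigma> :: "'k \<Rightarrow> 'l::field"
begin

sublocale S: alg "scalar_algebra \<sigma>"
  by unfold_locales (rule scalar_algebra_assoc_algebra)

sublocale tensor_product A "scalar_algebra \<sigma>" by unfold_locales

abbreviation "B \<equiv> extend_scalars \<sigma> A"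
abbreviation "\<iota> \<equiv> extend_elem \<sigma> A"

lemma extend_scalars_simps [simp]:
  "carrier B = carrier T"
  "monoid.mult B = monoid.mult T"
  "\<one>\<^bsub>B\<^esub> = \<one>\<^bsub>T\<^esub>"
  "\<zero>\<^bsub>B\<^esub> = \<zero>\<^bsub>T\<^esub>"
  "ring.add B = ring.add T"
  by (simp_all add: extend_scalars_def)

lemma smult_eq: "c \<odot>\<^bsub>B\<^esub> Z = tensor_lift T (\<lambda>a x. pure a (c * x)) Z"
  by (simp add: extend_scalars_def tensor_map_def)

lemma bilinear_smult: "bilinear_lift A (scalar_algebra \<sigma>) T (\<lambda>a x. pure a (c * x))"
proof unfold_locales
  have "pure a (c * (\<sigma> s * x)) = s \<odot>\<^bsub>T\<^esub> pure a (c * x)" if "a \<in> carrier A" for a x s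
    using pure_smult_r[OF that, of "c * x" s] by (simp add: mult_ac)
  moreover have "pure a (c * (x + y)) = pure a (c * x) \<oplus>\<^bsub>T\<^esub> pure a (c * y)" if "a \<in> carrier A" for a x y
    using pure_add_r[OF that, of "c * x" "c * y"] by (simp add: distrib_left)
  ultimately show "bilinear A (scalar_algebra \<sigma>) T (\<lambda>a x. pure a (c * x))"
    by (simp add: bilinear_def pure_add_l)
qed

lemma smult_pure [simp]: "a \<in> carrier A \<Longrightarrow> c \<odot>\<^bsub>B\<^esub> pure a x = pure a (c * x)"
  using bilinear_lift.lift_pure[OF bilinear_smult] by (simp add: smult_eq)

lemma smult_closed [simp, intro]: "Z \<in> carrier T \<Longrightarrow> c \<odot>\<^bsub>B\<^esub> Z \<in> carrier T"
  using bilinear_lift.lift_closed[OF bilinear_smult] by (simp add: smult_eq)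

lemma smult_add:
  "Y \<in> carrier T \<Longrightarrow> Z \<in> carrier T \<Longrightarrow> c \<odot>\<^bsub>B\<^esub> (Y \<oplus>\<^bsub>T\<^esub> Z) = c \<odot>\<^bsub>B\<^esub> Y \<oplus>\<^bsub>T\<^esub> c \<odot>\<^bsub>B\<^esub> Z"
  using bilinear_lift.lift_add[OF bilinear_smult] by (simp add: smult_eq)

lemma pure_mult_scalars:
  "a \<in> carrier A \<Longrightarrow> b \<in> carrier A \<Longrightarrow> pure a x \<otimes>\<^bsub>T\<^esub> pure b y = pure (a \<otimes>\<^bsub>A\<^esub> b) (x * y)"
  using pure_mult[of a x b y] by simp

lemma extend_scalars_assoc_algebra: "assoc_algebra B"
proof (rule assoc_algebraI)
  show "ring B" unfolding extend_scalars_def by (rule ring_with_smult[OF T.ring_axioms])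
  fix c d and Y Z assume "Y \<in> carrier B" "Z \<in> carrier B"
  then have Y: "Y \<in> carrier T" and Z: "Z \<in> carrier T" by simp_all
  show "c \<odot>\<^bsub>B\<^esub> Y \<in> carrier B" using Y by simp
  show "c \<odot>\<^bsub>B\<^esub> (Y \<oplus>\<^bsub>B\<^esub> Z) = c \<odot>\<^bsub>B\<^esub> Y \<oplus>\<^bsub>B\<^esub> c \<odot>\<^bsub>B\<^esub> Z" using Y Z by (simp add: smult_add)
  from Y have "(c + d) \<odot>\<^bsub>B\<^esub> Y = c \<odot>\<^bsub>B\<^esub> Y \<oplus>\<^bsub>T\<^esub> d \<odot>\<^bsub>B\<^esub> Y"
  proof (induction Y rule: tensor_induct)
    case (pure a x)
    then show ?case using pure_add_r[of a "c * x" "d * x"] by (simp add: distrib_right)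
  qed (simp add: smult_add T.a_ac)
  then show "(c + d) \<odot>\<^bsub>B\<^esub> Y = c \<odot>\<^bsub>B\<^esub> Y \<oplus>\<^bsub>B\<^esub> d \<odot>\<^bsub>B\<^esub> Y" by simp
  from Y show "(c * d) \<odot>\<^bsub>B\<^esub> Y = c \<odot>\<^bsub>B\<^esub> (d \<odot>\<^bsub>B\<^esub> Y)"
    by (induction Y rule: tensor_induct) (simp_all add: smult_add mult.assoc)
  from Y show "1 \<odot>\<^bsub>B\<^esub> Y = Y"
    by (induction Y rule: tensor_induct) (simp_all add: smult_add)
  from Y have "(c \<odot>\<^bsub>B\<^esub> Y) \<otimes>\<^bsub>T\<^esub> Z = c \<odot>\<^bsub>B\<^esub> (Y \<otimes>\<^bsub>T\<^esub> Z) \<and> Z \<otimes>\<^bsub>T\<^esub> (c \<odot>\<^bsub>B\<^esub> Y) = c \<odot>\<^bsub>B\<^esub> (Z \<otimes>\<^bsub>T\<^esub> Y)"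
  proof (induction Y rule: tensor_induct)
    case (pure a x)
    from Z show ?case
      by (induction Z rule: tensor_induct)
        (use pure in \<open>simp_all add: pure_mult_scalars smult_add T.r_distr T.l_distr mult_ac\<close>)
  qed (use Z in \<open>simp add: smult_add T.r_distr T.l_distr\<close>)
  then show "(c \<odot>\<^bsub>B\<^esub> Y) \<otimes>\<^bsub>B\<^esub> Z = c \<odot>\<^bsub>B\<^esub> (Y \<otimes>\<^bsub>B\<^esub> Z)" by simp
next
  fix c and Y Z assume "Y \<in> carrier B" "Z \<in> carrier B"
  then have Y: "Y \<in> carrier T" and Z: "Z \<in> carrier T" by simp_all
  from Z have "Y \<otimes>\<^bsub>T\<^esub> (c \<odot>\<^bsub>B\<^esub> Z) = c \<odot>\<^bsub>B\<^esub> (Y \<otimes>\<^bsub>T\<^esub> Z)"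
  proof (induction Z rule: tensor_induct)
    case (pure a x)
    from Y show ?case
      by (induction Y rule: tensor_induct)
        (use pure in \<open>simp_all add: pure_mult_scalars smult_add T.r_distr T.l_distr mult_ac\<close>)
  qed (use Y in \<open>simp add: smult_add T.r_distr T.l_distr\<close>)
  then show "Y \<otimes>\<^bsub>B\<^esub> (c \<odot>\<^bsub>B\<^esub> Z) = c \<odot>\<^bsub>B\<^esub> (Y \<otimes>\<^bsub>B\<^esub> Z)" by simp
qed

sublocale B: alg B by unfold_locales (rule extend_scalars_assoc_algebra)

text \<open>Scalars of the small field can be moved across the tensor sign, so the new action on the
  second factor extends the old one.\<close>

lemma restricted_smult: "Z \<in> carrier T \<Longrightarrow> \<sigma> c \<odot>\<^bsub>B\<^esub> Z = c \<odot>\<^bsub>T\<^esub> Z"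
proof (induction Z rule: tensor_induct)
  case (pure a x)
  then show ?case using pure_smult_r[of a x c] by simp
qed (simp add: smult_add T.smult_add_r)

lemma elem_closed [simp, intro]: "a \<in> carrier A \<Longrightarrow> \<iota> a \<in> carrier T"
  by (simp add: extend_elem_def)

lemma pure_as_smult: "a \<in> carrier A \<Longrightarrow> pure a x = x \<odot>\<^bsub>B\<^esub> \<iota> a"
  by (simp add: extend_elem_def)

lemma elem_alg_hom: "\<iota> \<in> alg_hom A (restrict_scalars \<sigma> B)"
proof (rule alg_homI)
  show "\<iota> (c \<odot>\<^bsub>A\<^esub> a) = c \<odot>\<^bsub>restrict_scalars \<sigma> B\<^esub> \<iota> a" if "a \<in> carrier A" for c a
    using that by (simp add: extend_elem_def restricted_smult del: smult_pure)
qed (simp_all add: extend_elem_def pure_add_l pure_mult_scalars one_tensor)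

lemmas elem = alg_homD[OF elem_alg_hom, simplified]

text \<open>Over the large field the pure tensor of a and x is x times \<open>\<iota> a\<close>, so
  it is enough to reach the image of A.\<close>

lemma extend_scalars_generates:
  assumes "generates A g"
  shows "generates B (\<lambda>x. \<iota> (g x))"
  unfolding generates_def
proof (intro conjI subsetI)
  show "Z \<in> carrier B" if "Z \<in> range (\<lambda>x. \<iota> (g x))" for Z
    using that generates_closed[OF assms] by auto
  let ?S = "alg_span B (range (\<lambda>x. \<iota> (g x)))"
  have elem: "\<iota> a \<in> ?S" if "a \<in> carrier A" for a
    using that assms
  proof (induction rule: A.generates_induct)
    case one show ?case using alg_span.one[of B] by (simp add: elem)
  next
    case (gen y) show ?case by (rule alg_span.gen) simp
  next
    case (add x y) then show ?case using alg_span.add[of "\<iota> x" B _ "\<iota> y"] by (simp add: elem)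
  next
    case (mult x y) then show ?case using alg_span.mult[of "\<iota> x" B _ "\<iota> y"] by (simp add: elem)
  next
    case (smult c x) then show ?case using alg_span.smult[of "\<iota> x" B _ "\<sigma> c"] by (simp add: elem)
  qed
  fix Z assume "Z \<in> carrier B"
  then have "Z \<in> carrier T" by simp
  then show "Z \<in> ?S"
  proof (induction Z rule: tensor_induct)
    case (pure a x)
    then show ?case unfolding pure_as_smult[OF pure(1)] by (intro alg_span.smult elem)
  next
    case (add Y Z)
    then show ?case using alg_span.add[of Y B _ Z] by simp
  qed
qed

text \<open>The map is described by its values on pure tensors and by additivity, because the three
  structure maps of \<open>extend_hopf\<close> are lifts with different targets and none of them is
  literally the lift used for a general extension.\<close>

lemma extension_alg_hom:
  assumes C: "assoc_algebra C" and h: "h \<in> alg_hom A (restrict_scalars \<sigma> C)"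
    and pure: "\<And>a x. a \<in> carrier A \<Longrightarrow> h' (pure a x) = x \<odot>\<^bsub>C\<^esub> h a"
    and add: "\<And>Y Z. Y \<in> carrier T \<Longrightarrow> Z \<in> carrier T \<Longrightarrow> h' (Y \<oplus>\<^bsub>T\<^esub> Z) = h' Y \<oplus>\<^bsub>C\<^esub> h' Z"
  shows "h' \<in> alg_hom B C" and "\<And>a. a \<in> carrier A \<Longrightarrow> h' (\<iota> a) = h a"
proof -
  interpret C: alg C by unfold_locales fact
  note hD = alg_homD[OF h, simplified]
  have closed: "h' Z \<in> carrier C" if "Z \<in> carrier T" for Z
    using that by (induction Z rule: tensor_induct) (simp_all add: pure add hD)
  show "h' \<in> alg_hom B C"
  proof (rule alg_homI)
    show "h' (Y \<oplus>\<^bsub>B\<^esub> Z) = h' Y \<oplus>\<^bsub>C\<^esub> h' Z" if "Y \<in> carrier B" "Z \<in> carrier B" for Y Z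
      using that add by simp
    have "h' (Y \<otimes>\<^bsub>T\<^esub> Z) = h' Y \<otimes>\<^bsub>C\<^esub> h' Z" if Y: "Y \<in> carrier T" and Z: "Z \<in> carrier T" for Y Z
      using Y
    proof (induction Y rule: tensor_induct)
      case (pure a x)
      from Z show ?case
        by (induction Z rule: tensor_induct)
          (use \<open>a \<in> carrier A\<close> in \<open>simp_all add: pure_mult_scalars assms(3) add hD T.r_distr C.r_distr closed mult_ac\<close>)
    qed (use Z in \<open>simp add: add T.l_distr C.l_distr closed\<close>)
    then show "h' (Y \<otimes>\<^bsub>B\<^esub> Z) = h' Y \<otimes>\<^bsub>C\<^esub> h' Z" if "Y \<in> carrier B" "Z \<in> carrier B" for Y Z
      using that by simp
    have "h' (c \<odot>\<^bsub>B\<^esub> Z) = c \<odot>\<^bsub>C\<^esub> h' Z" if "Z \<in> carrier T" for c Z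
      using that by (induction Z rule: tensor_induct) (simp_all add: pure add hD smult_add closed C.smult_add_r)
    then show "h' (c \<odot>\<^bsub>B\<^esub> Z) = c \<odot>\<^bsub>C\<^esub> h' Z" if "Z \<in> carrier B" for c Z
      using that by simp
  qed (simp_all add: closed one_tensor pure hD)
  show "h' (\<iota> a) = h a" if "a \<in> carrier A" for a
    using that by (simp add: extend_elem_def pure hD)
qed

lemma tensor_lift_extension:
  assumes C: "assoc_algebra C" and h: "h \<in> alg_hom A (restrict_scalars \<sigma> C)"
  defines "h' \<equiv> tensor_lift (restrict_scalars \<sigma> C) (\<lambda>a x. x \<odot>\<^bsub>C\<^esub> h a)"
  shows "h' \<in> alg_hom B C" and "\<And>a. a \<in> carrier A \<Longrightarrow> h' (\<iota> a) = h a"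
proof -
  interpret C: alg C by unfold_locales fact
  note hD = alg_homD[OF h, simplified]
  interpret R: alg "restrict_scalars \<sigma> C"
    by unfold_locales (rule restrict_scalars_assoc_algebra[OF C])
  interpret L: bilinear_lift A "scalar_algebra \<sigma>" "restrict_scalars \<sigma> C" "\<lambda>a x. x \<odot>\<^bsub>C\<^esub> h a"
    by unfold_locales (simp add: bilinear_def hD C.smult_add_l C.smult_add_r mult_ac)
  show "h' \<in> alg_hom B C" and "\<And>a. a \<in> carrier A \<Longrightarrow> h' (\<iota> a) = h a"
    unfolding h'_def using L.lift_add by (intro extension_alg_hom[OF C h]; simp)+
qed

end

lemma extend_hopf_simps [simp]:
  "carrier (extend_hopf \<sigma> H) = carrier (extend_scalars \<sigma> H)"
  "monoid.mult (extend_hopf \<sigma> H) = monoid.mult (extend_scalars \<sigma> H)"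
  "\<one>\<^bsub>extend_hopf \<sigma> H\<^esub> = \<one>\<^bsub>extend_scalars \<sigma> H\<^esub>"
  "\<zero>\<^bsub>extend_hopf \<sigma> H\<^esub> = \<zero>\<^bsub>extend_scalars \<sigma> H\<^esub>"
  "ring.add (extend_hopf \<sigma> H) = ring.add (extend_scalars \<sigma> H)"
  "module.smult (extend_hopf \<sigma> H) = module.smult (extend_scalars \<sigma> H)"
  by (simp_all add: extend_hopf_def Let_def module.defs)

text \<open>Composed with the canonical embeddings, the structure maps of H are homomorphisms over
  the small field into the tensor square, the large field and the opposite algebra; the maps of
  \<open>extend_hopf\<close> are their linear extensions.\<close>

theorem extend_hopf_generated:
  assumes "hopf_generated H g" "field_hom \<sigma>"
  shows "hopf_generated (extend_hopf \<sigma> H) (\<lambda>x. extend_elem \<sigma> H (g x))"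
proof -
  interpret H: hopf_gens H g by unfold_locales fact
  interpret field_hom \<sigma> by fact
  interpret X: scalar_extension H \<sigma> by unfold_locales
  interpret BB: tensor_product X.B X.B by unfold_locales
  interpret same_algebra "extend_hopf \<sigma> H" X.B by unfold_locales simp_all
  interpret R: alg "restrict_scalars \<sigma> BB.T"
    by unfold_locales (rule restrict_scalars_assoc_algebra[OF BB.tensor_assoc_algebra])
  note elem = X.elem
  let ?\<iota>\<iota> = "tensor_lift (restrict_scalars \<sigma> BB.T) (\<lambda>a b. BB.pure (X.\<iota> a) (X.\<iota> b))"
  interpret I: bilinear_lift H H "restrict_scalars \<sigma> BB.T" "\<lambda>a b. BB.pure (X.\<iota> a) (X.\<iota> b)"
    using BB.pure_add_l BB.pure_add_r BB.pure_smult_l BB.pure_smult_r BB.pure_closed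
    by unfold_locales (simp add: bilinear_def elem)
  have \<iota>\<iota>: "?\<iota>\<iota> \<in> alg_hom (tensor H H) (restrict_scalars \<sigma> BB.T)"
    using BB.pure_mult BB.one_tensor by (intro I.lift_alg_hom) (simp_all add: elem)
  have f: "comult (extend_hopf \<sigma> H) = tensor_lift (restrict_scalars \<sigma> BB.T) (\<lambda>a c. c \<odot>\<^bsub>BB.T\<^esub> ?\<iota>\<iota> (comult H a))"
    "counit (extend_hopf \<sigma> H) = tensor_lift (scalar_algebra \<sigma>) (\<lambda>a c. \<sigma> (counit H a) * c)"
    "antipode (extend_hopf \<sigma> H) = tensor_map H (scalar_algebra \<sigma>) (antipode H) id"
    by (simp_all add: extend_hopf_def Let_def module.defs hopf.defs)
  note \<Delta> = X.tensor_lift_extension[OF BB.tensor_assoc_algebra alg_hom_comp[OF H.comult_hom \<iota>\<iota>], folded f(1)]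
  interpret E: bilinear_lift H "scalar_algebra \<sigma>" "scalar_algebra \<sigma>" "\<lambda>a c. \<sigma> (counit H a) * c"
    by unfold_locales (simp add: bilinear_def H.counit hom_add hom_mult algebra_simps)
  have "(\<lambda>a. \<sigma> (counit H a)) \<in> alg_hom H (restrict_scalars \<sigma> (scalar_algebra id))"
    by (rule alg_homI) (simp_all add: H.counit hom_add hom_mult)
  note \<epsilon> = X.extension_alg_hom[OF scalar_id_assoc_algebra this, of "counit (extend_hopf \<sigma> H)"]
  have \<epsilon>': "counit (extend_hopf \<sigma> H) \<in> alg_hom X.B (scalar_algebra id)"
    "\<And>a. a \<in> carrier H \<Longrightarrow> counit (extend_hopf \<sigma> H) (X.\<iota> a) = \<sigma> (counit H a)"
    using E.lift_add by (intro \<epsilon>; simp add: f)+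
  interpret S: bilinear_lift H "scalar_algebra \<sigma>" X.T "\<lambda>a c. X.pure (antipode H a) c"
    using X.pure_smult_r X.pure_add_r
    by unfold_locales (simp add: bilinear_def H.antipode X.pure_add_l)
  interpret O: alg "opposite X.B" by unfold_locales (rule X.B.opposite_assoc_algebra)
  have "(\<lambda>a. X.\<iota> (antipode H a)) \<in> alg_hom H (restrict_scalars \<sigma> (opposite X.B))"
    by (rule alg_homI) (simp_all add: H.antipode elem)
  note S = X.extension_alg_hom[OF O.assoc_algebra this, of "antipode (extend_hopf \<sigma> H)"]
  have Sp: "tensor_lift X.T (\<lambda>a. X.pure (antipode H a)) (X.pure a x) = x \<odot>\<^bsub>X.B\<^esub> X.\<iota> (antipode H a)"
    if "a \<in> carrier H" for a x
    using that S.lift_pure[of a x] X.pure_as_smult[of "antipode H a" x] H.antipode(1)[of a] by simp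
  have S': "antipode (extend_hopf \<sigma> H) \<in> alg_hom X.B (opposite X.B)"
    "\<And>a. a \<in> carrier H \<Longrightarrow> antipode (extend_hopf \<sigma> H) (X.\<iota> a) = X.\<iota> (antipode H a)"
    using S.lift_add Sp by (intro S; simp add: f tensor_map_def)+
  have inv: "X.\<iota> x \<otimes>\<^bsub>X.T\<^esub> X.\<iota> y = \<one>\<^bsub>X.T\<^esub>" if "x \<otimes>\<^bsub>H\<^esub> y = \<one>\<^bsub>H\<^esub>" "x \<in> carrier H" "y \<in> carrier H" for x y
    using elem(3)[of x y] elem(4) that by simp
  have neg: "X.\<iota> (\<ominus>\<^bsub>H\<^esub> x) = \<ominus>\<^bsub>X.B\<^esub> X.\<iota> x" if "x \<in> carrier H" for x
    using that elem(5)[of x "- 1"] by (simp add: H.H.minus_eq_smult X.B.minus_eq_smult hom_minus)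
  have "comult (extend_hopf \<sigma> H) (X.\<iota> (g x)) = comult_on_gen X.B (\<lambda>x. X.\<iota> (g x)) x" for x
    by (cases x) (simp_all add: \<Delta>(2) I.lift_add elem)
  moreover have "antipode (extend_hopf \<sigma> H) (X.\<iota> (g x)) = antipode_on_gen X.B (\<lambda>x. X.\<iota> (g x)) x" for x
    by (cases x) (simp_all add: S'(2) elem neg)
  moreover have "counit (extend_hopf \<sigma> H) (X.\<iota> (g x)) = counit_on_gen x" for x
    by (cases x) (simp_all add: \<epsilon>'(2))
  moreover have "generates (extend_hopf \<sigma> H) (\<lambda>x. X.\<iota> (g x))"
    by (rule same_generates[OF X.extend_scalars_generates[OF H.generates]])
  ultimately show ?thesis
    unfolding hopf_generated_def same_tensor same_alg_hom same_comult_on_gen same_antipode_on_gen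
      same_alg_hom_opposite
    using \<Delta>(1) \<epsilon>'(1) S'(1) same_assoc_algebra[OF X.extend_scalars_assoc_algebra]
    by (simp add: inv)
qed

section \<open>Presented algebras\<close>

lemma free_monoid_simps [simp]:
  "carrier free_monoid = UNIV" "x \<otimes>\<^bsub>free_monoid\<^esub> y = x @ y" "\<one>\<^bsub>free_monoid\<^esub> = []"
  by (simp_all add: free_monoid_def)

lemma free_monoid_monoid: "monoid free_monoid"
  by (rule monoidI) simp_all

lemma free_algebra_eq: "free_algebra = tw_algebra free_monoid (\<lambda>_ _. 1)"
  by (simp add: free_algebra_def monoid_algebra_eq_tw_algebra)

lemma free_cocycle_trivial: "cocycle free_monoid (\<lambda>_ _. 1)"
  by (rule monoid.cocycle_trivial[OF free_monoid_monoid])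

section \<open>Evaluation of words and of linear combinations of words\<close>

definition word_prod :: "('k, 'a, 'm) module_scheme \<Rightarrow> ('x \<Rightarrow> 'a) \<Rightarrow> 'x list \<Rightarrow> 'a" where
  "word_prod A f w = foldr (\<lambda>x y. f x \<otimes>\<^bsub>A\<^esub> y) w \<one>\<^bsub>A\<^esub>"

lemma word_prod_simps [simp]:
  "word_prod A f [] = \<one>\<^bsub>A\<^esub>" "word_prod A f (x # w) = f x \<otimes>\<^bsub>A\<^esub> word_prod A f w"
  by (simp_all add: word_prod_def)

context alg
begin

lemma word_prod_closed [simp, intro]: "(\<And>x. f x \<in> carrier A) \<Longrightarrow> word_prod A f w \<in> carrier A"
  by (induction w) simp_all

lemma word_prod_append:
  "(\<And>x. f x \<in> carrier A) \<Longrightarrow> word_prod A f (u @ w) = word_prod A f u \<otimes> word_prod A f w"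
  by (induction u) (simp_all add: m_assoc)

lemma word_prod_replicate:
  "(\<And>x. f x \<in> carrier A) \<Longrightarrow> word_prod A f (replicate n x) = f x [^] n"
proof (induction n)
  case (Suc n)
  then show ?case using nat_pow_Suc2[of "f x" n] by simp
qed simp

lemma eval_alg_hom:
  "(\<And>x. f x \<in> carrier A) \<Longrightarrow> lin_ext A (word_prod A f) \<in> alg_hom free_algebra A"
  unfolding free_algebra_eq
  by (rule lin_ext_alg_hom[OF free_cocycle_trivial assoc_algebra]) (auto simp: word_prod_append)

end

lemma alg_hom_kernel_ideal:
  assumes A: "assoc_algebra A" and B: "assoc_algebra B" and h: "h \<in> alg_hom A B"
  shows "ideal {x \<in> carrier A. h x = \<zero>\<^bsub>B\<^esub>} A"
proof -
  interpret A: alg A by unfold_locales fact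
  interpret B: alg B by unfold_locales fact
  note hD = alg_homD[OF h] alg_hom_zero[OF h A B] alg_hom_minus[OF h A B]
  show ?thesis
  proof (rule idealI)
    show "subgroup {x \<in> carrier A. h x = \<zero>\<^bsub>B\<^esub>} (add_monoid A)"
      by (rule A.add.subgroupI) (auto simp: hD a_inv_def[symmetric])
  qed (auto simp: hD A.ring_axioms)
qed

lemma word_prod_alg_hom:
  assumes "h \<in> alg_hom A B" "assoc_algebra A" "\<And>x. f x \<in> carrier A"
  shows "h (word_prod A f w) = word_prod B (\<lambda>x. h (f x)) w"
proof -
  interpret alg A by unfold_locales fact
  show ?thesis using assms(3) by (induction w) (simp_all add: alg_homD[OF assms(1)])
qed

lemma lin_ext_alg_hom_comp:
  assumes h: "h \<in> alg_hom A B" and A: "assoc_algebra A" and B: "assoc_algebra B"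
    and \<beta>: "\<And>x. \<beta> x \<in> carrier A"
  shows "h (lin_ext A \<beta> f) = lin_ext B (\<lambda>x. h (\<beta> x)) f"
proof -
  interpret A: alg A by unfold_locales fact
  interpret B: alg B by unfold_locales fact
  note hD = alg_homD[OF h] alg_hom_zero[OF h A B]
  have p: "\<beta> \<in> UNIV \<rightarrow> carrier A" "(\<lambda>x. h (\<beta> x)) \<in> UNIV \<rightarrow> carrier B" using \<beta> hD by auto
  show ?thesis using subset_UNIV[of "keys f"]
  proof (induction f rule: poly_mapping_keys_induct)
    case (add f g)
    then show ?case
      using A.lin_ext_closed[OF _ p(1)]
      by (simp add: A.lin_ext_add[OF _ _ p(1)] B.lin_ext_add[OF _ _ p(2)] hD)
  qed (simp_all add: \<beta> hD)
qed

text \<open>The scalar by which the product of the letters of a word, formed in the algebra twisted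
  by \<alpha>, differs from the word itself.\<close>

fun twist :: "('x list \<Rightarrow> 'x list \<Rightarrow> 'k::field) \<Rightarrow> 'x list \<Rightarrow> 'k" where
  "twist \<alpha> [] = 1"
| "twist \<alpha> (x # w) = \<alpha> [x] w * twist \<alpha> w"

text \<open>Covers presented algebras, with \<alpha> = 1, and the star algebra. Because \<alpha>
  never vanishes, each word is a multiple of the twisted product of its letters, so the letters
  generate for the twisted product too.\<close>

locale free_quotient = cocycle free_monoid \<alpha> + alg_ideal "tw_algebra free_monoid \<alpha>" J
  for \<alpha> :: "'x list \<Rightarrow> 'x list \<Rightarrow> 'k::field" and J +
  assumes \<alpha>_nonzero: "\<alpha> u w \<noteq> 0"
begin

abbreviation "Q \<equiv> quot_algebra (tw_algebra free_monoid \<alpha>) J"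
abbreviation "\<pi> f \<equiv> J +>\<^bsub>tw_algebra free_monoid \<alpha>\<^esub> f"
abbreviation "gen x \<equiv> \<pi> (single [x] 1)"

sublocale Q: alg Q by unfold_locales (rule quot_algebra_assoc_algebra)

lemma carrier_free [simp]: "f \<in> carrier (tw_algebra free_monoid \<alpha>)"
  by simp

lemma \<pi>_closed [simp, intro]: "\<pi> f \<in> carrier Q"
  by (rule coset_closed) simp

lemmas \<pi> = alg_homD[OF coset_alg_hom, simplified]

lemma twist_nonzero: "twist \<alpha> w \<noteq> 0"
  by (induction w) (simp_all add: \<alpha>_nonzero)

lemma word_prod_gen: "word_prod Q gen w = \<pi> (single w (twist \<alpha> w))"
proof (induction w)
  case Nil
  then show ?case using \<pi>(4) by simp
next
  case (Cons x w)
  have "gen x \<otimes>\<^bsub>Q\<^esub> \<pi> (single w (twist \<alpha> w))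
    = \<pi> (tw_mult free_monoid \<alpha> (single [x] 1) (single w (twist \<alpha> w)))"
    by (rule \<pi>(3)[symmetric])
  with Cons show ?case by simp
qed

lemma \<pi>_single: "\<pi> (single w c) = (c / twist \<alpha> w) \<odot>\<^bsub>Q\<^esub> word_prod Q gen w"
  unfolding word_prod_gen \<pi>(5)[symmetric] using twist_nonzero[of w] by simp

lemma generates_gen: "generates Q gen"
  unfolding generates_def
proof (intro conjI subsetI)
  fix Z assume "Z \<in> carrier Q"
  then obtain f where f: "Z = \<pi> f" by (auto simp: quot_algebra_simps)
  have word: "word_prod Q gen w \<in> alg_span Q (range gen)" for w
    by (induction w) (auto intro: alg_span.intros)
  have "\<pi> f \<in> alg_span Q (range gen)" using subset_UNIV[of "keys f"]
  proof (induction f rule: poly_mapping_keys_induct)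
    case zero
    \<comment> \<open>\<open>alg_span\<close> has no rule for zero; it is reached as 0 times the
      empty word.\<close>
    have "\<pi> (single [] 0) \<in> alg_span Q (range gen)"
      by (subst \<pi>_single) (intro alg_span.smult word)
    then show ?case by simp
  next
    case (single w c)
    show ?case by (subst \<pi>_single) (intro alg_span.smult word)
  next
    case (add f g)
    then show ?case using \<pi>(2)[of f g] by (simp add: alg_span.add)
  qed
  with f show "Z \<in> alg_span Q (range gen)" by simp
qed auto

lemma \<pi>_eq_zero: "f \<in> J \<Longrightarrow> \<pi> f = \<zero>\<^bsub>Q\<^esub>"
  by (simp add: quot_algebra_simps a_rcos_zero[OF is_ideal])

end

locale presentation =
  fixes R :: "('x list \<Rightarrow>\<^sub>0 'k::field) set"
begin

lemma free_quotient: "free_quotient (\<lambda>_ _. 1) (Idl\<^bsub>free_algebra\<^esub> R)"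
proof -
  interpret C: cocycle free_monoid "\<lambda>_ _. 1 :: 'k" by (rule free_cocycle_trivial)
  interpret F: alg "tw_algebra free_monoid (\<lambda>_ _. 1 :: 'k)"
    by unfold_locales (rule C.tw_algebra_assoc_algebra)
  interpret I: ideal "Idl\<^bsub>free_algebra\<^esub> R" "tw_algebra free_monoid (\<lambda>_ _. 1 :: 'k)"
    unfolding free_algebra_eq by (rule F.genideal_ideal) simp
  show ?thesis
    by (intro free_quotient.intro alg_ideal.intro free_quotient_axioms.intro
        C.cocycle_axioms F.alg_axioms I.ideal_axioms) simp
qed

sublocale free_quotient "\<lambda>_ _. 1" "Idl\<^bsub>free_algebra\<^esub> R" by (rule free_quotient)

abbreviation "P \<equiv> presented R"

lemma presented_eq: "P = Q" "presented_gen R = gen"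
  by (simp_all add: presented_def presented_gen_def free_algebra_eq fun_eq_iff)

sublocale P: alg P by (simp add: presented_eq Q.alg_axioms)

lemma presented_generates: "generates P (presented_gen R)"
  unfolding presented_eq by (rule generates_gen)

lemma presented_gen_closed [simp, intro]: "presented_gen R x \<in> carrier P"
  unfolding presented_eq by (rule \<pi>_closed)

lemma eval_presented: "lin_ext P (word_prod P (presented_gen R)) f = \<pi> f"
proof -
  have one: "twist (\<lambda>_ _. 1 :: 'k) w = 1" for w :: "'x list" by (induction w) simp_all
  have c: "word_prod Q gen \<in> UNIV \<rightarrow> carrier Q" by auto
  show ?thesis unfolding presented_eq using subset_UNIV[of "keys f"]
  proof (induction f rule: poly_mapping_keys_induct)
    case zero
    then show ?case using \<pi>_eq_zero[OF zero_closed] by simp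
  next
    case (single w a)
    then show ?case using \<pi>_single[of w a] by (simp add: one)
  next
    case (add f g)
    then show ?case by (simp add: Q.lin_ext_add[OF _ _ c] \<pi>(2))
  qed
qed

lemma relation_holds:
  assumes "r \<in> R"
  shows "lin_ext P (word_prod P (presented_gen R)) r = \<zero>\<^bsub>P\<^esub>"
proof -
  have "r \<in> Idl\<^bsub>free_algebra\<^esub> R"
    using assms genideal_self[of R] by (auto simp: free_algebra_eq)
  from \<pi>_eq_zero[OF this] show ?thesis unfolding eval_presented by (simp add: presented_eq)
qed

lemma presented_lift:
  assumes B: "assoc_algebra B" and f: "\<And>x. f x \<in> carrier B"
    and rel: "\<And>r. r \<in> R \<Longrightarrow> lin_ext B (word_prod B f) r = \<zero>\<^bsub>B\<^esub>"
  obtains h where "h \<in> alg_hom P B" "\<And>x. h (presented_gen R x) = f x"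
proof -
  interpret B: alg B by unfold_locales fact
  let ?e = "lin_ext B (word_prod B f)"
  have e: "?e \<in> alg_hom (tw_algebra free_monoid (\<lambda>_ _. 1)) B"
    using B.eval_alg_hom[of f, OF f] by (simp add: free_algebra_eq)
  have "Idl\<^bsub>free_algebra\<^esub> R \<subseteq> {x \<in> carrier (tw_algebra free_monoid (\<lambda>_ _. 1)). ?e x = \<zero>\<^bsub>B\<^esub>}"
    unfolding free_algebra_eq
    using alg_hom_kernel_ideal[OF assoc_algebra B e] rel by (intro genideal_minimal) auto
  then have "?e y = \<zero>\<^bsub>B\<^esub>" if "y \<in> Idl\<^bsub>free_algebra\<^esub> R" for y using that by blast
  from quot_lift[OF B e this] obtain h where h: "h \<in> alg_hom Q B" "\<And>x. h (\<pi> x) = ?e x"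
    by auto
  show thesis
  proof
    show "h \<in> alg_hom P B" using h(1) by (simp add: presented_eq)
    show "h (presented_gen R x) = f x" for x by (simp add: presented_eq h(2) f)
  qed
qed

end

section \<open>Quantum Serre sums as iterated skew commutators\<close>

text \<open>Equivalent to q being nonzero and not a root of unity. The case n = 1 has content:
  division by zero yields 0, so it excludes q = 0 and q^2 = 1.\<close>

locale generic_parameter =
  fixes q :: "'k::field"
  assumes quantum_int_nonzero: "n \<ge> 1 \<Longrightarrow> quantum_int q n \<noteq> 0"
begin

lemma q_nonzero [simp]: "q \<noteq> 0"
  using quantum_int_nonzero[of 1] by (auto simp: quantum_int_def)

lemma quantum_fact_nonzero: "quantum_fact q n \<noteq> 0"
  by (simp add: quantum_fact_def quantum_int_nonzero)

lemma quantum_fact_Suc: "quantum_fact q (Suc n) = quantum_int q (Suc n) * quantum_fact q n"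
  by (simp add: quantum_fact_def prod.nat_ivl_Suc')

lemma quantum_int_add:
  "quantum_int q (m + n) = q ^ m * quantum_int q n + inverse q ^ n * quantum_int q m"
proof -
  have "q ^ (m + n) - inverse q ^ (m + n)
    = q ^ m * (q ^ n - inverse q ^ n) + inverse q ^ n * (q ^ m - inverse q ^ m)"
    by (simp only: power_add) (simp add: algebra_simps)
  then show ?thesis by (simp add: quantum_int_def add_divide_distrib)
qed

lemma quantum_binomial_0 [simp]: "quantum_binomial q n 0 = 1"
  using quantum_fact_nonzero[of n] by (simp add: quantum_binomial_def quantum_fact_def)

lemma quantum_binomial_self [simp]: "quantum_binomial q n n = 1"
  using quantum_fact_nonzero[of n] by (simp add: quantum_binomial_def quantum_fact_def)

text \<open>The splitting of [n+1] along n + 1 = (p+1) + (n-p), multiplied by the appropriate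
  quotient of factorials.\<close>

lemma quantum_binomial_Suc:
  assumes "p < n"
  shows "quantum_binomial q (Suc n) (Suc p) =
    q ^ Suc p * quantum_binomial q n (Suc p) + inverse q ^ (n - p) * quantum_binomial q n p"
proof -
  obtain m where n: "n = Suc (p + m)" using assms less_imp_Suc_add by blast
  define f where "f = quantum_fact q"
  have nz: "f p \<noteq> 0" "f m \<noteq> 0" "quantum_int q (Suc p) \<noteq> 0" "quantum_int q (Suc m) \<noteq> 0"
    by (auto simp: f_def quantum_fact_nonzero quantum_int_nonzero)
  have s: "f (Suc j) = quantum_int q (Suc j) * f j" for j by (simp add: f_def quantum_fact_Suc)
  have e: "quantum_int q (Suc (Suc (p + m))) =
      q ^ Suc p * quantum_int q (Suc m) + inverse q ^ Suc m * quantum_int q (Suc p)"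
    using quantum_int_add[of "Suc p" "Suc m"] by simp
  have d: "Suc (Suc (p + m)) - Suc p = Suc m" "Suc (p + m) - Suc p = m" "Suc (p + m) - p = Suc m"
    by simp_all
  have "quantum_binomial q (Suc n) (Suc p)
    = quantum_int q (Suc (Suc (p + m))) * f (Suc (p + m)) / (f (Suc p) * f (Suc m))"
    by (simp only: quantum_binomial_def n d f_def[symmetric] s[of "Suc (p + m)"])
  also have "\<dots> = q ^ Suc p * (f (Suc (p + m)) / (f (Suc p) * f m))
      + inverse q ^ Suc m * (f (Suc (p + m)) / (f p * f (Suc m)))"
    unfolding e s[of p] s[of m] using nz by (simp add: field_simps)
  finally show ?thesis by (simp only: quantum_binomial_def n d f_def[symmetric])
qed

end

text \<open>If a group-like k scales x by q^2 and y by q^a under conjugation, this is the factor by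
  which it scales the m-th commutator. Each commutator is therefore the adjoint action of x on the
  preceding one.\<close>

definition skew_exp :: "'k::field \<Rightarrow> int \<Rightarrow> nat \<Rightarrow> 'k" where
  "skew_exp q a m = q powi (a + 2 * int m)"

lemma skew_exp_eq: "q \<noteq> 0 \<Longrightarrow> skew_exp q a m = q powi a * (q\<^sup>2) ^ m"
  by (simp add: skew_exp_def power_int_add power_int_mult)

section \<open>Skew commutators and their relation to the Serre sum\<close>

context alg
begin

definition serre :: "'k \<Rightarrow> nat \<Rightarrow> 'a \<Rightarrow> 'a \<Rightarrow> 'a" where
  "serre q n x y =
     (\<Oplus>p\<in>{..n}. ((- 1) ^ p * quantum_binomial q n p) \<odot> (x [^] p \<otimes> y \<otimes> x [^] (n - p)))"

fun skew :: "'k \<Rightarrow> int \<Rightarrow> 'a \<Rightarrow> 'a \<Rightarrow> nat \<Rightarrow> 'a" where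
  "skew q a x y 0 = y"
| "skew q a x y (Suc m) = x \<otimes> skew q a x y m \<ominus> skew_exp q a m \<odot> (skew q a x y m \<otimes> x)"

lemma skew_closed [simp, intro]: "x \<in> carrier A \<Longrightarrow> y \<in> carrier A \<Longrightarrow> skew q a x y m \<in> carrier A"
  by (induction m) simp_all

lemma minus_smult_eq: "x \<in> carrier A \<Longrightarrow> y \<in> carrier A \<Longrightarrow> x \<ominus> c \<odot> y = x \<oplus> (- c) \<odot> y"
  by (simp add: a_minus_def minus_smult)

text \<open>Both recursions below send index p to p and p + 1. The guards supply the end terms that
  one of the two sums lacks.\<close>

lemma pascal_sum:
  assumes w: "\<And>p. w p \<in> carrier A"
  shows "(\<Oplus>p\<in>{..n}. \<beta> p \<odot> w (Suc p)) \<oplus> (\<Oplus>p\<in>{..n}. \<gamma> p \<odot> w p) =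
    (\<Oplus>p\<in>{..Suc n}. ((if p = 0 then 0 else \<beta> (p - 1)) + (if p \<le> n then \<gamma> p else 0)) \<odot> w p)"
proof -
  have "(\<Oplus>p\<in>{..n}. \<beta> p \<odot> w (Suc p)) = (\<Oplus>p\<in>{..Suc n}. (if p = 0 then 0 else \<beta> (p - 1)) \<odot> w p)"
    using w by (subst finsum_Suc2) (auto intro!: finsum_closed)
  moreover have "(\<Oplus>p\<in>{..n}. \<gamma> p \<odot> w p) = (\<Oplus>p\<in>{..Suc n}. (if p \<le> n then \<gamma> p else 0) \<odot> w p)"
  proof -
    have "(\<Oplus>p\<in>{..n}. \<gamma> p \<odot> w p) = (\<Oplus>p\<in>{..n}. (if p \<le> n then \<gamma> p else 0) \<odot> w p)"
      using w by (intro finsum_cong') auto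
    then show ?thesis using w by (subst finsum_Suc) (auto intro!: finsum_closed)
  qed
  ultimately show ?thesis using w by (simp add: smult_add_l finsum_addf)
qed

lemma nat_pow_Suc_left: "x \<in> carrier A \<Longrightarrow> x \<otimes> x [^] (n::nat) = x [^] Suc n"
  using nat_pow_Suc2[of x n] by simp

text \<open>Left and right multiplication by x, say L and R, commute, so the n-fold commutator is
  the product of the operators L - q^(a+2m) R for m < n applied to y. The formula is the q-binomial
  theorem for this product.\<close>

lemma skew_eq_sum:
  assumes "generic_parameter q" and x: "x \<in> carrier A" and y: "y \<in> carrier A"
  shows "skew q a x y n = (\<Oplus>p\<in>{..n}. ((- (q powi a)) ^ (n - p) * q ^ ((n - 1) * (n - p)) * quantum_binomial q n p)
      \<odot> (x [^] p \<otimes> y \<otimes> x [^] (n - p)))"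
proof (induction n)
  case 0
  interpret generic_parameter q by fact
  show ?case using x y by simp
next
  case (Suc n)
  interpret generic_parameter q by fact
  define b where "b n p = (- (q powi a)) ^ (n - p) * q ^ ((n - 1) * (n - p)) * quantum_binomial q n p" for n p
  define w where "w p = x [^] p \<otimes> y \<otimes> x [^] (Suc n - p)" for p
  have w: "w p \<in> carrier A" for p using x y by (simp add: w_def)
  let ?s = "\<Oplus>p\<in>{..n}. b n p \<odot> (x [^] p \<otimes> y \<otimes> x [^] (n - p))"
  have "x \<otimes> ?s = (\<Oplus>p\<in>{..n}. b n p \<odot> w (Suc p))"
    using x y by (subst finsum_rdistr) (auto simp: w_def nat_pow_Suc_left m_assoc[symmetric] simp del: nat_pow_Suc intro!: finsum_cong')
  moreover have "- skew_exp q a n \<odot> (?s \<otimes> x) = (\<Oplus>p\<in>{..n}. (- skew_exp q a n * b n p) \<odot> w p)"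
    using x y by (subst finsum_ldistr; (subst smult_finsum)?)
      (auto simp: w_def m_assoc Suc_diff_le intro!: finsum_cong')
  moreover have "skew q a x y (Suc n) = x \<otimes> ?s \<oplus> (- skew_exp q a n) \<odot> (?s \<otimes> x)"
  proof -
    have "?s \<in> carrier A" using x y by (auto intro!: finsum_closed)
    moreover have "skew q a x y n = ?s" unfolding Suc by (simp only: b_def)
    ultimately show ?thesis using x by (simp only: skew.simps minus_smult_eq m_closed)
  qed
  ultimately have "skew q a x y (Suc n) =
      (\<Oplus>p\<in>{..n}. b n p \<odot> w (Suc p)) \<oplus> (\<Oplus>p\<in>{..n}. (- skew_exp q a n * b n p) \<odot> w p)"
    by (simp only:)
  also have "\<dots> = (\<Oplus>p\<in>{..Suc n}. ((if p = 0 then 0 else b n (p - 1))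
      + (if p \<le> n then - skew_exp q a n * b n p else 0)) \<odot> w p)"
    by (rule pascal_sum[OF w])
  also have "\<dots> = (\<Oplus>p\<in>{..Suc n}. b (Suc n) p \<odot> w p)"
  proof (intro finsum_cong' refl)
    fix p assume p: "p \<in> {..Suc n}"
    have e: "skew_exp q a n = q powi a * q ^ (2 * n)"
      by (simp add: skew_exp_eq power_mult)
    have "(if p = 0 then 0 else b n (p - 1)) + (if p \<le> n then - skew_exp q a n * b n p else 0) = b (Suc n) p"
    proof (cases p)
      case 0
      \<comment> \<open>The end term p = 0 involves only powers of q; the truncated n - 1 is why n =
        0 is split off.\<close>
      have "n * 2 + n * (n - Suc 0) = n + n * n" by (cases n) auto
      then have "q ^ (n * 2 + n * (n - Suc 0)) = q ^ (n + n * n)" by (rule arg_cong)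
      then show ?thesis using 0 by (simp only: b_def e) (simp add: power_add[symmetric] mult_ac)
    next
      case (Suc p')
      show ?thesis
      proof (cases "p = Suc n")
        case True
        then show ?thesis by (simp add: b_def)
      next
        case False
        with p Suc have "p' < n" by simp
        then obtain m where n: "n = Suc (p' + m)" using less_imp_Suc_add by blast
        \<comment> \<open>The q-Pascal rule for the new coefficient; \<open>F2\<close> and
          \<open>F3\<close> redistribute the powers of q so that its two summands become the two
          terms of the recursion.\<close>
        have B: "quantum_binomial q (Suc n) (Suc p') =
          q ^ Suc p' * quantum_binomial q n (Suc p') + inverse q ^ Suc m * quantum_binomial q n p'"
          using quantum_binomial_Suc[of p' n] n by simp
        define c where "c = - (q powi a)"
        have d: "Suc n - Suc p' = Suc m" and d2: "n - Suc p' = m" using n by simp_all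
        have b1: "b (Suc n) p = c ^ Suc m * q ^ (n * Suc m) * quantum_binomial q (Suc n) (Suc p')"
          by (simp only: b_def c_def Suc d diff_Suc_1)
        have F1: "b (Suc n) p = c ^ Suc m * q ^ (n * Suc m) * q ^ Suc p' * quantum_binomial q n (Suc p')
            + c ^ Suc m * (q ^ (n * Suc m) * inverse q ^ Suc m) * quantum_binomial q n p'"
          by (simp only: b1 B distrib_left mult_ac)
        have F2: "q ^ (n * Suc m) * inverse q ^ Suc m = q ^ ((n - 1) * Suc m)"
          unfolding n by (simp add: power_add power_mult field_simps)
        have F3: "q ^ (n * Suc m) * q ^ Suc p' = q ^ (2 * n) * q ^ ((n - 1) * m)"
          unfolding n power_add[symmetric] by (rule arg_cong[of _ _ "power q"]) (simp add: algebra_simps)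
        have F4: "b n (p - 1) = c ^ Suc m * q ^ ((n - 1) * Suc m) * quantum_binomial q n p'"
          using Suc n by (simp add: b_def c_def)
        have F5: "- skew_exp q a n * b n p = c ^ Suc m * (q ^ (2 * n) * q ^ ((n - 1) * m)) * quantum_binomial q n (Suc p')"
          by (simp only: b_def e Suc d2 c_def) (simp add: mult_ac)
        have "(if p = 0 then 0 else b n (p - 1)) + (if p \<le> n then - skew_exp q a n * b n p else 0)
            = b n (p - 1) + - skew_exp q a n * b n p"
          using Suc n by simp
        also have "\<dots> = b (Suc n) p"
          unfolding F4 F5 F3[symmetric] F2[symmetric] F1 by (simp only: mult.assoc add.commute)
        finally show ?thesis .
      qed
    qed
    then show "((if p = 0 then 0 else b n (p - 1)) + (if p \<le> n then - skew_exp q a n * b n p else 0)) \<odot> w p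
      = b (Suc n) p \<odot> w p" by simp
  qed (use w in auto)
  finally show ?case by (simp add: b_def w_def)
qed

text \<open>For n = 1 - a with n > 0 one has q^a q^(n-1) = 1, so every power of q in
  \<open>skew_eq_sum\<close> cancels and the coefficients agree up to the overall sign. For n = 0
  there is nothing to cancel.\<close>

lemma serre_eq_skew:
  assumes "generic_parameter q" and x: "x \<in> carrier A" and y: "y \<in> carrier A"
    and n: "int n = 1 - a"
  shows "serre q n x y = (- 1) ^ n \<odot> skew q a x y n"
proof -
  interpret generic_parameter q by fact
  have c: "(- 1) ^ n * ((- (q powi a)) ^ (n - p) * q ^ ((n - 1) * (n - p)) * quantum_binomial q n p)
      = (- 1) ^ p * quantum_binomial q n p" if "p \<le> n" for p
  proof -
    from n have "n \<ge> 1 \<or> n = 0" by auto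
    have "q powi a * q ^ (n - 1) = 1" if "n \<ge> 1"
    proof -
      have "q powi a * q powi (int (n - 1)) = 1"
        using n that by (simp add: power_int_add[symmetric] of_nat_diff)
      then show ?thesis by simp
    qed
    then have "(q powi a) ^ (n - p) * q ^ ((n - 1) * (n - p)) = 1"
      by (cases "n = 0") (auto simp: power_mult power_mult_distrib[symmetric])
    moreover have "(- 1) ^ n * (- 1) ^ (n - p) = ((- 1) ^ p :: 'k)"
      using that by (simp add: uminus_power_if)
    moreover have "(- (q powi a)) ^ (n - p) = (- 1) ^ (n - p) * (q powi a) ^ (n - p)"
      by (simp add: power_mult_distrib[symmetric])
    ultimately show ?thesis by (simp add: mult.assoc[symmetric])
  qed
  show ?thesis
    unfolding skew_eq_sum[OF assms(1) x y] serre_def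
    using x y by (subst smult_finsum) (auto simp: c[unfolded One_nat_def] intro!: finsum_cong')
qed

lemma serre_zero_iff_skew:
  assumes "generic_parameter q" "x \<in> carrier A" "y \<in> carrier A" "int n = 1 - a"
  shows "serre q n x y = \<zero> \<longleftrightarrow> skew q a x y n = \<zero>"
proof -
  have "(- 1) ^ n \<odot> ((- 1) ^ n \<odot> skew q a x y n) = skew q a x y n"
    using assms by (simp add: power_mult_distrib[symmetric])
  then show ?thesis unfolding serre_eq_skew[OF assms] by (metis smult_zero)
qed

lemma nat_pow_opposite: "x [^]\<^bsub>opposite A\<^esub> (n::nat) = x [^] n" if "x \<in> carrier A"
proof -
  interpret O: alg "opposite A" by unfold_locales (rule opposite_assoc_algebra)
  show ?thesis
    by (induction n) (use that O.nat_pow_Suc nat_pow_Suc_left in \<open>simp_all\<close>)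
qed

text \<open>Reversing the products exchanges p and n - p. The binomials are symmetric, so only the
  sign (-1)^n remains.\<close>

lemma serre_opposite:
  assumes x: "x \<in> carrier A" and y: "y \<in> carrier A"
  shows "alg.serre (opposite A) q n x y = (- 1) ^ n \<odot> serre q n x y"
proof -
  interpret O: alg "opposite A" by unfold_locales (rule opposite_assoc_algebra)
  let ?w = "\<lambda>p. x [^] p \<otimes> y \<otimes> x [^] (n - p)"
  have f: "finsum (opposite A) f I = finsum A f I" for f :: "nat \<Rightarrow> 'a" and I
    by (simp add: finsum_def finprod_def opposite_def)
  have "O.serre q n x y = (\<Oplus>p\<in>{..n}. ((- 1) ^ p * quantum_binomial q n p) \<odot> ?w (n - p))"
    unfolding O.serre_def f using x y
    by (intro finsum_cong') (auto simp: nat_pow_opposite m_assoc)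
  also have "\<dots> = (\<Oplus>p\<in>(\<lambda>p. n - p) ` {..n}. ((- 1) ^ (n - p) * quantum_binomial q n (n - p)) \<odot> ?w p)"
    using x y by (subst finsum_reindex) (auto simp: inj_on_def intro!: finsum_cong')
  also have "(\<lambda>p. n - p) ` {..n} = {..n}"
    by (auto simp: image_iff) (metis atMost_iff diff_diff_cancel diff_le_self)
  also have "(\<Oplus>p\<in>{..n}. ((- 1) ^ (n - p) * quantum_binomial q n (n - p)) \<odot> ?w p) = (- 1) ^ n \<odot> serre q n x y"
  proof -
    have "(- 1) ^ (n - p) * quantum_binomial q n (n - p) = (- 1) ^ n * ((- 1) ^ p * quantum_binomial q n p)"
      if "p \<le> n" for p
      using that by (simp add: quantum_binomial_def mult.commute uminus_power_if)
    then show ?thesis unfolding serre_def using x y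
      by (subst smult_finsum) (auto intro!: finsum_cong')
  qed
  finally show ?thesis .
qed

text \<open>Every monomial of the m-th commutator contains x exactly m times and y once.\<close>

lemma mult_commute_skew:
  assumes "x \<in> carrier A" "y \<in> carrier A" "z \<in> carrier A"
    and "z \<otimes> x = c \<odot> (x \<otimes> z)" "z \<otimes> y = d \<odot> (y \<otimes> z)"
  shows "z \<otimes> skew q a x y m = (c ^ m * d) \<odot> (skew q a x y m \<otimes> z)"
proof (induction m)
  case (Suc m)
  let ?Y = "skew q a x y m"
  have cl: "?Y \<in> carrier A" using assms by simp
  have "z \<otimes> (x \<otimes> ?Y) = c \<odot> (x \<otimes> (z \<otimes> ?Y))"
    using assms cl by (simp add: m_assoc[symmetric])
  also have "\<dots> = (c ^ Suc m * d) \<odot> (x \<otimes> ?Y \<otimes> z)"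
    using assms(1-3) cl Suc by (simp add: m_assoc mult_ac)
  finally have 1: "z \<otimes> (x \<otimes> ?Y) = (c ^ Suc m * d) \<odot> (x \<otimes> ?Y \<otimes> z)" .
  have "z \<otimes> (?Y \<otimes> x) = (c ^ m * d) \<odot> (?Y \<otimes> (z \<otimes> x))"
    using assms(1-3) cl Suc by (simp add: m_assoc[symmetric])
  also have "\<dots> = (c ^ Suc m * d) \<odot> (?Y \<otimes> x \<otimes> z)"
    using assms cl by (simp add: m_assoc mult_ac)
  finally have 2: "z \<otimes> (?Y \<otimes> x) = (c ^ Suc m * d) \<odot> (?Y \<otimes> x \<otimes> z)" .
  show ?case using assms(1-3) cl 1 2
    by (simp add: r_distr l_distr smult_add_r minus_smult_eq mult_ac)
qed (use assms in simp)

lemma commute_skew: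
  assumes "x \<in> carrier A" "y \<in> carrier A" "z \<in> carrier A" "z \<otimes> x = x \<otimes> z" "z \<otimes> y = y \<otimes> z"
  shows "z \<otimes> skew q a x y m = skew q a x y m \<otimes> z"
  using mult_commute_skew[of x y z 1 1] assms by simp

text \<open>The antipode sends \<open>x\<close> and \<open>y\<close> to multiples of \<open>k x\<close> and \<open>l y\<close>, with \<open>k\<close> and \<open>l\<close> group-like.\<close>

lemma skew_antipode:
  assumes c: "x \<in> carrier A" "y \<in> carrier A" "k \<in> carrier A" "l \<in> carrier A"
    and kl: "k \<otimes> l = l \<otimes> k"
    and xk: "x \<otimes> k = q\<^sup>2 \<odot> (k \<otimes> x)" and xl: "x \<otimes> l = q powi a \<odot> (l \<otimes> x)"
    and yk: "y \<otimes> k = q powi a \<odot> (k \<otimes> y)"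
    and q: "q \<noteq> 0"
  shows "\<exists>r. skew q a (\<mu> \<odot> (k \<otimes> x)) (\<nu> \<odot> (l \<otimes> y)) m = r \<odot> (k [^] m \<otimes> l \<otimes> skew q a x y m)"
proof (induction m)
  case 0
  then show ?case using c by (intro exI[of _ \<nu>]) simp
next
  case (Suc m)
  then obtain r where r: "skew q a (\<mu> \<odot> (k \<otimes> x)) (\<nu> \<odot> (l \<otimes> y)) m = r \<odot> (k [^] m \<otimes> l \<otimes> skew q a x y m)"
    by blast
  let ?Y = "skew q a x y m"
  let ?e = "skew_exp q a m"
  have Y: "?Y \<in> carrier A" using c by simp
  have e: "?e = q powi a * (q\<^sup>2) ^ m" using q by (rule skew_exp_eq)
  have xkm: "x \<otimes> k [^] j = (q\<^sup>2) ^ j \<odot> (k [^] j \<otimes> x)" for j :: nat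
  proof (induction j)
    case (Suc j)
    have "x \<otimes> (k [^] j \<otimes> k) = (q\<^sup>2) ^ j \<odot> (k [^] j \<otimes> (x \<otimes> k))"
      using c Suc by (simp add: m_assoc[symmetric])
    then show ?case using c xk by (simp add: m_assoc mult_ac)
  qed (use c in simp)
  have yk': "?Y \<otimes> k = ?e \<odot> (k \<otimes> ?Y)"
  proof -
    have "k \<otimes> x = inverse (q\<^sup>2) \<odot> (x \<otimes> k)" "k \<otimes> y = inverse (q powi a) \<odot> (y \<otimes> k)"
      using c xk yk q by simp_all
    from mult_commute_skew[OF c(1-3) this, of q a m]
    have "k \<otimes> ?Y = inverse ?e \<odot> (?Y \<otimes> k)" using q by (simp add: e power_inverse mult.commute)
    then show ?thesis using c Y q by (simp add: skew_exp_def)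
  qed
  have kml: "k [^] j \<otimes> l = l \<otimes> k [^] j" for j :: nat
  proof (induction j)
    case (Suc j)
    have "k [^] j \<otimes> k \<otimes> l = k [^] j \<otimes> l \<otimes> k" using c kl by (simp add: m_assoc)
    then show ?case using Suc c by (simp add: m_assoc)
  qed (use c in simp)
  have "(k \<otimes> x) \<otimes> (k [^] m \<otimes> l \<otimes> ?Y) = k \<otimes> (x \<otimes> k [^] m) \<otimes> l \<otimes> ?Y"
    using c Y by (simp add: m_assoc)
  also have "\<dots> = (q\<^sup>2) ^ m \<odot> (k \<otimes> k [^] m \<otimes> (x \<otimes> l) \<otimes> ?Y)"
    using c Y by (simp add: xkm m_assoc)
  also have "\<dots> = ?e \<odot> (k [^] Suc m \<otimes> l \<otimes> (x \<otimes> ?Y))"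
    using c Y by (simp add: xl nat_pow_Suc_left m_assoc e mult_ac del: nat_pow_Suc flip: m_assoc)
  finally have 1: "(k \<otimes> x) \<otimes> (k [^] m \<otimes> l \<otimes> ?Y) = ?e \<odot> (k [^] Suc m \<otimes> l \<otimes> (x \<otimes> ?Y))" .
  have "(k [^] m \<otimes> l \<otimes> ?Y) \<otimes> (k \<otimes> x) = k [^] m \<otimes> l \<otimes> (?Y \<otimes> k) \<otimes> x"
    using c Y by (simp add: m_assoc)
  also have "\<dots> = ?e \<odot> (k [^] m \<otimes> (l \<otimes> k) \<otimes> ?Y \<otimes> x)"
    using c Y by (simp add: yk' m_assoc)
  also have "\<dots> = ?e \<odot> (k [^] Suc m \<otimes> l \<otimes> (?Y \<otimes> x))"
    using c Y by (simp add: kl[symmetric] m_assoc)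
  finally have 2: "(k [^] m \<otimes> l \<otimes> ?Y) \<otimes> (k \<otimes> x) = ?e \<odot> (k [^] Suc m \<otimes> l \<otimes> (?Y \<otimes> x))" .
  \<comment> \<open>By 1 and 2 both halves of the next commutator acquire the same factor, so it
    remains a multiple of the commutator of x and y.\<close>
  have "skew q a (\<mu> \<odot> (k \<otimes> x)) (\<nu> \<odot> (l \<otimes> y)) (Suc m)
    = (\<mu> * r * ?e) \<odot> (k [^] Suc m \<otimes> l \<otimes> skew q a x y (Suc m))"
    using c Y 1 2 by (simp add: r minus_smult_eq r_distr smult_add_r mult_ac del: nat_pow_Suc)
  then show ?case by blast
qed

end

text \<open>The Gaussian binomial as a polynomial in z, later z = q^2; the recursion avoids
  quotients of factorials and hence any condition on z.\<close>

fun gauss_binomial :: "'k::field \<Rightarrow> nat \<Rightarrow> nat \<Rightarrow> 'k" where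
  "gauss_binomial z m 0 = 1"
| "gauss_binomial z 0 (Suc r) = 0"
| "gauss_binomial z (Suc m) (Suc r) = gauss_binomial z m (Suc r) + z ^ (m - r) * gauss_binomial z m r"

lemma gauss_binomial_eq_0: "m < r \<Longrightarrow> gauss_binomial z m r = 0"
  by (induction z m r rule: gauss_binomial.induct) simp_all

lemma gauss_binomial_self [simp]: "gauss_binomial z m m = 1"
  by (induction m) (simp_all add: gauss_binomial_eq_0)

text \<open>The second of the two Pascal rules, the power of z standing at the other term. The
  recursion for \<open>coproduct_coeff\<close> uses both.\<close>

lemma gauss_binomial_Suc:
  "gauss_binomial z (Suc m) (Suc r) = z ^ Suc r * gauss_binomial z m (Suc r) + gauss_binomial z m r"
proof (induction m arbitrary: r)
  case 0
  show ?case by (cases r) simp_all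
next
  case (Suc m)
  show ?case
  proof (cases r)
    case 0
    have "gauss_binomial z (Suc (Suc m)) 1 = gauss_binomial z (Suc m) 1 + z ^ Suc m" by simp
    also have "\<dots> = z * gauss_binomial z m 1 + 1 + z ^ Suc m" using Suc[of 0] by simp
    also have "\<dots> = z * gauss_binomial z (Suc m) 1 + 1" by (simp add: algebra_simps)
    finally show ?thesis using 0 by simp
  next
    case (Suc s)
    show ?thesis
    proof (cases "r \<le> m")
      case True
      obtain d where d: "m = r + d" using True le_Suc_ex by blast
      have "gauss_binomial z (Suc (Suc m)) (Suc r)
        = gauss_binomial z (Suc m) (Suc r) + z ^ Suc d * gauss_binomial z (Suc m) r"
        using d by (simp add: Suc_diff_le)
      also have "\<dots> = (z ^ Suc r * gauss_binomial z m (Suc r) + gauss_binomial z m r)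
        + z ^ Suc d * (z ^ r * gauss_binomial z m r + gauss_binomial z m s)"
        using Suc.IH[of r] Suc.IH[of s] \<open>r = Suc s\<close> by (simp only:)
      also have "\<dots> = z ^ Suc r * (gauss_binomial z m (Suc r) + z ^ d * gauss_binomial z m r)
        + (gauss_binomial z m r + z ^ Suc d * gauss_binomial z m s)"
        by (simp add: algebra_simps)
      also have "\<dots> = z ^ Suc r * gauss_binomial z (Suc m) (Suc r) + gauss_binomial z (Suc m) r"
        using d \<open>r = Suc s\<close> by (simp add: Suc_diff_le)
      finally show ?thesis .
    next
      case False
      then show ?thesis
        by (cases "r = Suc m") (simp_all add: gauss_binomial_eq_0 del: gauss_binomial.simps)
    qed
  qed
qed

text \<open>With z = q^2 and b = q^(2a), the coefficient in the coproduct of the m-th commutator of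
  the term that has \<open>x1^(m-r) k1^r l1\<close> in one factor and the r-th commutator in the
  other.\<close>

definition coproduct_coeff :: "'k::field \<Rightarrow> 'k \<Rightarrow> nat \<Rightarrow> nat \<Rightarrow> 'k" where
  "coproduct_coeff z b m r = gauss_binomial z m r * (\<Prod>k\<in>{r..<m}. 1 - b * z ^ k)"

lemma coproduct_coeff_Suc:
  assumes r: "r \<le> Suc m"
  shows "coproduct_coeff z b (Suc m) r =
    (if r = 0 then 0 else coproduct_coeff z b m (r - 1) * z ^ (m - (r - 1))) +
    (if r \<le> m then coproduct_coeff z b m r * (1 - b * z ^ (r + m)) else 0)"
proof (cases r)
  case 0
  then show ?thesis by (simp add: coproduct_coeff_def)
next
  case (Suc s)
  show ?thesis
  proof (cases "s = m")
    case True
    then show ?thesis using Suc by (simp add: coproduct_coeff_def gauss_binomial_eq_0)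
  next
    case False
    with Suc r have "s < m" by simp
    define P where "P = (\<Prod>k\<in>{r..<m}. 1 - b * z ^ k)"
    have P1: "(\<Prod>k\<in>{r..<Suc m}. 1 - b * z ^ k) = P * (1 - b * z ^ m)"
      using \<open>s < m\<close> Suc by (simp add: P_def)
    have P2: "(\<Prod>k\<in>{s..<m}. 1 - b * z ^ k) = (1 - b * z ^ s) * P"
      using \<open>s < m\<close> Suc by (simp add: P_def prod.atLeast_Suc_lessThan)
    let ?B = "gauss_binomial z"
    have zz: "z ^ (m - s) * z ^ s = z ^ m" using \<open>s < m\<close> by (simp add: power_add[symmetric])
    have "?B (Suc m) r * (1 - b * z ^ m) = ?B (Suc m) r - b * z ^ m * ?B (Suc m) r"
      by (simp add: algebra_simps)
    \<comment> \<open>One Pascal rule is applied to the term without b and the other to the term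
      with b; then the common product P can be split off.\<close>
    also have "\<dots> = (?B m r + z ^ (m - s) * ?B m s) - b * z ^ m * (z ^ r * ?B m r + ?B m s)"
    proof -
      have "?B (Suc m) r = ?B m r + z ^ (m - s) * ?B m s" using Suc by simp
      moreover have "?B (Suc m) r = z ^ r * ?B m r + ?B m s"
        using Suc gauss_binomial_Suc[of z m s] by (simp only:)
      ultimately show ?thesis by metis
    qed
    also have "\<dots> = ?B m s * (1 - b * z ^ s) * z ^ (m - s) + ?B m r * (1 - b * z ^ (r + m))"
      unfolding zz[symmetric] power_add by (simp add: algebra_simps)
    finally have "?B (Suc m) r * (1 - b * z ^ m) * P =
      (?B m s * (1 - b * z ^ s) * z ^ (m - s) + ?B m r * (1 - b * z ^ (r + m))) * P" by simp
    moreover have "coproduct_coeff z b (Suc m) r = ?B (Suc m) r * (1 - b * z ^ m) * P"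
      by (simp only: coproduct_coeff_def P1 mult_ac)
    moreover have "coproduct_coeff z b m r = ?B m r * P"
      by (simp only: coproduct_coeff_def P_def)
    moreover have "coproduct_coeff z b m s = ?B m s * (1 - b * z ^ s) * P"
      by (simp only: coproduct_coeff_def P2 mult_ac)
    moreover have "r \<noteq> 0" "r - 1 = s" "r \<le> m" using Suc \<open>s < m\<close> by auto
    ultimately show ?thesis by (simp add: distrib_left distrib_right mult_ac)
  qed
qed

text \<open>The factor with k = n - 1 is zero, and r < n puts it into the product.\<close>

lemma coproduct_coeff_eq_0:
  assumes "r < n" "b * z ^ (n - 1) = 1"
  shows "coproduct_coeff z b n r = 0"
proof -
  have "(\<Prod>k\<in>{r..<n}. 1 - b * z ^ k) = 0"
    using assms by (intro prod_zero) (auto intro!: bexI[of _ "n - 1"])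
  then show ?thesis by (simp add: coproduct_coeff_def)
qed

section \<open>The coproduct of an iterated skew commutator\<close>

context alg
begin

lemma commutator_add:
  assumes "x \<in> carrier A" "y \<in> carrier A" "z \<in> carrier A"
  shows "x \<otimes> (y \<oplus> z) \<ominus> d \<odot> ((y \<oplus> z) \<otimes> x) = (x \<otimes> y \<ominus> d \<odot> (y \<otimes> x)) \<oplus> (x \<otimes> z \<ominus> d \<odot> (z \<otimes> x))"
  using assms by (simp only: minus_smult_eq m_closed a_closed) (simp add: r_distr l_distr smult_add_r a_ac)

lemma commutator_smult:
  assumes "x \<in> carrier A" "y \<in> carrier A"
  shows "x \<otimes> (c \<odot> y) \<ominus> d \<odot> ((c \<odot> y) \<otimes> x) = c \<odot> (x \<otimes> y \<ominus> d \<odot> (y \<otimes> x))"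
  using assms by (simp add: smult_diff_r mult_ac)

lemma commutator_finsum:
  assumes "finite I" "x \<in> carrier A" "\<And>i. i \<in> I \<Longrightarrow> e i \<in> carrier A"
  shows "x \<otimes> (\<Oplus>i\<in>I. c i \<odot> e i) \<ominus> d \<odot> ((\<Oplus>i\<in>I. c i \<odot> e i) \<otimes> x)
    = (\<Oplus>i\<in>I. c i \<odot> (x \<otimes> e i \<ominus> d \<odot> (e i \<otimes> x)))"
  using assms
proof (induction I rule: finite_induct)
  case (insert i I)
  let ?S = "\<Oplus>i\<in>I. c i \<odot> e i"
  from insert have cl: "?S \<in> carrier A" "e i \<in> carrier A" "x \<in> carrier A"
    by (auto intro!: finsum_closed)
  have IH: "x \<otimes> ?S \<ominus> d \<odot> (?S \<otimes> x) = (\<Oplus>i\<in>I. c i \<odot> (x \<otimes> e i \<ominus> d \<odot> (e i \<otimes> x)))"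
    using insert by simp
  have "(\<Oplus>i\<in>insert i I. c i \<odot> e i) = c i \<odot> e i \<oplus> ?S"
    "(\<Oplus>i\<in>insert i I. c i \<odot> (x \<otimes> e i \<ominus> d \<odot> (e i \<otimes> x)))
      = c i \<odot> (x \<otimes> e i \<ominus> d \<odot> (e i \<otimes> x)) \<oplus> (\<Oplus>i\<in>I. c i \<odot> (x \<otimes> e i \<ominus> d \<odot> (e i \<otimes> x)))"
    using insert by (simp_all add: finsum_insert Pi_iff)
  then show ?case using cl by (simp only: commutator_add commutator_smult IH smult_cl)
qed (auto simp: a_minus_def)

end

text \<open>The elements with index 1 and 2 stand for the images of the two tensor factors, so that the
  coproduct sends the generators to \<open>x\<^sub>1 + k\<^sub>1 x\<^sub>2\<close> and \<open>y\<^sub>1 + l\<^sub>1 y\<^sub>2\<close>.\<close>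

locale serre_coproduct = alg +
  fixes q a x1 y1 k1 l1 x2 y2
  assumes q: "q \<noteq> 0"
    and closed [simp, intro]: "x1 \<in> carrier A" "y1 \<in> carrier A" "k1 \<in> carrier A" "l1 \<in> carrier A"
      "x2 \<in> carrier A" "y2 \<in> carrier A"
    and commute: "x2 \<otimes> x1 = x1 \<otimes> x2" "x2 \<otimes> y1 = y1 \<otimes> x2" "x2 \<otimes> k1 = k1 \<otimes> x2" "x2 \<otimes> l1 = l1 \<otimes> x2"
      "y2 \<otimes> x1 = x1 \<otimes> y2" "y2 \<otimes> k1 = k1 \<otimes> y2"
    and k1l1: "l1 \<otimes> k1 = k1 \<otimes> l1"
    and k1x1: "k1 \<otimes> x1 = q\<^sup>2 \<odot> (x1 \<otimes> k1)" and k1y1: "k1 \<otimes> y1 = q powi a \<odot> (y1 \<otimes> k1)"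
    and l1x1: "l1 \<otimes> x1 = q powi a \<odot> (x1 \<otimes> l1)"
begin

abbreviation "Y m \<equiv> skew q a x2 y2 m"
abbreviation "Y1 m \<equiv> skew q a x1 y1 m"
abbreviation "u s r \<equiv> x1 [^] (s::nat) \<otimes> k1 [^] (r::nat) \<otimes> l1"

lemma commute_pow: "x \<in> carrier A \<Longrightarrow> y \<in> carrier A \<Longrightarrow> x \<otimes> y = c \<odot> (y \<otimes> x)
    \<Longrightarrow> x [^] (n::nat) \<otimes> y = c ^ n \<odot> (y \<otimes> x [^] n)"
proof (induction n)
  case (Suc n)
  have "x [^] n \<otimes> x \<otimes> y = c \<odot> (x [^] n \<otimes> y \<otimes> x)" using Suc.prems by (simp add: m_assoc)
  also have "\<dots> = c \<odot> ((c ^ n \<odot> (y \<otimes> x [^] n)) \<otimes> x)" using Suc by simp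
  finally show ?case using Suc.prems by (simp add: m_assoc)
qed simp

lemma commute_pow_r: "x \<in> carrier A \<Longrightarrow> y \<in> carrier A \<Longrightarrow> x \<otimes> y = c \<odot> (y \<otimes> x)
    \<Longrightarrow> x \<otimes> y [^] (n::nat) = c ^ n \<odot> (y [^] n \<otimes> x)"
proof (induction n)
  case (Suc n)
  have "x \<otimes> (y [^] n \<otimes> y) = x \<otimes> y [^] n \<otimes> y" using Suc.prems by (simp add: m_assoc)
  also have "\<dots> = c ^ n \<odot> (y [^] n \<otimes> (x \<otimes> y))" using Suc.IH[OF Suc.prems] Suc.prems(1,2) by (simp add: m_assoc)
  also have "\<dots> = c ^ Suc n \<odot> (y [^] n \<otimes> y \<otimes> x)" using Suc.prems by (simp add: m_assoc mult_ac)
  finally show ?case by simp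
qed simp

lemma x2_u: "x2 \<otimes> u s r = u s r \<otimes> x2"
proof -
  have "x2 \<otimes> x1 [^] s = x1 [^] s \<otimes> x2" "x2 \<otimes> k1 [^] r = k1 [^] r \<otimes> x2"
    using commute_pow_r[of x2 x1 1] commute_pow_r[of x2 k1 1] commute by simp_all
  then have "x2 \<otimes> u s r = x1 [^] s \<otimes> (k1 [^] r \<otimes> x2) \<otimes> l1"
    by (simp add: m_assoc[symmetric]) (simp add: m_assoc)
  also have "\<dots> = u s r \<otimes> x2" by (simp add: m_assoc commute)
  finally show ?thesis .
qed

lemma Y_x1: "Y m \<otimes> x1 = x1 \<otimes> Y m" and Y_k1: "Y m \<otimes> k1 = k1 \<otimes> Y m"
  by (simp_all add: commute commute_skew)

text \<open>Commuting x1 past the term multiplies it by a scalar, which yields the coefficient of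
  the first summand. The part k1 x2 commutes past it up to (q^2)^s, and since
  \<open>skew_exp q a (r + s)\<close> is (q^2)^s times \<open>skew_exp q a r\<close>, what is left
  over is exactly the next commutator of x2.\<close>

lemma step:
  "(x1 \<oplus> k1 \<otimes> x2) \<otimes> (u s r \<otimes> Y r) \<ominus> skew_exp q a (r + s) \<odot> ((u s r \<otimes> Y r) \<otimes> (x1 \<oplus> k1 \<otimes> x2))
    = (1 - (q powi a)\<^sup>2 * (q\<^sup>2) ^ (r + (r + s))) \<odot> (u (Suc s) r \<otimes> Y r) \<oplus> (q\<^sup>2) ^ s \<odot> (u s (Suc r) \<otimes> Y (Suc r))"
proof -
  have c [simp]: "u s r \<in> carrier A" "Y r \<in> carrier A" for s r by simp_all
  have 1: "x1 \<otimes> u s r = u (Suc s) r"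
    by (simp add: nat_pow_Suc_left m_assoc[symmetric] del: nat_pow_Suc)
  have 2: "u s r \<otimes> x1 = ((q\<^sup>2) ^ r * q powi a) \<odot> u (Suc s) r"
    using commute_pow[OF _ _ k1x1, of r] by (simp add: m_assoc l1x1) (simp add: m_assoc[symmetric] mult_ac)
  have 3: "k1 \<otimes> u s r = (q\<^sup>2) ^ s \<odot> u s (Suc r)"
  proof -
    have "k1 \<otimes> u s r = (k1 \<otimes> x1 [^] s) \<otimes> (k1 [^] r \<otimes> l1)" by (simp add: m_assoc)
    also have "\<dots> = (q\<^sup>2) ^ s \<odot> (x1 [^] s \<otimes> (k1 \<otimes> k1 [^] r) \<otimes> l1)"
      using commute_pow_r[OF _ _ k1x1, of s] by (simp add: m_assoc)
    finally show ?thesis by (simp only: nat_pow_Suc_left closed)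
  qed
  have 4: "u s r \<otimes> k1 = u s (Suc r)"
    by (simp add: m_assoc k1l1)
  have L: "(x1 \<oplus> k1 \<otimes> x2) \<otimes> (u s r \<otimes> Y r) = u (Suc s) r \<otimes> Y r \<oplus> (q\<^sup>2) ^ s \<odot> (u s (Suc r) \<otimes> (x2 \<otimes> Y r))"
  proof -
    have "(k1 \<otimes> x2) \<otimes> (u s r \<otimes> Y r) = k1 \<otimes> (x2 \<otimes> u s r) \<otimes> Y r" by (simp add: m_assoc)
    also have "\<dots> = (k1 \<otimes> u s r) \<otimes> (x2 \<otimes> Y r)" unfolding x2_u by (simp add: m_assoc)
    also have "\<dots> = (q\<^sup>2) ^ s \<odot> (u s (Suc r) \<otimes> (x2 \<otimes> Y r))" unfolding 3 by (simp del: nat_pow_Suc)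
    finally have *: "(k1 \<otimes> x2) \<otimes> (u s r \<otimes> Y r) = (q\<^sup>2) ^ s \<odot> (u s (Suc r) \<otimes> (x2 \<otimes> Y r))" .
    have "x1 \<otimes> (u s r \<otimes> Y r) = u (Suc s) r \<otimes> Y r"
      unfolding 1[symmetric] by (rule m_assoc[symmetric]) simp_all
    with * show ?thesis by (simp add: l_distr del: nat_pow_Suc)
  qed
  have R: "(u s r \<otimes> Y r) \<otimes> (x1 \<oplus> k1 \<otimes> x2)
    = ((q\<^sup>2) ^ r * q powi a) \<odot> (u (Suc s) r \<otimes> Y r) \<oplus> u s (Suc r) \<otimes> (Y r \<otimes> x2)"
  proof -
    have "(u s r \<otimes> Y r) \<otimes> (k1 \<otimes> x2) = u s r \<otimes> (Y r \<otimes> k1) \<otimes> x2" by (simp add: m_assoc)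
    also have "\<dots> = (u s r \<otimes> k1) \<otimes> (Y r \<otimes> x2)" unfolding Y_k1 by (simp add: m_assoc)
    finally have *: "(u s r \<otimes> Y r) \<otimes> (k1 \<otimes> x2) = u s (Suc r) \<otimes> (Y r \<otimes> x2)" unfolding 4 .
    have "(u s r \<otimes> Y r) \<otimes> x1 = (u s r \<otimes> x1) \<otimes> Y r" by (simp add: m_assoc Y_x1)
    also have "\<dots> = ((q\<^sup>2) ^ r * q powi a) \<odot> (u (Suc s) r \<otimes> Y r)" unfolding 2 by (simp del: nat_pow_Suc)
    finally have "(u s r \<otimes> Y r) \<otimes> x1 = ((q\<^sup>2) ^ r * q powi a) \<odot> (u (Suc s) r \<otimes> Y r)" .
    with * show ?thesis by (simp add: r_distr del: nat_pow_Suc)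
  qed
  define v w1 w2 where "v = u (Suc s) r \<otimes> Y r" and "w1 = u s (Suc r) \<otimes> (x2 \<otimes> Y r)"
    and "w2 = u s (Suc r) \<otimes> (Y r \<otimes> x2)"
  have vw: "v \<in> carrier A" "w1 \<in> carrier A" "w2 \<in> carrier A" by (simp_all add: v_def w1_def w2_def)
  have Ysuc: "u s (Suc r) \<otimes> Y (Suc r) = w1 \<oplus> (- skew_exp q a r) \<odot> w2"
    by (simp add: w1_def w2_def minus_smult_eq r_distr del: nat_pow_Suc)
  have e1: "skew_exp q a (r + s) * ((q\<^sup>2) ^ r * q powi a) = (q powi a)\<^sup>2 * (q\<^sup>2) ^ (r + (r + s))"
    by (simp add: skew_exp_eq[OF q] power2_eq_square power_add mult_ac)
  have e2: "skew_exp q a (r + s) = (q\<^sup>2) ^ s * skew_exp q a r"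
    by (simp add: skew_exp_eq[OF q] power_add mult_ac)
  have "(v \<oplus> (q\<^sup>2) ^ s \<odot> w1) \<ominus> skew_exp q a (r + s) \<odot> (((q\<^sup>2) ^ r * q powi a) \<odot> v \<oplus> w2)
    = (v \<oplus> (- ((q powi a)\<^sup>2 * (q\<^sup>2) ^ (r + (r + s)))) \<odot> v) \<oplus> ((q\<^sup>2) ^ s \<odot> w1 \<oplus> (- ((q\<^sup>2) ^ s * skew_exp q a r)) \<odot> w2)"
    using vw unfolding e1[symmetric] e2[symmetric]
    by (simp only: minus_smult_eq a_closed smult_cl) (simp add: smult_add_r a_ac)
  also have "v \<oplus> (- ((q powi a)\<^sup>2 * (q\<^sup>2) ^ (r + (r + s)))) \<odot> v = (1 - (q powi a)\<^sup>2 * (q\<^sup>2) ^ (r + (r + s))) \<odot> v"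
    using vw smult_add_l[of v 1 "- ((q powi a)\<^sup>2 * (q\<^sup>2) ^ (r + (r + s)))"] by simp
  also have "(q\<^sup>2) ^ s \<odot> w1 \<oplus> (- ((q\<^sup>2) ^ s * skew_exp q a r)) \<odot> w2
    = (q\<^sup>2) ^ s \<odot> (u s (Suc r) \<otimes> Y (Suc r))"
    unfolding Ysuc using vw by (simp add: smult_add_r)
  finally show ?thesis unfolding L R v_def w1_def w2_def .
qed

text \<open>The term \<open>Y1 m\<close> remains separate: its skew commutator with k1 x2 vanishes,
  because k1 scales \<open>Y1 m\<close> by precisely \<open>skew_exp q a m\<close>. On the other
  terms \<open>step\<close> reproduces the recursion \<open>coproduct_coeff_Suc\<close>.\<close>

lemma skew_coproduct:
  "skew q a (x1 \<oplus> k1 \<otimes> x2) (y1 \<oplus> l1 \<otimes> y2) m = Y1 m \<oplus>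
    (\<Oplus>r\<in>{..m}. coproduct_coeff (q\<^sup>2) ((q powi a)\<^sup>2) m r \<odot> (u (m - r) r \<otimes> Y r))"
proof (induction m)
  case 0
  show ?case by (simp add: coproduct_coeff_def)
next
  case (Suc m)
  let ?x = "x1 \<oplus> k1 \<otimes> x2"
  let ?c = "coproduct_coeff (q\<^sup>2) ((q powi a)\<^sup>2)"
  let ?e = "skew_exp q a m"
  let ?W = "\<Oplus>r\<in>{..m}. ?c m r \<odot> (u (m - r) r \<otimes> Y r)"
  define w where "w r = u (Suc m - r) r \<otimes> Y r" for r
  have w: "w r \<in> carrier A" for r by (simp add: w_def)
  have W: "?W \<in> carrier A" by (auto intro!: finsum_closed)
  have Y1: "?x \<otimes> Y1 m \<ominus> ?e \<odot> (Y1 m \<otimes> ?x) = Y1 (Suc m)"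
  proof -
    have x2: "x2 \<otimes> Y1 m = Y1 m \<otimes> x2" by (simp add: commute commute_skew)
    have k1: "k1 \<otimes> Y1 m = ?e \<odot> (Y1 m \<otimes> k1)"
      using mult_commute_skew[OF _ _ _ k1x1 k1y1, of q a m] by (simp add: skew_exp_eq[OF q] mult.commute)
    have "k1 \<otimes> x2 \<otimes> Y1 m = k1 \<otimes> Y1 m \<otimes> x2" by (simp add: m_assoc x2)
    also have "\<dots> = ?e \<odot> (Y1 m \<otimes> (k1 \<otimes> x2))" unfolding k1 by (simp add: m_assoc)
    finally have *: "k1 \<otimes> x2 \<otimes> Y1 m = ?e \<odot> (Y1 m \<otimes> (k1 \<otimes> x2))" .
    define p r s where "p = x1 \<otimes> Y1 m" and "r = Y1 m \<otimes> x1" and "s = Y1 m \<otimes> (k1 \<otimes> x2)"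
    have prs: "p \<in> carrier A" "r \<in> carrier A" "s \<in> carrier A" by (simp_all add: p_def r_def s_def)
    have "?x \<otimes> Y1 m = p \<oplus> ?e \<odot> s" "Y1 m \<otimes> ?x = r \<oplus> s"
      by (simp_all add: l_distr r_distr * p_def r_def s_def)
    then have "?x \<otimes> Y1 m \<ominus> ?e \<odot> (Y1 m \<otimes> ?x) = p \<oplus> (- ?e) \<odot> r \<oplus> (?e \<odot> s \<oplus> (- ?e) \<odot> s)"
      using prs by (simp only: minus_smult_eq a_closed smult_cl) (simp add: smult_add_r a_ac)
    also have "?e \<odot> s \<oplus> (- ?e) \<odot> s = \<zero>" using prs smult_add_l[of s ?e "- ?e"] by simp
    finally show ?thesis using prs by (simp add: minus_smult_eq p_def r_def)
  qed
  have "?x \<otimes> ?W \<ominus> ?e \<odot> (?W \<otimes> ?x)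
    = (\<Oplus>r\<in>{..m}. ?c m r \<odot> (?x \<otimes> (u (m - r) r \<otimes> Y r) \<ominus> ?e \<odot> ((u (m - r) r \<otimes> Y r) \<otimes> ?x)))"
    by (rule commutator_finsum) simp_all
  also have "\<dots> = (\<Oplus>r\<in>{..m}. (?c m r * (q\<^sup>2) ^ (m - r)) \<odot> w (Suc r)
      \<oplus> (?c m r * (1 - (q powi a)\<^sup>2 * (q\<^sup>2) ^ (r + m))) \<odot> w r)"
  proof (intro finsum_cong' refl)
    fix r assume "r \<in> {..m}"
    \<comment> \<open>In the m-th sum the powers s = m - r and r add up to m, so all terms meet the
      same exponent \<open>skew_exp q a m\<close>.\<close>
    then have d: "r + (m - r) = m" "Suc (m - r) = Suc m - r" "m - r = Suc m - Suc r" by auto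
    show "?c m r \<odot> (?x \<otimes> (u (m - r) r \<otimes> Y r) \<ominus> ?e \<odot> ((u (m - r) r \<otimes> Y r) \<otimes> ?x))
      = (?c m r * (q\<^sup>2) ^ (m - r)) \<odot> w (Suc r) \<oplus> (?c m r * (1 - (q powi a)\<^sup>2 * (q\<^sup>2) ^ (r + m))) \<odot> w r"
      using step[of "m - r" r, unfolded d(1)] w[of r] w[of "Suc r"]
      unfolding d(2) d(3)[symmetric] w_def by (simp add: smult_add_r a_comm del: nat_pow_Suc skew.simps)
  qed (use w in auto)
  also have "\<dots> = (\<Oplus>r\<in>{..m}. (?c m r * (q\<^sup>2) ^ (m - r)) \<odot> w (Suc r))
      \<oplus> (\<Oplus>r\<in>{..m}. (?c m r * (1 - (q powi a)\<^sup>2 * (q\<^sup>2) ^ (r + m))) \<odot> w r)"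
    using w by (intro finsum_addf) auto
  also have "\<dots> = (\<Oplus>r\<in>{..Suc m}. ((if r = 0 then 0 else ?c m (r - 1) * (q\<^sup>2) ^ (m - (r - 1)))
      + (if r \<le> m then ?c m r * (1 - (q powi a)\<^sup>2 * (q\<^sup>2) ^ (r + m)) else 0)) \<odot> w r)"
    by (rule pascal_sum[OF w])
  also have "\<dots> = (\<Oplus>r\<in>{..Suc m}. ?c (Suc m) r \<odot> w r)"
    using w coproduct_coeff_Suc[of _ m "q\<^sup>2" "(q powi a)\<^sup>2"] by (intro finsum_cong') auto
  finally have *: "?x \<otimes> ?W \<ominus> ?e \<odot> (?W \<otimes> ?x) = (\<Oplus>r\<in>{..Suc m}. ?c (Suc m) r \<odot> w r)" .
  have "skew q a ?x (y1 \<oplus> l1 \<otimes> y2) (Suc m)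
    = (?x \<otimes> Y1 m \<ominus> ?e \<odot> (Y1 m \<otimes> ?x)) \<oplus> (?x \<otimes> ?W \<ominus> ?e \<odot> (?W \<otimes> ?x))"
    using W unfolding skew.simps(2) Suc by (intro commutator_add) simp_all
  then show ?case unfolding * Y1 by (simp add: w_def)
qed

text \<open>The extreme terms contain a vanishing commutator in one tensor factor. In the mixed
  terms r < n, and n = 1 - a gives q^(2a) (q^2)^(n-1) = 1, so their coefficients vanish.\<close>

lemma serre_coproduct:
  assumes "generic_parameter q" and n: "int n = 1 - a"
    and "serre q n x1 y1 = \<zero>" "serre q n x2 y2 = \<zero>"
  shows "serre q n (x1 \<oplus> k1 \<otimes> x2) (y1 \<oplus> l1 \<otimes> y2) = \<zero>"
proof -
  let ?c = "coproduct_coeff (q\<^sup>2) ((q powi a)\<^sup>2) n"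
  have Y: "Y n = \<zero>" "Y1 n = \<zero>" using assms by (simp_all add: serre_zero_iff_skew)
  have "?c r \<odot> (u (n - r) r \<otimes> Y r) = \<zero>" if "r \<le> n" for r
  proof (cases "r = n")
    case True
    then show ?thesis by (simp add: Y del: skew.simps)
  next
    case False
    then have "r < n" using that by simp
    have "(q powi a)\<^sup>2 * (q\<^sup>2) ^ (n - 1) = (q powi a * q ^ (n - 1))\<^sup>2"
      by (simp add: power_mult_distrib power_mult[symmetric] mult.commute)
    also have "q powi a * q ^ (n - 1) = 1"
    proof -
      have "q powi a * q powi (int (n - 1)) = 1"
        using n \<open>r < n\<close> q by (simp add: power_int_add[symmetric] of_nat_diff)
      then show ?thesis by simp
    qed
    finally have "(q powi a)\<^sup>2 * (q\<^sup>2) ^ (n - 1) = 1" by simp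
    from coproduct_coeff_eq_0[OF \<open>r < n\<close> this] show ?thesis by simp
  qed
  then have "(\<Oplus>r\<in>{..n}. ?c r \<odot> (u (n - r) r \<otimes> Y r)) = (\<Oplus>r\<in>{..n}. \<zero>)"
    by (intro finsum_cong') auto
  then show ?thesis using assms(1) n Y
    by (simp add: serre_zero_iff_skew skew_coproduct del: skew.simps)
qed

end

section \<open>The one-parameter quantum group as a Hopf algebra\<close>

lemma alg_hom_finsum:
  assumes h: "h \<in> alg_hom A B" and A: "assoc_algebra A" and B: "assoc_algebra B"
    and f: "\<And>i. f i \<in> carrier A" and "finite I"
  shows "h (\<Oplus>\<^bsub>A\<^esub>i\<in>I. f i) = (\<Oplus>\<^bsub>B\<^esub>i\<in>I. h (f i))"
proof -
  interpret A: alg A by unfold_locales fact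
  interpret B: alg B by unfold_locales fact
  note hD = alg_homD[OF h] alg_hom_zero[OF h A B]
  show ?thesis using \<open>finite I\<close>
    by (induction I rule: finite_induct) (simp_all add: f hD Pi_iff A.finsum_closed)
qed

lemma alg_hom_nat_pow:
  assumes h: "h \<in> alg_hom A B" and A: "assoc_algebra A" and B: "assoc_algebra B" and x: "x \<in> carrier A"
  shows "h (x [^]\<^bsub>A\<^esub> (n::nat)) = h x [^]\<^bsub>B\<^esub> n"
proof -
  interpret A: alg A by unfold_locales fact
  interpret B: alg B by unfold_locales fact
  show ?thesis by (induction n) (simp_all add: alg_homD[OF h] x)
qed

lemma alg_hom_serre:
  assumes h: "h \<in> alg_hom A B" and A: "assoc_algebra A" and B: "assoc_algebra B"
    and xy: "x \<in> carrier A" "y \<in> carrier A"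
  shows "h (alg.serre A q n x y) = alg.serre B q n (h x) (h y)"
proof -
  interpret A: alg A by unfold_locales fact
  interpret B: alg B by unfold_locales fact
  show ?thesis unfolding A.serre_def B.serre_def using xy
    by (subst alg_hom_finsum[OF h A B]) (simp_all add: alg_homD[OF h] alg_hom_nat_pow[OF h A B])
qed

text \<open>The two embeddings into the tensor square are kept abstract, so that the same statement
  serves the E and, with the factors exchanged, the F.\<close>

lemma alg_hom_serre_coproduct:
  fixes A :: "('k::field, 'a, 'm) module_scheme" (structure)
  assumes A: "assoc_algebra A" and C: "assoc_algebra C" and h: "h1 \<in> alg_hom A C" "h2 \<in> alg_hom A C"
    and commute: "\<And>x y. x \<in> carrier A \<Longrightarrow> y \<in> carrier A \<Longrightarrow> h2 x \<otimes>\<^bsub>C\<^esub> h1 y = h1 y \<otimes>\<^bsub>C\<^esub> h2 x"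
    and q: "generic_parameter q" "int n = 1 - a"
    and closed: "x \<in> carrier A" "y \<in> carrier A" "k \<in> carrier A" "l \<in> carrier A"
    and lk: "l \<otimes> k = k \<otimes> l" and kx: "k \<otimes> x = q\<^sup>2 \<odot> (x \<otimes> k)" and ky: "k \<otimes> y = q powi a \<odot> (y \<otimes> k)"
    and lx: "l \<otimes> x = q powi a \<odot> (x \<otimes> l)" and serre: "alg.serre A q n x y = \<zero>"
  shows "alg.serre C q n (h1 x \<oplus>\<^bsub>C\<^esub> h1 k \<otimes>\<^bsub>C\<^esub> h2 x) (h1 y \<oplus>\<^bsub>C\<^esub> h1 l \<otimes>\<^bsub>C\<^esub> h2 y) = \<zero>\<^bsub>C\<^esub>"
proof -
  interpret A: alg A by unfold_locales fact
  note hD = alg_homD[OF h(1)] alg_homD(1)[OF h(2)]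
  have "h1 l \<otimes>\<^bsub>C\<^esub> h1 k = h1 k \<otimes>\<^bsub>C\<^esub> h1 l" "h1 k \<otimes>\<^bsub>C\<^esub> h1 x = q\<^sup>2 \<odot>\<^bsub>C\<^esub> (h1 x \<otimes>\<^bsub>C\<^esub> h1 k)"
    "h1 k \<otimes>\<^bsub>C\<^esub> h1 y = q powi a \<odot>\<^bsub>C\<^esub> (h1 y \<otimes>\<^bsub>C\<^esub> h1 k)" "h1 l \<otimes>\<^bsub>C\<^esub> h1 x = q powi a \<odot>\<^bsub>C\<^esub> (h1 x \<otimes>\<^bsub>C\<^esub> h1 l)"
    using arg_cong[OF lk, of h1] arg_cong[OF kx, of h1] arg_cong[OF ky, of h1] arg_cong[OF lx, of h1] closed
    by (simp_all add: hD)
  then interpret Z: serre_coproduct C q a "h1 x" "h1 y" "h1 k" "h1 l" "h2 x" "h2 y"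
    using C closed generic_parameter.q_nonzero[OF q(1)]
    by unfold_locales (simp_all add: hD commute)
  show ?thesis
    using alg_hom_serre[OF h(1) A C closed(1,2), of q n] alg_hom_serre[OF h(2) A C closed(1,2), of q n]
      alg_hom_zero[OF h(1) A C] alg_hom_zero[OF h(2) A C] serre
    by (intro Z.serre_coproduct q) simp_all
qed

text \<open>The target is arbitrary because the same equations are to be checked in the tensor
  square, in the scalars and in the opposite algebra.\<close>

definition u1_relations ::
    "('i \<Rightarrow> 'i \<Rightarrow> int) \<Rightarrow> (Qv, 'b, 'm) module_scheme \<Rightarrow> ('i gen \<Rightarrow> 'b) \<Rightarrow> bool" where
  "u1_relations d B f \<longleftrightarrow>
     (\<forall>x. f x \<in> carrier B) \<and>
     (\<forall>x y. x \<in> torus_gens \<longrightarrow> y \<in> torus_gens \<longrightarrow> f x \<otimes>\<^bsub>B\<^esub> f y = f y \<otimes>\<^bsub>B\<^esub> f x) \<and>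
     (\<forall>i. f (K i) \<otimes>\<^bsub>B\<^esub> f (Kinv i) = \<one>\<^bsub>B\<^esub>) \<and> (\<forall>i. f (K' i) \<otimes>\<^bsub>B\<^esub> f (Kinv' i) = \<one>\<^bsub>B\<^esub>) \<and>
     (\<forall>i j. f (K i) \<otimes>\<^bsub>B\<^esub> f (E j) \<otimes>\<^bsub>B\<^esub> f (Kinv i) = v1 powi d i j \<odot>\<^bsub>B\<^esub> f (E j)) \<and>
     (\<forall>i j. f (K' i) \<otimes>\<^bsub>B\<^esub> f (E j) \<otimes>\<^bsub>B\<^esub> f (Kinv' i) = v1 powi (- d i j) \<odot>\<^bsub>B\<^esub> f (E j)) \<and>
     (\<forall>i j. f (K i) \<otimes>\<^bsub>B\<^esub> f (F j) \<otimes>\<^bsub>B\<^esub> f (Kinv i) = v1 powi (- d i j) \<odot>\<^bsub>B\<^esub> f (F j)) \<and>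
     (\<forall>i j. f (K' i) \<otimes>\<^bsub>B\<^esub> f (F j) \<otimes>\<^bsub>B\<^esub> f (Kinv' i) = v1 powi d i j \<odot>\<^bsub>B\<^esub> f (F j)) \<and>
     (\<forall>i j. f (E i) \<otimes>\<^bsub>B\<^esub> f (F j) \<ominus>\<^bsub>B\<^esub> f (F j) \<otimes>\<^bsub>B\<^esub> f (E i) =
       (if i = j then (1 / (root_power d v1 i - inverse (root_power d v1 i))) \<odot>\<^bsub>B\<^esub> (f (K i) \<ominus>\<^bsub>B\<^esub> f (K' i))
        else \<zero>\<^bsub>B\<^esub>)) \<and>
     (\<forall>i j. i \<noteq> j \<longrightarrow> alg.serre B (root_power d v1 i) (nat (1 - cartan_int d i j)) (f (E i)) (f (E j)) = \<zero>\<^bsub>B\<^esub>) \<and>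
     (\<forall>i j. i \<noteq> j \<longrightarrow> alg.serre B (root_power d v1 i) (nat (1 - cartan_int d i j)) (f (F i)) (f (F j)) = \<zero>\<^bsub>B\<^esub>)"

lemma ball_Collect_pair: "(\<forall>r\<in>{h i j | i j. True}. P r) \<longleftrightarrow> (\<forall>i j. P (h i j))"
  "(\<forall>r\<in>{h' i | i. True}. P r) \<longleftrightarrow> (\<forall>i. P (h' i))"
  "(\<forall>r\<in>{h i j | i j. i \<in> S \<and> j \<in> S'}. P r) \<longleftrightarrow> (\<forall>i j. i \<in> S \<longrightarrow> j \<in> S' \<longrightarrow> P (h i j))"
  by blast+

text \<open>Lets relations be verified as equations in B, although the presentation is given by
  elements of the free algebra.\<close>

lemma u1_relations_iff:
  fixes d :: "'i \<Rightarrow> 'i \<Rightarrow> int" and f :: "'i gen \<Rightarrow> 'b" and B :: "(Qv, 'b, 'm) module_scheme"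
  assumes B: "assoc_algebra B" and f: "\<And>x. f x \<in> carrier B"
  shows "u1_relations d B f \<longleftrightarrow> (\<forall>r\<in>rels1 d. lin_ext B (word_prod B f) r = \<zero>\<^bsub>B\<^esub>)"
proof -
  interpret alg B by unfold_locales fact
  let ?L = "lin_ext B (word_prod B f)"
  have wc: "word_prod B f \<in> UNIV \<rightarrow> carrier B" using f by auto
  have Ld: "?L (r - s) = ?L r \<ominus>\<^bsub>B\<^esub> ?L s" for r s by (rule lin_ext_diff[OF _ _ wc]) auto
  have Ls: "?L (single w c) = c \<odot>\<^bsub>B\<^esub> word_prod B f w" for w c
    using f by simp
  have Lc: "?L r \<in> carrier B" for r by (rule lin_ext_closed[OF _ wc]) auto
  have serre: "?L (\<Sum>p\<le>n. single (replicate p z @ [z'] @ replicate (n - p) z)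
          ((-1) ^ p * quantum_binomial q n p)) = serre q n (f z) (f z')" for q n z z'
  proof -
    have "?L (\<Sum>p\<le>n. single (replicate p z @ [z'] @ replicate (n - p) z)
          ((-1) ^ p * quantum_binomial q n p))
      = (\<Oplus>\<^bsub>B\<^esub>p\<in>{..n}. ?L (single (replicate p z @ [z'] @ replicate (n - p) z)
          ((-1) ^ p * quantum_binomial q n p)))"
      by (rule lin_ext_sum[OF _ wc]) auto
    also have "\<dots> = serre q n (f z) (f z')"
      unfolding serre_def Ls using f
      by (intro finsum_cong') (auto simp: word_prod_append word_prod_replicate m_assoc)
    finally show ?thesis .
  qed
  have comm: "(\<forall>r\<in>commutator_rels d v1. ?L r = \<zero>\<^bsub>B\<^esub>) \<longleftrightarrow>
    (\<forall>i j. f (E i) \<otimes>\<^bsub>B\<^esub> f (F j) \<ominus>\<^bsub>B\<^esub> f (F j) \<otimes>\<^bsub>B\<^esub> f (E i) =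
       (if i = j then (1 / (root_power d v1 i - inverse (root_power d v1 i))) \<odot>\<^bsub>B\<^esub> (f (K i) \<ominus>\<^bsub>B\<^esub> f (K' i))
        else \<zero>\<^bsub>B\<^esub>))"
  proof -
    have "?L (if i = j then let c = 1 / (root_power d v1 i - inverse (root_power d v1 i))
            in single [K i] c - single [K' i] c else 0)
        = (if i = j then (1 / (root_power d v1 i - inverse (root_power d v1 i))) \<odot>\<^bsub>B\<^esub> (f (K i) \<ominus>\<^bsub>B\<^esub> f (K' i))
        else \<zero>\<^bsub>B\<^esub>)" for i j
      using f by (simp add: Let_def Ld Ls smult_diff_r)
    then have "?L (single [E i, F j] 1 - single [F j, E i] 1 -
        (if i = j then let c = 1 / (root_power d v1 i - inverse (root_power d v1 i))
            in single [K i] c - single [K' i] c else 0)) = \<zero>\<^bsub>B\<^esub> \<longleftrightarrow>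
      f (E i) \<otimes>\<^bsub>B\<^esub> f (F j) \<ominus>\<^bsub>B\<^esub> f (F j) \<otimes>\<^bsub>B\<^esub> f (E i) =
       (if i = j then (1 / (root_power d v1 i - inverse (root_power d v1 i))) \<odot>\<^bsub>B\<^esub> (f (K i) \<ominus>\<^bsub>B\<^esub> f (K' i))
        else \<zero>\<^bsub>B\<^esub>)" for i j
      using f by (simp only: Ld Ls) (subst r_right_minus_eq; simp)
    then show ?thesis unfolding commutator_rels_def ball_Collect_pair by (simp only:)
  qed
  have tor: "(\<forall>r\<in>torus_rels. ?L r = \<zero>\<^bsub>B\<^esub>) \<longleftrightarrow>
     (\<forall>x y. x \<in> torus_gens \<longrightarrow> y \<in> torus_gens \<longrightarrow> f x \<otimes>\<^bsub>B\<^esub> f y = f y \<otimes>\<^bsub>B\<^esub> f x) \<and>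
     (\<forall>i. f (K i) \<otimes>\<^bsub>B\<^esub> f (Kinv i) = \<one>\<^bsub>B\<^esub>) \<and> (\<forall>i. f (K' i) \<otimes>\<^bsub>B\<^esub> f (Kinv' i) = \<one>\<^bsub>B\<^esub>)"
    unfolding torus_rels_def ball_Un ball_Collect_pair using f by (simp add: Ld Ls)
  have conj: "(\<forall>r\<in>{single [t i, z j, t' i] 1 - single [z j] (c i j) | i j. True}. ?L r = \<zero>\<^bsub>B\<^esub>)
    \<longleftrightarrow> (\<forall>i j. f (t i) \<otimes>\<^bsub>B\<^esub> f (z j) \<otimes>\<^bsub>B\<^esub> f (t' i) = c i j \<odot>\<^bsub>B\<^esub> f (z j))" for t t' z :: "'i \<Rightarrow> 'i gen" and c
    unfolding ball_Collect_pair using f by (simp add: Ld Ls m_assoc)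
  have ser: "(\<forall>r\<in>{(\<Sum>p\<le>n. single (replicate p (Z i) @ [Z j] @ replicate (n - p) (Z i))
          ((-1) ^ p * quantum_binomial (root_power d v1 i) n p))
      | Z i j n. Z \<in> {E, F} \<and> i \<noteq> j \<and> n = nat (1 - cartan_int d i j)}. ?L r = \<zero>\<^bsub>B\<^esub>) \<longleftrightarrow>
     (\<forall>i j. i \<noteq> j \<longrightarrow> serre (root_power d v1 i) (nat (1 - cartan_int d i j)) (f (E i)) (f (E j)) = \<zero>\<^bsub>B\<^esub>) \<and>
     (\<forall>i j. i \<noteq> j \<longrightarrow> serre (root_power d v1 i) (nat (1 - cartan_int d i j)) (f (F i)) (f (F j)) = \<zero>\<^bsub>B\<^esub>)"
    (is "?l = ?r")
  proof
    assume l: ?l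
    have "serre (root_power d v1 i) (nat (1 - cartan_int d i j)) (f (Z i)) (f (Z j)) = \<zero>\<^bsub>B\<^esub>"
      if "Z \<in> {E, F}" "i \<noteq> j" for Z i j
      unfolding serre[symmetric] by (rule bspec[OF l]) (use that in blast)
    then show ?r by blast
  next
    assume r: ?r
    show ?l
    proof
      fix s assume "s \<in> {(\<Sum>p\<le>n. single (replicate p (Z i) @ [Z j] @ replicate (n - p) (Z i))
          ((-1) ^ p * quantum_binomial (root_power d v1 i) n p))
        | Z i j n. Z \<in> {E, F} \<and> i \<noteq> j \<and> n = nat (1 - cartan_int d i j)}"
      then obtain Z i j n where Z: "Z = E \<or> Z = F" "i \<noteq> j" and n: "n = nat (1 - cartan_int d i j)"
        and s: "s = (\<Sum>p\<le>n. single (replicate p (Z i) @ [Z j] @ replicate (n - p) (Z i))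
          ((-1) ^ p * quantum_binomial (root_power d v1 i) n p))" by blast
      from Z(1) show "?L s = \<zero>\<^bsub>B\<^esub>"
        unfolding s serre n using r Z(2) by (elim disjE) simp_all
    qed
  qed
  show ?thesis
    unfolding rels1_def ball_Un tor comm conj ser u1_relations_def by (simp only: f conj_assoc simp_thms)
qed

section \<open>The indeterminate v is not a root of unity\<close>

lemma to_fract_power: "to_fract (p ^ n) = to_fract p ^ n"
  by (induction n) simp_all

lemma v1_power_neq_1:
  assumes "n \<noteq> 0"
  shows "v1 ^ n \<noteq> 1"
proof
  assume "v1 ^ n = 1"
  then have "to_fract ([:0, 1:] ^ n) = to_fract (1 :: rat poly)"
    by (simp add: v1_def to_fract_power)
  then have "[:0, 1:] ^ n = (1 :: rat poly)" by (simp only: to_fract_eq_iff)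
  then have "degree ([:0, 1:] ^ n :: rat poly) = 0" by simp
  with assms show False by (simp add: degree_power_eq)
qed

lemma v1_nonzero [simp]: "v1 \<noteq> 0"
  by (simp add: v1_def)

text \<open>A zero of the numerator, or of the denominator, which is the numerator for n = 1, would
  make v a root of unity.\<close>

lemma v1_generic:
  assumes "m > 0"
  shows "generic_parameter (v1 powi m)"
proof
  fix n :: nat assume n: "n \<ge> 1"
  define w where "w = v1 ^ nat m"
  have w: "v1 powi m = w" using assms by (simp add: w_def power_int_def)
  have w0: "w \<noteq> 0" by (simp add: w_def)
  have ne: "w ^ k - inverse w ^ k \<noteq> 0" if "k \<ge> 1" for k
  proof
    assume "w ^ k - inverse w ^ k = 0"
    then have "w ^ k * w ^ k = 1" using w0 by (simp add: field_simps)
    then have "v1 ^ (nat m * k + nat m * k) = 1" by (simp add: w_def power_mult[symmetric] power_add[symmetric])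
    with v1_power_neq_1[of "nat m * k + nat m * k"] assms that show False by simp
  qed
  show "quantum_int (v1 powi m) n \<noteq> 0"
    unfolding w quantum_int_def using ne[OF n] ne[of 1] by simp
qed

text \<open>The symmetric Cartan datum by itself; \<Omega> enters only when \<open>d\<close> becomes
  \<open>dot \<Omega>\<close>. Evenness makes the exponent of \<open>root_power\<close> an exact
  half, and \<open>cartan\<close> says that v_i to the power a_ij is v to the power i.j.\<close>

locale root_datum =
  fixes d :: "'i \<Rightarrow> 'i \<Rightarrow> int"
  assumes sym: "d i j = d j i"
    and pos: "d i i > 0"
    and even: "d i i = 2 * (d i i div 2)"
    and cartan: "i \<noteq> j \<Longrightarrow> (d i i div 2) * cartan_int d i j = d i j"
    and cartan_nonpos: "i \<noteq> j \<Longrightarrow> cartan_int d i j \<le> 0"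
begin

abbreviation "q i \<equiv> root_power d v1 i"

lemma q_generic: "generic_parameter (q i)"
  unfolding root_power_def using pos[of i] even[of i] by (intro v1_generic) linarith

lemma q_square: "(q i)\<^sup>2 = v1 powi d i i"
proof -
  have "(q i)\<^sup>2 = (v1 powi (d i i div 2)) powi 2" by (simp add: root_power_def)
  also have "\<dots> = v1 powi (2 * (d i i div 2))" by (simp only: power_int_mult[symmetric] mult.commute)
  finally show ?thesis using even[of i] by simp
qed

lemma q_cartan: "i \<noteq> j \<Longrightarrow> q i powi cartan_int d i j = v1 powi d i j"
  using cartan[of i j] by (metis power_int_mult root_power_def)

lemma cartan_nat: "i \<noteq> j \<Longrightarrow> int (nat (1 - cartan_int d i j)) = 1 - cartan_int d i j"
  using cartan_nonpos[of i j] by simp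

lemma q_nonzero: "q i \<noteq> 0"
  by (simp add: root_power_def)

end

lemma (in alg) conj_imp_commute:
  assumes "k \<in> carrier A" "l \<in> carrier A" "x \<in> carrier A" "k \<otimes> l = \<one>" "l \<otimes> k = \<one>"
    and "k \<otimes> x \<otimes> l = c \<odot> x"
  shows "k \<otimes> x = c \<odot> (x \<otimes> k)" and "x \<otimes> l = c \<odot> (l \<otimes> x)"
proof -
  have "k \<otimes> x = (k \<otimes> x \<otimes> l) \<otimes> k" using assms(1-5) by (simp add: m_assoc)
  then show "k \<otimes> x = c \<odot> (x \<otimes> k)" using assms by simp
  have "x \<otimes> l = l \<otimes> (k \<otimes> x \<otimes> l)" using assms(1-5) by (simp add: m_assoc[symmetric])
  then show "x \<otimes> l = c \<odot> (l \<otimes> x)" using assms by simp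
qed

section \<open>Coproduct and counit values satisfy the defining relations\<close>

locale u1_algebra = alg B + root_datum d
  for B :: "(Qv, 'b, 'm) module_scheme" (structure) and d :: "'i \<Rightarrow> 'i \<Rightarrow> int" +
  fixes g :: "'i gen \<Rightarrow> 'b"
  assumes rels: "u1_relations d B g"
begin

abbreviation "e i \<equiv> g (E i)"
abbreviation "f i \<equiv> g (F i)"
abbreviation "k i \<equiv> g (K i)"
abbreviation "l i \<equiv> g (Kinv i)"
abbreviation "k' i \<equiv> g (K' i)"
abbreviation "l' i \<equiv> g (Kinv' i)"

lemmas rel = rels[unfolded u1_relations_def]
lemmas g_closed [simp, intro] = rel[THEN conjunct1, rule_format]
lemmas torus_commute = rel[THEN conjunct2, THEN conjunct1, rule_format]

lemma torus_gensI [simp, intro]: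
  "K i \<in> torus_gens" "Kinv i \<in> torus_gens" "K' i \<in> torus_gens" "Kinv' i \<in> torus_gens"
  by (simp_all add: torus_gens_def)

lemma torus_inverse [simp]: "k i \<otimes> l i = \<one>" "k' i \<otimes> l' i = \<one>" "l i \<otimes> k i = \<one>" "l' i \<otimes> k' i = \<one>"
proof -
  show "k i \<otimes> l i = \<one>" "k' i \<otimes> l' i = \<one>"
    by (rule rel[THEN conjunct2, THEN conjunct2, THEN conjunct1, rule_format], rule rel[THEN conjunct2, THEN conjunct2, THEN conjunct2, THEN conjunct1, rule_format])
  then show "l i \<otimes> k i = \<one>" "l' i \<otimes> k' i = \<one>"
    using torus_commute[of "Kinv i" "K i"] torus_commute[of "Kinv' i" "K' i"] by simp_all
qed

lemmas conj_rels =
  rel[THEN conjunct2, THEN conjunct2, THEN conjunct2, THEN conjunct2, THEN conjunct1, rule_format]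
  rel[THEN conjunct2, THEN conjunct2, THEN conjunct2, THEN conjunct2, THEN conjunct2, THEN conjunct1, rule_format]
  rel[THEN conjunct2, THEN conjunct2, THEN conjunct2, THEN conjunct2, THEN conjunct2, THEN conjunct2, THEN conjunct1, rule_format]
  rel[THEN conjunct2, THEN conjunct2, THEN conjunct2, THEN conjunct2, THEN conjunct2, THEN conjunct2, THEN conjunct2, THEN conjunct1, rule_format]

lemmas commute_rels =
  conj_imp_commute[OF _ _ _ _ _ conj_rels(1)] conj_imp_commute[OF _ _ _ _ _ conj_rels(2)]
  conj_imp_commute[OF _ _ _ _ _ conj_rels(3)] conj_imp_commute[OF _ _ _ _ _ conj_rels(4)]

lemmas commutator = rel[THEN conjunct2, THEN conjunct2, THEN conjunct2, THEN conjunct2, THEN conjunct2, THEN conjunct2, THEN conjunct2, THEN conjunct2, THEN conjunct1, rule_format]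
lemmas serre_e = rel[THEN conjunct2, THEN conjunct2, THEN conjunct2, THEN conjunct2, THEN conjunct2, THEN conjunct2, THEN conjunct2, THEN conjunct2, THEN conjunct2, THEN conjunct1, rule_format]
lemmas serre_f = rel[THEN conjunct2, THEN conjunct2, THEN conjunct2, THEN conjunct2, THEN conjunct2, THEN conjunct2, THEN conjunct2, THEN conjunct2, THEN conjunct2, THEN conjunct2, rule_format]

lemma conj_torus:
  assumes "x \<in> torus_gens"
  shows "k i \<otimes> g x \<otimes> l i = g x" "k' i \<otimes> g x \<otimes> l' i = g x"
  using torus_commute[of "K i" x] torus_commute[of "K' i" x] assms by (simp_all add: m_assoc)

sublocale BB: tensor_product B B by unfold_locales

lemma comult_torus: "x \<in> torus_gens \<Longrightarrow> comult_on_gen B g x = BB.pure (g x) (g x)"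
  by (auto simp: torus_gens_def)

lemma comult_on_gen_closed [simp, intro]: "comult_on_gen B g x \<in> carrier BB.T"
  by (cases x) simp_all

lemma left_alg_hom: "(\<lambda>x. BB.pure x \<one>) \<in> alg_hom B BB.T"
  by (rule alg_homI) (simp_all add: BB.pure_add_l BB.one_tensor)

lemma right_alg_hom: "(\<lambda>x. BB.pure \<one> x) \<in> alg_hom B BB.T"
  by (rule alg_homI) (simp_all add: BB.pure_add_r BB.one_tensor)

lemma comult_serre_e:
  assumes ij: "i \<noteq> j"
  shows "BB.T.serre (q i) (nat (1 - cartan_int d i j)) (comult_on_gen B g (E i)) (comult_on_gen B g (E j)) = \<zero>\<^bsub>BB.T\<^esub>"
  using alg_hom_serre_coproduct[OF assoc_algebra BB.tensor_assoc_algebra left_alg_hom right_alg_hom _ q_generic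
      cartan_nat[OF ij], of "e i" "e j" "k i" "k j"]
    torus_commute[of "K j" "K i"] sym[of i j] ij
  by (simp add: q_square q_cartan commute_rels serre_e)

text \<open>The coproduct of F has the pattern of that of E with the tensor factors exchanged and K'
  in place of K; indeed K' scales F_j by the same power of v as K scales E_j.\<close>

lemma comult_serre_f:
  assumes ij: "i \<noteq> j"
  shows "BB.T.serre (q i) (nat (1 - cartan_int d i j)) (comult_on_gen B g (F i)) (comult_on_gen B g (F j)) = \<zero>\<^bsub>BB.T\<^esub>"
  using alg_hom_serre_coproduct[OF assoc_algebra BB.tensor_assoc_algebra right_alg_hom left_alg_hom _ q_generic
      cartan_nat[OF ij], of "f i" "f j" "k' i" "k' j"]
    torus_commute[of "K' j" "K' i"] sym[of i j] ij
  by (simp add: q_square q_cartan commute_rels serre_f)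

lemma comult_commutator:
  "comult_on_gen B g (E i) \<otimes>\<^bsub>BB.T\<^esub> comult_on_gen B g (F j) \<ominus>\<^bsub>BB.T\<^esub> comult_on_gen B g (F j) \<otimes>\<^bsub>BB.T\<^esub> comult_on_gen B g (E i) =
   (if i = j then (1 / (q i - inverse (q i))) \<odot>\<^bsub>BB.T\<^esub> (comult_on_gen B g (K i) \<ominus>\<^bsub>BB.T\<^esub> comult_on_gen B g (K' i))
    else \<zero>\<^bsub>BB.T\<^esub>)"
proof -
  let ?P = BB.pure
  \<comment> \<open>The cross terms of the commutator: moving K_i past F_j and E_i past K'_j
    produces opposite powers of v, so the two orders agree and the terms cancel.\<close>
  have x: "?P (k i \<otimes> f j) (e i \<otimes> k' j) = ?P (f j \<otimes> k i) (k' j \<otimes> e i)"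
    using sym[of i j] by (simp add: commute_rels power_int_minus)
  let ?c = "e i \<otimes> f j \<ominus> f j \<otimes> e i"
  have "comult_on_gen B g (E i) \<otimes>\<^bsub>BB.T\<^esub> comult_on_gen B g (F j) \<ominus>\<^bsub>BB.T\<^esub> comult_on_gen B g (F j) \<otimes>\<^bsub>BB.T\<^esub> comult_on_gen B g (E i)
    = ?P ?c (k' j) \<oplus>\<^bsub>BB.T\<^esub> ?P (k i) ?c"
  proof -
    define p r s t u w where "p = ?P (e i) (f j)" and "r = ?P (e i \<otimes> f j) (k' j)" and "s = ?P (k i) (e i \<otimes> f j)"
      and "t = ?P (f j \<otimes> k i) (k' j \<otimes> e i)" and "u = ?P (k i) (f j \<otimes> e i)" and "w = ?P (f j \<otimes> e i) (k' j)"
    note defs = p_def r_def s_def t_def u_def w_def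
    have cl: "p \<in> carrier BB.T" "r \<in> carrier BB.T" "s \<in> carrier BB.T" "t \<in> carrier BB.T" "u \<in> carrier BB.T" "w \<in> carrier BB.T"
      by (simp_all add: defs)
    have 1: "comult_on_gen B g (E i) \<otimes>\<^bsub>BB.T\<^esub> comult_on_gen B g (F j) = (p \<oplus>\<^bsub>BB.T\<^esub> t) \<oplus>\<^bsub>BB.T\<^esub> (r \<oplus>\<^bsub>BB.T\<^esub> s)"
      using cl by (simp add: BB.T.l_distr BB.T.r_distr x p_def[symmetric] r_def[symmetric] s_def[symmetric] t_def[symmetric] BB.T.a_ac)
    have 2: "comult_on_gen B g (F j) \<otimes>\<^bsub>BB.T\<^esub> comult_on_gen B g (E i) = (p \<oplus>\<^bsub>BB.T\<^esub> t) \<oplus>\<^bsub>BB.T\<^esub> (w \<oplus>\<^bsub>BB.T\<^esub> u)"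
      using cl by (simp add: BB.T.l_distr BB.T.r_distr p_def[symmetric] u_def[symmetric] w_def[symmetric] t_def[symmetric] BB.T.a_ac)
    have 3: "?P ?c (k' j) \<oplus>\<^bsub>BB.T\<^esub> ?P (k i) ?c = (r \<ominus>\<^bsub>BB.T\<^esub> w) \<oplus>\<^bsub>BB.T\<^esub> (s \<ominus>\<^bsub>BB.T\<^esub> u)"
      by (simp add: a_minus_def minus_eq_smult BB.T.minus_eq_smult BB.pure_add_l BB.pure_add_r defs)
    have canc: "(m \<oplus>\<^bsub>BB.T\<^esub> y) \<ominus>\<^bsub>BB.T\<^esub> (m \<oplus>\<^bsub>BB.T\<^esub> z) = y \<ominus>\<^bsub>BB.T\<^esub> z"
      if "m \<in> carrier BB.T" "y \<in> carrier BB.T" "z \<in> carrier BB.T" for m y z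
    proof -
      have "(m \<oplus>\<^bsub>BB.T\<^esub> y) \<ominus>\<^bsub>BB.T\<^esub> (m \<oplus>\<^bsub>BB.T\<^esub> z) = (m \<oplus>\<^bsub>BB.T\<^esub> \<ominus>\<^bsub>BB.T\<^esub> m) \<oplus>\<^bsub>BB.T\<^esub> (y \<ominus>\<^bsub>BB.T\<^esub> z)"
        using that by (simp add: a_minus_def BB.T.minus_add BB.T.a_ac del: BB.T.r_neg)
      then show ?thesis using that by (simp add: BB.T.r_neg)
    qed
    show ?thesis unfolding 1 2 3 using cl
      by (simp only: canc BB.T.a_closed) (simp add: a_minus_def BB.T.minus_add BB.T.a_ac)
  qed
  also have "\<dots> = (if i = j then (1 / (q i - inverse (q i))) \<odot>\<^bsub>BB.T\<^esub> (comult_on_gen B g (K i) \<ominus>\<^bsub>BB.T\<^esub> comult_on_gen B g (K' i))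
    else \<zero>\<^bsub>BB.T\<^esub>)"
  proof (cases "i = j")
    case True
    define c where "c = 1 / (q i - inverse (q i))"
    have cm: "?c = c \<odot> (k i \<ominus> k' i)" unfolding commutator by (simp add: c_def True)
    \<comment> \<open>(K - K') \<otimes> K' + K \<otimes> (K - K') telescopes to K \<otimes> K - K'
      \<otimes> K'; here r is the term that drops out.\<close>
    define p r s where "p = ?P (k i) (k i)" and "r = ?P (k i) (k' i)" and "s = ?P (k' i) (k' i)"
    have cl: "p \<in> carrier BB.T" "r \<in> carrier BB.T" "s \<in> carrier BB.T" by (simp_all add: p_def r_def s_def)
    have "?P ?c (k' j) \<oplus>\<^bsub>BB.T\<^esub> ?P (k i) ?c = c \<odot>\<^bsub>BB.T\<^esub> ((r \<oplus>\<^bsub>BB.T\<^esub> (- 1) \<odot>\<^bsub>BB.T\<^esub> s) \<oplus>\<^bsub>BB.T\<^esub> (p \<oplus>\<^bsub>BB.T\<^esub> (- 1) \<odot>\<^bsub>BB.T\<^esub> r))"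
      unfolding cm using True
      by (simp add: a_minus_def minus_eq_smult BB.pure_add_l BB.pure_add_r p_def r_def s_def BB.T.smult_add_r)
    also have "(r \<oplus>\<^bsub>BB.T\<^esub> (- 1) \<odot>\<^bsub>BB.T\<^esub> s) \<oplus>\<^bsub>BB.T\<^esub> (p \<oplus>\<^bsub>BB.T\<^esub> (- 1) \<odot>\<^bsub>BB.T\<^esub> r)
      = (r \<oplus>\<^bsub>BB.T\<^esub> (- 1) \<odot>\<^bsub>BB.T\<^esub> r) \<oplus>\<^bsub>BB.T\<^esub> (p \<oplus>\<^bsub>BB.T\<^esub> (- 1) \<odot>\<^bsub>BB.T\<^esub> s)"
      using cl by (simp add: BB.T.a_ac)
    also have "\<dots> = p \<ominus>\<^bsub>BB.T\<^esub> s"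
      using cl BB.T.smult_add_l[of r 1 "- 1"] by (simp add: a_minus_def BB.T.minus_eq_smult)
    finally show ?thesis using True by (simp add: c_def p_def s_def)
  next
    case False
    have "?P \<zero> y = \<zero>\<^bsub>BB.T\<^esub>" "?P y \<zero> = \<zero>\<^bsub>BB.T\<^esub>" if "y \<in> carrier B" for y
      using that BB.pure_smult_l[of \<zero> y 0] BB.pure_smult_r[of y \<zero> 0] by simp_all
    then show ?thesis unfolding commutator using False by simp
  qed
  finally show ?thesis .
qed

lemma comult_relations: "u1_relations d BB.T (comult_on_gen B g)"
  unfolding u1_relations_def
proof (intro conjI allI impI)
  show "comult_on_gen B g x \<otimes>\<^bsub>BB.T\<^esub> comult_on_gen B g y = comult_on_gen B g y \<otimes>\<^bsub>BB.T\<^esub> comult_on_gen B g x"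
    if "x \<in> torus_gens" "y \<in> torus_gens" for x y
    using that torus_commute[of x y] by (simp add: comult_torus)
qed (simp_all add: BB.one_tensor BB.T.l_distr BB.T.r_distr BB.T.smult_add_r conj_rels conj_torus
      comult_commutator comult_serre_e comult_serre_f del: comult_on_gen.simps(1,2)
      | simp add: BB.T.l_distr BB.T.r_distr BB.T.smult_add_r conj_rels conj_torus)+

text \<open>E and F go to 0 and the torus to 1: each Serre monomial keeps a factor 0, and the
  right-hand side of (R3) becomes a multiple of 1 - 1.\<close>

lemma counit_relations: "u1_relations d (scalar_algebra id) (counit_on_gen :: 'i gen \<Rightarrow> Qv)"
proof -
  interpret S: alg "scalar_algebra (id :: Qv \<Rightarrow> Qv)" by unfold_locales (rule scalar_id_assoc_algebra)
  have "S.serre c n 0 0 = (\<Oplus>\<^bsub>scalar_algebra (id :: Qv \<Rightarrow> Qv)\<^esub>p\<in>{..n}. \<zero>\<^bsub>scalar_algebra (id :: Qv \<Rightarrow> Qv)\<^esub>)" for c n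
    unfolding S.serre_def by (intro S.finsum_cong') auto
  then have "S.serre c n 0 0 = 0" for c n
    unfolding S.finsum_zero by simp
  then show ?thesis
    by (auto simp: u1_relations_def torus_gens_def S.r_neg a_minus_def S.minus_eq_smult)
qed

section \<open>Antipode values satisfy the defining relations in the opposite algebra\<close>

lemma antipode_torus: "x \<in> torus_gens \<Longrightarrow> \<exists>y\<in>torus_gens. antipode_on_gen B g x = g y"
  by (auto simp: torus_gens_def)

lemma antipode_on_gen_closed [simp, intro]: "antipode_on_gen B g x \<in> carrier B"
  by (cases x) simp_all

text \<open>The image of E_i is -K_i^-1 E_i, so \<open>skew_antipode\<close> makes the commutator of
  the images a multiple of a torus element times the commutator that already vanishes.\<close>

lemma antipode_serre_e:
  assumes ij: "i \<noteq> j"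
  shows "serre (q i) (nat (1 - cartan_int d i j)) (antipode_on_gen B g (E i)) (antipode_on_gen B g (E j)) = \<zero>"
proof -
  let ?n = "nat (1 - cartan_int d i j)" and ?a = "cartan_int d i j"
  have "\<exists>r. skew (q i) ?a ((- 1) \<odot> (l i \<otimes> e i)) ((- 1) \<odot> (l j \<otimes> e j)) ?n
      = r \<odot> (l i [^] ?n \<otimes> l j \<otimes> skew (q i) ?a (e i) (e j) ?n)"
    using torus_commute[of "Kinv i" "Kinv j"] sym[of i j] ij
    by (intro skew_antipode) (simp_all add: q_nonzero q_square q_cartan commute_rels)
  moreover have "skew (q i) ?a (e i) (e j) ?n = \<zero>"
    using serre_e[OF ij] serre_zero_iff_skew[OF q_generic _ _ cartan_nat[OF ij]] by simp
  ultimately show ?thesis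
    using serre_zero_iff_skew[OF q_generic _ _ cartan_nat[OF ij]] by (auto simp: minus_eq_smult)
qed

lemma antipode_serre_f:
  assumes ij: "i \<noteq> j"
  shows "serre (q i) (nat (1 - cartan_int d i j)) (antipode_on_gen B g (F i)) (antipode_on_gen B g (F j)) = \<zero>"
proof -
  let ?n = "nat (1 - cartan_int d i j)" and ?a = "cartan_int d i j"
  \<comment> \<open>The image of F_i is -F_i K'_i^-1; moving the torus element to the left, as
    \<open>skew_antipode\<close> expects, costs the factor v^(i.i).\<close>
  have "\<exists>r. skew (q i) ?a ((- (v1 powi d i i)) \<odot> (l' i \<otimes> f i)) ((- (v1 powi d j j)) \<odot> (l' j \<otimes> f j)) ?n
      = r \<odot> (l' i [^] ?n \<otimes> l' j \<otimes> skew (q i) ?a (f i) (f j) ?n)"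
    using torus_commute[of "Kinv' i" "Kinv' j"] sym[of i j] ij
    by (intro skew_antipode) (simp_all add: q_nonzero q_square q_cartan commute_rels)
  moreover have "skew (q i) ?a (f i) (f j) ?n = \<zero>"
    using serre_f[OF ij] serre_zero_iff_skew[OF q_generic _ _ cartan_nat[OF ij]] by simp
  ultimately show ?thesis
    using serre_zero_iff_skew[OF q_generic _ _ cartan_nat[OF ij]]
    by (auto simp: minus_eq_smult commute_rels)
qed

end

lemma (in alg) conj_mult:
  assumes "k \<in> carrier A" "l \<in> carrier A" "x \<in> carrier A" "y \<in> carrier A" "l \<otimes> k = \<one>"
    and "k \<otimes> x \<otimes> l = a \<odot> x" "k \<otimes> y \<otimes> l = b \<odot> y"
  shows "k \<otimes> (x \<otimes> y) \<otimes> l = (a * b) \<odot> (x \<otimes> y)"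
proof -
  have "k \<otimes> (x \<otimes> y) \<otimes> l = k \<otimes> x \<otimes> (l \<otimes> k) \<otimes> y \<otimes> l"
    unfolding assms(5) using assms(1-4) by (simp add: m_assoc)
  also have "\<dots> = (k \<otimes> x \<otimes> l) \<otimes> (k \<otimes> y \<otimes> l)" using assms(1-4) by (simp add: m_assoc)
  finally show ?thesis unfolding assms(6,7) using assms(3,4) by (simp add: mult.commute)
qed

lemma minus_opposite [simp]: "x \<ominus>\<^bsub>opposite A\<^esub> y = x \<ominus>\<^bsub>A\<^esub> y"
  by (simp add: a_minus_def a_inv_def m_inv_def opposite_def)

context u1_algebra
begin

lemma conj_antipode:
  "k i \<otimes> (antipode_on_gen B g (E j) \<otimes> l i) = v1 powi d i j \<odot> antipode_on_gen B g (E j)"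
  "k' i \<otimes> (antipode_on_gen B g (E j) \<otimes> l' i) = v1 powi (- d i j) \<odot> antipode_on_gen B g (E j)"
  "k i \<otimes> (antipode_on_gen B g (F j) \<otimes> l i) = v1 powi (- d i j) \<odot> antipode_on_gen B g (F j)"
  "k' i \<otimes> (antipode_on_gen B g (F j) \<otimes> l' i) = v1 powi d i j \<odot> antipode_on_gen B g (F j)"
proof -
  have "k i \<otimes> (l j \<otimes> e j) \<otimes> l i = (1 * v1 powi d i j) \<odot> (l j \<otimes> e j)"
    "k' i \<otimes> (l j \<otimes> e j) \<otimes> l' i = (1 * v1 powi (- d i j)) \<odot> (l j \<otimes> e j)"
    "k i \<otimes> (f j \<otimes> l' j) \<otimes> l i = (v1 powi (- d i j) * 1) \<odot> (f j \<otimes> l' j)"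
    "k' i \<otimes> (f j \<otimes> l' j) \<otimes> l' i = (v1 powi d i j * 1) \<odot> (f j \<otimes> l' j)"
    by (rule conj_mult; simp add: conj_torus conj_rels)+
  then show "k i \<otimes> (antipode_on_gen B g (E j) \<otimes> l i) = v1 powi d i j \<odot> antipode_on_gen B g (E j)"
    "k' i \<otimes> (antipode_on_gen B g (E j) \<otimes> l' i) = v1 powi (- d i j) \<odot> antipode_on_gen B g (E j)"
    "k i \<otimes> (antipode_on_gen B g (F j) \<otimes> l i) = v1 powi (- d i j) \<odot> antipode_on_gen B g (F j)"
    "k' i \<otimes> (antipode_on_gen B g (F j) \<otimes> l' i) = v1 powi d i j \<odot> antipode_on_gen B g (F j)"
    by (simp_all add: minus_eq_smult m_assoc)
qed

text \<open>The order is reversed because S is an antihomomorphism. The left-hand side is -K_i^-1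
  (E_i F_j - F_j E_i) K'_j^-1, and -K^-1 (K - K') K'^-1 = K^-1 - K'^-1.\<close>

lemma antipode_commutator:
  "antipode_on_gen B g (F j) \<otimes> antipode_on_gen B g (E i) \<ominus> antipode_on_gen B g (E i) \<otimes> antipode_on_gen B g (F j)
   = (if i = j then (1 / (q i - inverse (q i))) \<odot> (l i \<ominus> l' i) else \<zero>)"
proof -
  let ?C = "e i \<otimes> f j \<ominus> f j \<otimes> e i"
  \<comment> \<open>The powers of v from moving K_i^-1 past F_j and K'_j^-1 past E_i cancel by
    symmetry of d.\<close>
  have "f j \<otimes> (l i \<otimes> l' j) \<otimes> e i = l i \<otimes> (f j \<otimes> e i) \<otimes> l' j"
  proof -
    have le: "l' j \<otimes> e i = v1 powi d j i \<odot> (e i \<otimes> l' j)"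
      by (simp add: commute_rels power_int_minus)
    have fl: "f j \<otimes> l i = v1 powi (- d i j) \<odot> (l i \<otimes> f j)"
      by (rule commute_rels(6)) simp_all
    have "f j \<otimes> (l i \<otimes> l' j) \<otimes> e i = (f j \<otimes> l i) \<otimes> (l' j \<otimes> e i)" by (simp add: m_assoc)
    also have "\<dots> = (v1 powi d j i * v1 powi (- d i j)) \<odot> ((l i \<otimes> f j) \<otimes> (e i \<otimes> l' j))"
      unfolding le fl by (simp add: mult.commute)
    also have "v1 powi d j i * v1 powi (- d i j) = 1"
      using sym[of i j] by (simp add: power_int_minus)
    finally show ?thesis by (simp add: m_assoc)
  qed
  moreover have "l' j \<otimes> l i = l i \<otimes> l' j" by (simp add: torus_commute)
  ultimately have 1: "f j \<otimes> l' j \<otimes> (l i \<otimes> e i) = l i \<otimes> (f j \<otimes> e i) \<otimes> l' j"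
    by (simp add: m_assoc[symmetric]) (simp add: m_assoc)
  have "antipode_on_gen B g (F j) \<otimes> antipode_on_gen B g (E i) \<ominus> antipode_on_gen B g (E i) \<otimes> antipode_on_gen B g (F j)
    = f j \<otimes> l' j \<otimes> (l i \<otimes> e i) \<ominus> l i \<otimes> (e i \<otimes> f j) \<otimes> l' j"
    by (simp add: l_minus r_minus m_assoc)
  also have "\<dots> = (- 1) \<odot> (l i \<otimes> ?C \<otimes> l' j)"
    unfolding 1 by (simp add: a_minus_def minus_eq_smult l_distr r_distr smult_add_r a_comm)
  also have "\<dots> = (if i = j then (1 / (q i - inverse (q i))) \<odot> (l i \<ominus> l' i) else \<zero>)"
  proof (cases "i = j")
    case True
    define c where "c = 1 / (q i - inverse (q i))"
    have cm: "?C = c \<odot> (k i \<ominus> k' i)" unfolding commutator by (simp add: c_def True)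
    have "l i \<otimes> k' i \<otimes> l' i = l i" by (simp add: m_assoc)
    then have "(- 1) \<odot> (l i \<otimes> (c \<odot> (k i \<ominus> k' i)) \<otimes> l' i) = c \<odot> (l i \<ominus> l' i)"
      by (simp add: a_minus_def minus_eq_smult l_distr r_distr smult_add_r a_comm)
    then show ?thesis unfolding cm using True by (simp add: c_def)
  next
    case False
    then show ?thesis unfolding commutator by simp
  qed
  finally show ?thesis .
qed

lemma antipode_relations: "u1_relations d (opposite B) (antipode_on_gen B g)"
proof -
  interpret O: alg "opposite B" by unfold_locales (rule opposite_assoc_algebra)
  have tor: "antipode_on_gen B g y \<otimes> antipode_on_gen B g x = antipode_on_gen B g x \<otimes> antipode_on_gen B g y"
    if xy: "x \<in> torus_gens" "y \<in> torus_gens" for x y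
  proof -
    obtain x' y' where "x' \<in> torus_gens" "antipode_on_gen B g x = g x'"
      "y' \<in> torus_gens" "antipode_on_gen B g y = g y'"
      using antipode_torus[OF xy(1)] antipode_torus[OF xy(2)] by blast
    then show ?thesis using torus_commute[of y' x'] by simp
  qed
  show ?thesis
    unfolding u1_relations_def opposite_simps minus_opposite
    \<comment> \<open>Reversal changes a Serre sum only by a sign, so its vanishing may be checked
      in B itself.\<close>
    using serre_opposite[OF antipode_on_gen_closed antipode_on_gen_closed]
    by (intro conjI allI impI antipode_on_gen_closed tor)
      (simp_all add: conj_antipode antipode_commutator antipode_serre_e antipode_serre_f
        del: antipode_on_gen.simps(1,2))
qed

end

section \<open>The Hopf structure over Q(v) and over Q(v,t)\<close>

context root_datum
begin

sublocale U: presentation "rels1 d" .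

abbreviation "gen1 \<equiv> presented_gen (rels1 d)"

lemma presented_relations: "u1_relations d U.P gen1"
  unfolding u1_relations_iff[OF U.P.assoc_algebra U.presented_gen_closed]
  by (intro ballI) (rule U.relation_holds)

sublocale U: u1_algebra U.P d gen1
  by unfold_locales (rule presented_relations)

lemma presented_hom:
  assumes B: "assoc_algebra B" and rel: "u1_relations d B f"
  obtains h where "h \<in> alg_hom U.P B" "\<And>x. h (gen1 x) = f x"
proof -
  have f: "f x \<in> carrier B" for x using rel[unfolded u1_relations_def, THEN conjunct1] by simp
  have "lin_ext B (word_prod B f) r = \<zero>\<^bsub>B\<^esub>" if "r \<in> rels1 d" for r
    using rel that unfolding u1_relations_iff[OF B f] by simp
  from U.presented_lift[OF B f this] that show thesis by blast
qed

lemma U1_hopf_generated: "hopf_generated (U1 d) gen1"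
proof -
  obtain \<Delta> where \<Delta>: "\<Delta> \<in> alg_hom U.P U.BB.T" "\<And>x. \<Delta> (gen1 x) = comult_on_gen U.P gen1 x"
    by (rule presented_hom[OF U.BB.tensor_assoc_algebra U.comult_relations]) blast
  obtain \<epsilon> where \<epsilon>: "\<epsilon> \<in> alg_hom U.P (scalar_algebra id)" "\<And>x. \<epsilon> (gen1 x) = counit_on_gen x"
    by (rule presented_hom[OF scalar_id_assoc_algebra U.counit_relations]) blast
  obtain S where S: "S \<in> alg_hom U.P (opposite U.P)" "\<And>x. S (gen1 x) = antipode_on_gen U.P gen1 x"
    by (rule presented_hom[OF U.P.opposite_assoc_algebra U.antipode_relations]) blast
  show ?thesis unfolding U1_def
    by (rule hopf_on_gens_hopf_generated[OF U.P.assoc_algebra U.presented_generates _ _ _ _ \<Delta> \<epsilon> S])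
      simp_all
qed

end

lemma field_hom_Qv_in_Qvt: "field_hom Qv_in_Qvt"
proof
  fix x y :: Qv
  have "[:x + y:] = [:x:] + [:y:]" "[:x * y:] = [:x:] * [:y:]" "[:1 :: Qv:] = 1" by simp_all
  then show "Qv_in_Qvt (x + y) = Qv_in_Qvt x + Qv_in_Qvt y"
    "Qv_in_Qvt (x * y) = Qv_in_Qvt x * Qv_in_Qvt y" "Qv_in_Qvt 1 = 1"
    by (simp_all only: Qv_in_Qvt_def to_fract_add to_fract_mult to_fract_1)
qed

lemma (in root_datum) U1_vt_hopf_generated: "hopf_generated (U1_vt d) (U1_vt_gen d)"
proof -
  have "U1_vt_gen d = (\<lambda>x. extend_elem Qv_in_Qvt (U1 d) (gen1 x))"
    by (simp add: U1_vt_gen_def fun_eq_iff)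
  then show ?thesis unfolding U1_vt_def
    using extend_hopf_generated[OF U1_hopf_generated field_hom_Qv_in_Qvt] by simp
qed

section \<open>Ideals under change of the twist\<close>

lemma word_deg_Nil [simp]: "word_deg [] = (\<lambda>_. 0, \<lambda>_. 0)"
  by (simp add: word_deg_def)

lemma word_deg_append:
  "word_deg (u @ w) = (\<lambda>j. fst (word_deg u) j + fst (word_deg w) j, \<lambda>j. snd (word_deg u) j + snd (word_deg w) j)"
  by (simp add: word_deg_def)

lemma word_deg_single [simp]: "word_deg [x] = gen_deg x"
  by (simp add: word_deg_def)

lemma bilinear_ext_zero [simp]: "bilinear_ext b (\<lambda>_. 0) \<nu> = 0" "bilinear_ext b \<mu> (\<lambda>_. 0) = 0"
  by (simp_all add: bilinear_ext_def)

lemma bilinear_ext_add: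
  "bilinear_ext b (\<lambda>j. \<mu> j + \<mu>' j) \<nu> = bilinear_ext b \<mu> \<nu> + bilinear_ext b \<mu>' \<nu>"
  "bilinear_ext b \<mu> (\<lambda>j. \<nu> j + \<nu>' j) = bilinear_ext b \<mu> \<nu> + bilinear_ext b \<mu> \<nu>'"
  by (simp_all add: bilinear_ext_def distrib_left distrib_right sum.distrib)

lemma bilinear_ext_minus [simp]:
  "bilinear_ext b (\<lambda>j. - \<mu> j) \<nu> = - bilinear_ext b \<mu> \<nu>"
  "bilinear_ext b \<mu> (\<lambda>j. - \<nu> j) = - bilinear_ext b \<mu> \<nu>"
  by (simp_all add: bilinear_ext_def sum_negf)

lemma bilinear_ext_unit_vec [simp]: "bilinear_ext b (unit_vec i) (unit_vec j) = b i j"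
proof -
  have "unit_vec i k * unit_vec j m * b k m = (if m = j then if k = i then b k m else 0 else 0)" for k m
    by (simp add: unit_vec_def)
  then show ?thesis by (simp add: bilinear_ext_def)
qed

abbreviation word_form :: "('i::finite \<Rightarrow> 'i \<Rightarrow> int) \<Rightarrow> 'i gen list \<Rightarrow> 'i gen list \<Rightarrow> int" where
  "word_form \<Omega> u w \<equiv> deg_form \<Omega> (word_deg u) (word_deg w)"

lemma word_form_append:
  "word_form \<Omega> (u @ u') w = word_form \<Omega> u w + word_form \<Omega> u' w"
  "word_form \<Omega> u (w @ w') = word_form \<Omega> u w + word_form \<Omega> u w'"
  by (simp_all add: deg_form_def word_deg_append bilinear_ext_add)

lemma word_form_Nil: "word_form \<Omega> [] w = 0" "word_form \<Omega> u [] = 0"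
  by (simp_all add: deg_form_def)

lemma word_form_Cons: "word_form \<Omega> u (x # w) = word_form \<Omega> u [x] + word_form \<Omega> u w"
  using word_form_append(2)[of \<Omega> u "[x]" w] by simp

lemma word_form_replicate:
  "word_form \<Omega> (replicate n x) w = int n * word_form \<Omega> [x] w"
  "word_form \<Omega> u (replicate n x) = int n * word_form \<Omega> u [x]"
proof -
  show "word_form \<Omega> (replicate n x) w = int n * word_form \<Omega> [x] w"
  proof (induction n)
    case (Suc n)
    then show ?case using word_form_append(1)[of \<Omega> "[x]" "replicate n x" w]
      by (simp add: algebra_simps del: word_deg_single)
  qed (simp add: word_form_Nil del: word_deg_Nil)
  show "word_form \<Omega> u (replicate n x) = int n * word_form \<Omega> u [x]"
  proof (induction n)
    case (Suc n)
    then show ?case using word_form_append(2)[of \<Omega> u "[x]" "replicate n x"]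
      by (simp add: algebra_simps del: word_deg_single)
  qed (simp add: word_form_Nil del: word_deg_Nil)
qed

lemma t2_nonzero [simp]: "t2 \<noteq> 0"
  by (simp add: t2_def)

text \<open>\<open>s = 0\<close> gives the free algebra and \<open>s = 1\<close> the product \<open>free_star\<close>.\<close>

definition twist_cocycle ::
    "('i::finite \<Rightarrow> 'i \<Rightarrow> int) \<Rightarrow> int \<Rightarrow> 'i gen list \<Rightarrow> 'i gen list \<Rightarrow> Qvt" where
  "twist_cocycle \<Omega> s u w = t2 powi (- (s * word_form \<Omega> u w))"

lemma twist_cocycle_0: "twist_cocycle \<Omega> 0 = (\<lambda>_ _. 1)"
  by (simp add: twist_cocycle_def fun_eq_iff)

lemma twist_cocycle_nonzero: "twist_cocycle \<Omega> s u w \<noteq> 0"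
  by (simp add: twist_cocycle_def)

lemma twist_cocycle_append:
  "twist_cocycle \<Omega> s (u @ u') w = twist_cocycle \<Omega> s u w * twist_cocycle \<Omega> s u' w"
  "twist_cocycle \<Omega> s u (w @ w') = twist_cocycle \<Omega> s u w * twist_cocycle \<Omega> s u w'"
  by (simp_all add: twist_cocycle_def word_form_append power_int_add[symmetric] algebra_simps)

lemma cocycle_twist_cocycle: "cocycle free_monoid (twist_cocycle \<Omega> s)"
proof -
  interpret monoid free_monoid by (rule free_monoid_monoid)
  show ?thesis
    by unfold_locales (simp_all add: twist_cocycle_append, simp_all add: twist_cocycle_def word_form_Nil del: word_deg_Nil)
qed

text \<open>For \<chi> additive under concatenation this is multiplicative for every twist. When
  \<chi> depends on the degree alone, it acts on homogeneous elements by scalars.\<close>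

definition degree_op :: "('x \<Rightarrow> int) \<Rightarrow> ('x \<Rightarrow>\<^sub>0 Qvt) \<Rightarrow> 'x \<Rightarrow>\<^sub>0 Qvt" where
  "degree_op \<chi> = Poly_Mapping.mapp (\<lambda>w c. t2 powi \<chi> w * c)"

lemma lookup_degree_op [simp]:
  "lookup (degree_op \<chi> f) w = t2 powi \<chi> w * lookup f w"
  by (simp add: degree_op_def lookup_mapp when_def in_keys_iff)

lemma degree_op_single [simp]:
  "degree_op \<chi> (single w c) = single w (t2 powi \<chi> w * c)"
  by (rule poly_mapping_eqI) (simp add: lookup_single when_def)

lemma degree_op_add: "degree_op \<chi> (f + g) = degree_op \<chi> f + degree_op \<chi> g"
  by (rule poly_mapping_eqI) (simp add: lookup_add algebra_simps)

lemma degree_op_minus: "degree_op \<chi> (- f) = - degree_op \<chi> f"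
  by (rule poly_mapping_eqI) simp

lemma degree_op_zero [simp]: "degree_op \<chi> 0 = 0"
  by (rule poly_mapping_eqI) simp

lemma degree_op_tw_mult:
  fixes f g :: "'i::finite gen list \<Rightarrow>\<^sub>0 Qvt"
  assumes \<chi>: "\<And>u w. \<chi> (u @ w) = \<chi> u + \<chi> w"
  shows "degree_op \<chi> (tw_mult free_monoid \<alpha> f g) = tw_mult free_monoid \<alpha> (degree_op \<chi> f) (degree_op \<chi> g)"
  using subset_UNIV[of "keys f"]
proof (induction f rule: poly_mapping_keys_induct)
  case (single u c)
  show ?case using subset_UNIV[of "keys g"]
    by (induction g rule: poly_mapping_keys_induct)
      (simp_all add: tw_mult_add_r degree_op_add \<chi> power_int_add mult_ac)
qed (simp_all add: tw_mult_add_l degree_op_add)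

definition homogeneous :: "('i \<Rightarrow> int) \<times> ('i \<Rightarrow> int) \<Rightarrow> ('i gen list \<Rightarrow>\<^sub>0 Qvt) \<Rightarrow> bool" where
  "homogeneous \<delta> f \<longleftrightarrow> (\<forall>w. lookup f w \<noteq> 0 \<longrightarrow> word_deg w = \<delta>)"

lemma homogeneous_single: "word_deg w = \<delta> \<Longrightarrow> homogeneous \<delta> (single w c)"
  by (simp add: homogeneous_def lookup_single when_def)

lemma homogeneous_zero: "homogeneous \<delta> 0"
  by (simp add: homogeneous_def)

lemma homogeneous_diff: "homogeneous \<delta> f \<Longrightarrow> homogeneous \<delta> g \<Longrightarrow> homogeneous \<delta> (f - g)"
  unfolding homogeneous_def lookup_minus by (metis right_minus_eq)

lemma homogeneous_add: "homogeneous \<delta> f \<Longrightarrow> homogeneous \<delta> g \<Longrightarrow> homogeneous \<delta> (f + g)"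
  unfolding homogeneous_def lookup_add by (metis add.right_neutral)

lemma homogeneous_sum: "(\<And>i. i \<in> I \<Longrightarrow> homogeneous \<delta> (f i)) \<Longrightarrow> homogeneous \<delta> (sum f I)"
  by (induction I rule: infinite_finite_induct) (simp_all add: homogeneous_zero homogeneous_add)

lemma degree_op_homogeneous:
  assumes "homogeneous \<delta> f"
  shows "degree_op (\<lambda>w. \<psi> (word_deg w)) f = scale (t2 powi \<psi> \<delta>) f"
proof (rule poly_mapping_eqI)
  fix w
  show "lookup (degree_op (\<lambda>w. \<psi> (word_deg w)) f) w = lookup (scale (t2 powi \<psi> \<delta>) f) w"
    using assms by (cases "lookup f w = 0") (simp_all add: homogeneous_def)
qed

text \<open>Passing from one twist to another multiplies \<open>u f\<close> by a power of \<open>t\<close> that depends on the degrees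
  only, that is, it replaces \<open>f\<close> by its image under a \<^const>\<open>degree_op\<close>, and these preserve an ideal
  with homogeneous generators.\<close>

lemma ideal_change_twist:
  fixes R :: "('i::finite gen list \<Rightarrow>\<^sub>0 Qvt) set" and \<Omega> :: "'i \<Rightarrow> 'i \<Rightarrow> int"
  assumes R: "\<And>r. r \<in> R \<Longrightarrow> \<exists>\<delta>. homogeneous \<delta> r"
  shows "ideal (Idl\<^bsub>tw_algebra free_monoid (twist_cocycle \<Omega> s)\<^esub> R) (tw_algebra free_monoid (twist_cocycle \<Omega> s'))"
proof -
  let ?A = "tw_algebra free_monoid (twist_cocycle \<Omega> s)"
  let ?A' = "tw_algebra free_monoid (twist_cocycle \<Omega> s')"
  interpret C: cocycle free_monoid "twist_cocycle \<Omega> s" by (rule cocycle_twist_cocycle)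
  interpret C': cocycle free_monoid "twist_cocycle \<Omega> s'" by (rule cocycle_twist_cocycle)
  interpret A: alg ?A by unfold_locales (rule C.tw_algebra_assoc_algebra)
  interpret A': alg ?A' by unfold_locales (rule C'.tw_algebra_assoc_algebra)
  define J where "J = Idl\<^bsub>?A\<^esub> R"
  have "ideal J ?A" unfolding J_def by (rule A.genideal_ideal) simp
  then interpret J: alg_ideal ?A J by (intro alg_ideal.intro A.alg_axioms)
  have RJ: "R \<subseteq> J" unfolding J_def by (rule A.genideal_self) simp
  have J0: "0 \<in> J" using J.zero_closed by simp
  have Jadd: "f + g \<in> J" if "f \<in> J" "g \<in> J" for f g using J.a_closed[OF that] by simp
  have Jscale: "scale c f \<in> J" if "f \<in> J" for c f using J.smult_ideal[OF that, of c] by simp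
  have Jneg: "- f \<in> J" if "f \<in> J" for f using Jscale[OF that, of "- 1"] by (simp add: scale_minus_one)
  have Jl: "tw_mult free_monoid (twist_cocycle \<Omega> s) g f \<in> J"
    and Jr: "tw_mult free_monoid (twist_cocycle \<Omega> s) f g \<in> J" if "f \<in> J" for f g
    using J.I_l_closed[OF that, of g] J.I_r_closed[OF that, of g] by simp_all
  have neg: "\<ominus>\<^bsub>?A\<^esub> f = - f" for f using A.minus_eq_smult[of f] by (simp add: scale_minus_one)
  have deg: "degree_op (\<lambda>w. \<psi> (word_deg w)) f \<in> J"
    if f: "f \<in> J" and \<psi>: "\<And>u w :: 'i gen list. \<psi> (word_deg (u @ w)) = \<psi> (word_deg u) + \<psi> (word_deg w)" for f \<psi>
  proof -
    let ?D = "degree_op (\<lambda>w :: 'i gen list. \<psi> (word_deg w))"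
    \<comment> \<open>The elements that D sends into J form an ideal, as D is multiplicative;
      homogeneous generators lie in it, since D multiplies them by scalars. By minimality it
      contains J.\<close>
    have "ideal {f. ?D f \<in> J} ?A"
    proof (rule idealI)
      show "subgroup {f. ?D f \<in> J} (add_monoid ?A)"
        by (rule A.add.subgroupI)
          (auto simp: a_inv_def[symmetric] neg degree_op_add degree_op_minus Jadd Jneg J0 intro: exI[of _ 0])
    qed (auto simp: A.ring_axioms degree_op_tw_mult[OF \<psi>] Jl Jr)
    moreover have "R \<subseteq> {f. ?D f \<in> J}"
    proof
      fix r assume r: "r \<in> R"
      then obtain \<delta> where "homogeneous \<delta> r" using R by blast
      then show "r \<in> {f. ?D f \<in> J}" using r RJ Jscale by (auto simp: degree_op_homogeneous)
    qed
    ultimately have "J \<subseteq> {f. ?D f \<in> J}" unfolding J_def by (rule A.genideal_minimal)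
    then show ?thesis using f by blast
  qed
  have left: "tw_mult free_monoid (twist_cocycle \<Omega> s') (single u c) f
    = tw_mult free_monoid (twist_cocycle \<Omega> s) (single u c)
        (degree_op (\<lambda>w. (s - s') * word_form \<Omega> u w) f)" for u c f
    using subset_UNIV[of "keys f"]
  proof (induction f rule: poly_mapping_keys_induct)
    case (single w a)
    have "twist_cocycle \<Omega> s' u w = twist_cocycle \<Omega> s u w * t2 powi ((s - s') * word_form \<Omega> u w)"
      by (simp add: twist_cocycle_def power_int_add[symmetric] algebra_simps)
    then show ?case by (simp add: mult_ac)
  qed (simp_all add: tw_mult_add_r degree_op_add)
  have right: "tw_mult free_monoid (twist_cocycle \<Omega> s') f (single u c)
    = tw_mult free_monoid (twist_cocycle \<Omega> s)
        (degree_op (\<lambda>w. (s - s') * word_form \<Omega> w u) f) (single u c)" for u c f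
    using subset_UNIV[of "keys f"]
  proof (induction f rule: poly_mapping_keys_induct)
    case (single w a)
    have "twist_cocycle \<Omega> s' w u = twist_cocycle \<Omega> s w u * t2 powi ((s - s') * word_form \<Omega> w u)"
      by (simp add: twist_cocycle_def power_int_add[symmetric] algebra_simps)
    then show ?case by (simp add: mult_ac)
  qed (simp_all add: tw_mult_add_l degree_op_add)
  have l: "tw_mult free_monoid (twist_cocycle \<Omega> s') g f \<in> J" if f: "f \<in> J" for f g
    using subset_UNIV[of "keys g"]
  proof (induction g rule: poly_mapping_keys_induct)
    case (single u c)
    show ?case unfolding left
      by (intro Jl deg[OF f]) (simp add: word_form_append algebra_simps)
  qed (simp_all add: tw_mult_add_l J0 Jadd)
  have r: "tw_mult free_monoid (twist_cocycle \<Omega> s') f g \<in> J" if f: "f \<in> J" for f g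
    using subset_UNIV[of "keys g"]
  proof (induction g rule: poly_mapping_keys_induct)
    case (single u c)
    show ?case unfolding right
      by (intro Jr deg[OF f]) (simp add: word_form_append algebra_simps)
  qed (simp_all add: tw_mult_add_r J0 Jadd)
  have "ideal J ?A'"
  proof (rule idealI)
    show "subgroup J (add_monoid ?A')" using J.a_subgroup by simp
  qed (auto simp: A'.ring_axioms l r)
  then show ?thesis by (simp add: J_def)
qed

section \<open>Comparison of the defining relations\<close>

text \<open>The exponent \<sigma>: minus the sum of the forms over all pairs of letters in their
  order of occurrence. The star product of the letters of w is t to this power times w.\<close>

fun twist_exp :: "('i::finite \<Rightarrow> 'i \<Rightarrow> int) \<Rightarrow> 'i gen list \<Rightarrow> int" where
  "twist_exp \<Omega> [] = 0"
| "twist_exp \<Omega> (x # w) = twist_exp \<Omega> w - word_form \<Omega> [x] w"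

lemma twist_twist_cocycle: "twist (twist_cocycle \<Omega> 1) w = t2 powi twist_exp \<Omega> w"
  by (induction w) (simp_all add: twist_cocycle_def power_int_add[symmetric])

text \<open>The coboundary property: the form of u and w measures the failure of
  \<open>twist_exp\<close> to be additive.\<close>

lemma twist_exp_append: "twist_exp \<Omega> (u @ w) = twist_exp \<Omega> u + twist_exp \<Omega> w - word_form \<Omega> u w"
proof (induction u)
  case (Cons x u)
  then show ?case
    using word_form_append(1)[of \<Omega> "[x]" u w] word_form_append(2)[of \<Omega> "[x]" u w]
    by (simp del: word_deg_single)
qed (simp add: word_form_Nil del: word_deg_Nil)

text \<open>This is n (n - 1) / 2, which occurs both as the number of pairs among n equal letters
  and as the exponent of t in the two-parameter factorial; the recursion avoids a division.\<close>

fun triangle :: "nat \<Rightarrow> int" where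
  "triangle 0 = 0"
| "triangle (Suc n) = triangle n + int n"

lemma triangle_add: "triangle (m + n) = triangle m + triangle n + int m * int n"
  by (induction m) (simp_all add: algebra_simps)

lemma twist_exp_replicate: "twist_exp \<Omega> (replicate n x) = - word_form \<Omega> [x] [x] * triangle n"
  by (induction n) (simp_all add: word_form_replicate algebra_simps del: word_deg_single)

lemma twist_exp_serre:
  "twist_exp \<Omega> (replicate m x @ [y] @ replicate n x) =
    - word_form \<Omega> [x] [x] * triangle (m + n) - int m * word_form \<Omega> [x] [y] - int n * word_form \<Omega> [y] [x]"
  unfolding twist_exp_append word_form_append word_form_replicate twist_exp_replicate triangle_add
  by (simp add: word_form_Nil algebra_simps del: word_deg_single word_deg_Nil)

lemma word_form_letters:
  "word_form \<Omega> [E i] [E j] = - sq_form \<Omega> i j" "word_form \<Omega> [F i] [F j] = sq_form \<Omega> i j"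
  "word_form \<Omega> [E i] [F j] = 0" "word_form \<Omega> [F i] [E j] = 0"
  "word_form \<Omega> [K i] [E j] = - sq_form \<Omega> i j" "word_form \<Omega> [K' i] [E j] = - sq_form \<Omega> i j"
  "word_form \<Omega> [K i] [F j] = sq_form \<Omega> i j" "word_form \<Omega> [K' i] [F j] = sq_form \<Omega> i j"
  "word_form \<Omega> [E i] [Kinv j] = sq_form \<Omega> i j" "word_form \<Omega> [E i] [Kinv' j] = sq_form \<Omega> i j"
  "word_form \<Omega> [F i] [Kinv j] = - sq_form \<Omega> i j" "word_form \<Omega> [F i] [Kinv' j] = - sq_form \<Omega> i j"
  by (simp_all add: deg_form_def)

text \<open>Both components of the degree of a torus generator are equal, so the two terms of the
  form cancel.\<close>

lemma word_form_torus: "x \<in> torus_gens \<Longrightarrow> y \<in> torus_gens \<Longrightarrow> word_form \<Omega> [x] [y] = 0"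
  by (auto simp: torus_gens_def deg_form_def)

interpretation Qv: field_hom Qv_in_Qvt by (rule field_hom_Qv_in_Qvt)

text \<open>Semilinear along \<open>Qv_in_Qvt\<close>: the twist and the extension of scalars are
  performed in one map on the free algebras.\<close>

definition twist_map ::
    "('i::finite \<Rightarrow> 'i \<Rightarrow> int) \<Rightarrow> ('i gen list \<Rightarrow>\<^sub>0 Qv) \<Rightarrow> 'i gen list \<Rightarrow>\<^sub>0 Qvt" where
  "twist_map \<Omega> = Poly_Mapping.mapp (\<lambda>w c. t2 powi twist_exp \<Omega> w * Qv_in_Qvt c)"

lemma lookup_twist_map [simp]:
  "lookup (twist_map \<Omega> f) w = t2 powi twist_exp \<Omega> w * Qv_in_Qvt (lookup f w)"
  by (simp add: twist_map_def lookup_mapp when_def in_keys_iff)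

lemma twist_map_single [simp]:
  "twist_map \<Omega> (single w c) = single w (t2 powi twist_exp \<Omega> w * Qv_in_Qvt c)"
  by (rule poly_mapping_eqI) (simp add: lookup_single when_def)

lemma twist_map_zero [simp]: "twist_map \<Omega> 0 = 0"
  by (rule poly_mapping_eqI) simp

lemma twist_map_add: "twist_map \<Omega> (f + g) = twist_map \<Omega> f + twist_map \<Omega> g"
  by (rule poly_mapping_eqI) (simp add: lookup_add Qv.hom_add algebra_simps)

lemma twist_map_diff: "twist_map \<Omega> (f - g) = twist_map \<Omega> f - twist_map \<Omega> g"
  by (rule poly_mapping_eqI) (simp add: lookup_minus Qv.hom_diff algebra_simps)

lemma twist_map_sum: "twist_map \<Omega> (sum f I) = (\<Sum>i\<in>I. twist_map \<Omega> (f i))"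
  by (induction I rule: infinite_finite_induct) (simp_all add: twist_map_add)

text \<open>A scalar is allowed since the Serre sums differ by a factorial and a power of t. It must
  be nonzero so that either relation can be recovered from the other.\<close>

definition matches ::
    "('i::finite \<Rightarrow> 'i \<Rightarrow> int) \<Rightarrow> ('i gen list \<Rightarrow>\<^sub>0 Qv) \<Rightarrow> ('i gen list \<Rightarrow>\<^sub>0 Qvt) \<Rightarrow> bool" where
  "matches \<Omega> r r' \<longleftrightarrow> (\<exists>c. c \<noteq> 0 \<and> twist_map \<Omega> r = scale c r')"

lemma rel_set_Un: "rel_set P A B \<Longrightarrow> rel_set P A' B' \<Longrightarrow> rel_set P (A \<union> A') (B \<union> B')"
  unfolding rel_set_def by blast

lemma rel_set_family:
  "(\<And>i j. P (h i j) (h' i j)) \<Longrightarrow> rel_set P {h i j | i j. True} {h' i j | i j. True}"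
  "(\<And>i. P (k i) (k' i)) \<Longrightarrow> rel_set P {k i | i. True} {k' i | i. True}"
  "(\<And>x y. x \<in> S \<Longrightarrow> y \<in> S \<Longrightarrow> P (f x y) (f' x y)) \<Longrightarrow>
    rel_set P {f x y | x y. x \<in> S \<and> y \<in> S} {f' x y | x y. x \<in> S \<and> y \<in> S}"
  "(\<And>i j. i \<noteq> j \<Longrightarrow> P (m i j (n i j)) (m' i j (n i j))) \<Longrightarrow>
    rel_set P {m i j l | i j l. i \<noteq> j \<and> l = n i j} {m' i j l | i j l. i \<noteq> j \<and> l = n i j}"
  unfolding rel_set_def by blast+

section \<open>Quantum integers and factorials over Q(v,t)\<close>

lemma hom_quantum_int: "Qv_in_Qvt (quantum_int v n) = quantum_int (Qv_in_Qvt v) n"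
  by (simp add: quantum_int_def Qv.hom_divide Qv.hom_diff Qv.hom_power Qv.hom_inverse)

lemma hom_quantum_fact: "Qv_in_Qvt (quantum_fact v n) = quantum_fact (Qv_in_Qvt v) n"
  by (simp add: quantum_fact_def Qv.hom_prod hom_quantum_int)

lemma hom_quantum_binomial: "Qv_in_Qvt (quantum_binomial v n m) = quantum_binomial (Qv_in_Qvt v) n m"
  by (simp add: quantum_binomial_def Qv.hom_divide Qv.hom_mult hom_quantum_fact)

lemma hom_root_power: "Qv_in_Qvt (root_power d v1 i) = root_power d v2 i"
  by (simp add: root_power_def Qv.hom_power_int v2_def)

lemma hom_nonzero: "x \<noteq> 0 \<Longrightarrow> Qv_in_Qvt x \<noteq> 0"
  using Qv.hom_mult[of x "inverse x"] by auto

lemma quantum_int2_eq: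
  fixes t :: "'k::field"
  assumes "t \<noteq> 0"
  shows "quantum_int2 v t (Suc n) = t ^ n * quantum_int v (Suc n)"
proof -
  have "quantum_int2 v t (Suc n) = (t * (t ^ n * (v ^ Suc n - inverse v ^ Suc n))) / (t * (v - inverse v))"
    by (simp add: quantum_int2_def power_mult_distrib algebra_simps)
  then show ?thesis using assms by (simp add: quantum_int_def)
qed

lemma quantum_fact2_eq:
  assumes "t \<noteq> 0"
  shows "quantum_fact2 v t n = t powi triangle n * quantum_fact v n"
proof (induction n)
  case (Suc n)
  have "quantum_fact2 v t (Suc n) = quantum_int2 v t (Suc n) * quantum_fact2 v t n"
    "quantum_fact v (Suc n) = quantum_int v (Suc n) * quantum_fact v n"
    by (simp_all add: quantum_fact2_def quantum_fact_def prod.nat_ivl_Suc')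
  then show ?case using assms Suc by (simp add: quantum_int2_eq power_int_add mult_ac)
qed (simp add: quantum_fact2_def quantum_fact_def)

section \<open>The relations matched one family at a time\<close>

locale two_parameter =
  fixes \<Omega> :: "'i::finite \<Rightarrow> 'i \<Rightarrow> int"
  assumes datum: "cartan_matrix_datum \<Omega>"
begin

lemma dot_diag [simp]: "dot \<Omega> i i div 2 = \<Omega> i i"
  by (simp add: dot_def)

lemma root_datum_dot: "root_datum (dot \<Omega>)"
proof (rule root_datum.intro)
  fix i j :: 'i
  show "dot \<Omega> i j = dot \<Omega> j i" by (simp add: dot_def)
  have pos: "\<Omega> i i > 0" using datum by (simp add: cartan_matrix_datum_def)
  then show "dot \<Omega> i i > 0" by (simp add: dot_def)
  show "dot \<Omega> i i = 2 * (dot \<Omega> i i div 2)" by (simp add: dot_def)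
  assume ij: "i \<noteq> j"
  have dvd: "\<Omega> i i dvd \<Omega> i j + \<Omega> j i" and le: "(\<Omega> i j + \<Omega> j i) div \<Omega> i i \<le> 0"
    using datum ij by (simp_all add: cartan_matrix_datum_def)
  \<comment> \<open>As i.i = 2 \<Omega>_ii, the factor 2 cancels and a_ij becomes the quotient in
    condition (b) of the datum.\<close>
  have c: "cartan_int (dot \<Omega>) i j = (\<Omega> i j + \<Omega> j i) div \<Omega> i i"
  proof -
    have "cartan_int (dot \<Omega>) i j = (2 * (\<Omega> i j + \<Omega> j i)) div (2 * \<Omega> i i)"
      by (simp add: cartan_int_def dot_def)
    also have "\<dots> = (\<Omega> i j + \<Omega> j i) div \<Omega> i i" by (rule div_mult_mult1) simp
    finally show ?thesis .
  qed
  show "(dot \<Omega> i i div 2) * cartan_int (dot \<Omega>) i j = dot \<Omega> i j"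
    unfolding c dot_diag using dvd by (simp add: dot_def)
  show "cartan_int (dot \<Omega>) i j \<le> 0" unfolding c by (rule le)
qed

text \<open>Single letters are not twisted, while the conjugating word acquires t^(-e). Dividing by
  this power moves t^e to the coefficient of the single letter, which is how the powers of t in (R2)
  arise.\<close>

lemma matches_conj:
  assumes "c' = t2 powi e * Qv_in_Qvt c" "twist_exp \<Omega> w = - e"
  shows "matches \<Omega> (single w 1 - single [x] c)
    (single w 1 - single [x] c')"
  unfolding matches_def
proof (intro exI conjI)
  show "t2 powi (- e) \<noteq> 0" by simp
  have inv: "inverse (t2 powi e) * (t2 powi e * a) = a" for a by (simp flip: mult.assoc)
  show "twist_map \<Omega> (single w 1 - single [x] c) =
    scale (t2 powi (- e)) (single w 1 - single [x] c')"
    using assms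
    by (simp add: inv twist_map_diff scale_diff power_int_minus word_form_Nil del: word_deg_single word_deg_Nil)
qed

lemma v2_power: "Qv_in_Qvt (v1 powi n) = v2 powi n"
  by (simp add: Qv.hom_power_int v2_def)

lemma twist_exp_triple:
  "twist_exp \<Omega> [x, y, z] = - word_form \<Omega> [x] [y] - word_form \<Omega> [x] [z] - word_form \<Omega> [y] [z]"
  using word_form_Cons[of \<Omega> "[x]" y "[z]"] by (simp add: word_form_Nil del: word_deg_single word_deg_Nil)

lemma sq_form_diff: "sq_form \<Omega> i j - sq_form \<Omega> j i = \<Omega> j i - \<Omega> i j"
  by (simp add: sq_form_def)

lemma matches_torus:
  "rel_set (matches \<Omega>) (torus_rels :: ('i gen list \<Rightarrow>\<^sub>0 Qv) set) (torus_rels :: ('i gen list \<Rightarrow>\<^sub>0 Qvt) set)"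
  unfolding torus_rels_def
proof (intro rel_set_Un rel_set_family)
  have two: "twist_exp \<Omega> [x, y] = 0" if "x \<in> torus_gens" "y \<in> torus_gens" for x y
    using word_form_torus[OF that] by (simp add: word_form_Nil del: word_deg_single word_deg_Nil)
  show "matches \<Omega> (single [x, y] 1 - single [y, x] 1)
      (single [x, y] 1 - single [y, x] 1)"
    if "x \<in> torus_gens" "y \<in> torus_gens" for x y
    unfolding matches_def
    by (intro exI[of _ 1]) (use that in \<open>simp add: twist_map_diff two del: twist_exp.simps\<close>)
  show "matches \<Omega> (single [K i, Kinv i] 1 - single [] 1)
      (single [K i, Kinv i] 1 - single [] 1)" for i
    unfolding matches_def
    by (intro exI[of _ 1]) (use two[of "K i" "Kinv i"] in \<open>simp add: twist_map_diff torus_gens_def\<close>)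
  show "matches \<Omega> (single [K' i, Kinv' i] 1 - single [] 1)
      (single [K' i, Kinv' i] 1 - single [] 1)" for i
    unfolding matches_def
    by (intro exI[of _ 1]) (use two[of "K' i" "Kinv' i"] in \<open>simp add: twist_map_diff torus_gens_def\<close>)
qed

lemma matches_commutator:
  "rel_set (matches \<Omega>) (commutator_rels (dot \<Omega>) v1) (commutator_rels (dot \<Omega>) v2)"
  unfolding commutator_rels_def
proof (intro rel_set_family)
  fix i j :: 'i
  have "twist_exp \<Omega> [E i, F j] = 0" "twist_exp \<Omega> [F j, E i] = 0"
    "\<And>m. twist_exp \<Omega> [K m] = 0" "\<And>m. twist_exp \<Omega> [K' m] = 0"
    using word_form_letters[of \<Omega>] by (simp_all add: word_form_Nil del: word_deg_single word_deg_Nil)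
  then show "matches \<Omega>
     (single [E i, F j] 1 - single [F j, E i] 1 -
        (if i = j then (let c = 1 / (root_power (dot \<Omega>) v1 i - inverse (root_power (dot \<Omega>) v1 i)) in
            single [K i] c - single [K' i] c) else 0))
     (single [E i, F j] 1 - single [F j, E i] 1 -
        (if i = j then (let c = 1 / (root_power (dot \<Omega>) v2 i - inverse (root_power (dot \<Omega>) v2 i)) in
            single [K i] c - single [K' i] c) else 0))"
    unfolding matches_def
    by (intro exI[of _ 1])
      (simp add: twist_map_diff Let_def Qv.hom_divide Qv.hom_diff Qv.hom_inverse hom_root_power del: twist_exp.simps)
qed

lemma quantum_fact_nonzero2: "quantum_fact (root_power (dot \<Omega>) v2 i) n \<noteq> 0"
  using hom_nonzero[OF generic_parameter.quantum_fact_nonzero[OF root_datum.q_generic[OF root_datum_dot, of i], of n]]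
  by (simp add: hom_quantum_fact hom_root_power)

text \<open>The factorials contribute the triangular exponents; with all powers of t collected in
  one place the coefficient can be compared with \<open>twist_exp_serre\<close>.\<close>

lemma serre2_coeff_eq:
  "serre2_coeff \<Omega> i j p r = (-1) ^ p / (quantum_fact (root_power (dot \<Omega>) v2 i) p * quantum_fact (root_power (dot \<Omega>) v2 i) r)
    * t2 powi (- (int p * (int r * \<Omega> i i - \<Omega> i j + \<Omega> j i)) - \<Omega> i i * triangle p - \<Omega> i i * triangle r)"
proof -
  have "root_power (dot \<Omega>) t2 i powi triangle n = t2 powi (\<Omega> i i * triangle n)" for n
    by (simp add: root_power_def power_int_mult)
  moreover have "root_power (dot \<Omega>) t2 i \<noteq> 0" by (simp add: root_power_def)
  ultimately show ?thesis
    by (simp add: serre2_coeff_def Let_def quantum_fact2_eq power_int_diff)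
qed

lemma matches_serre_E:
  assumes ij: "i \<noteq> j"
  shows "matches \<Omega>
     (\<Sum>p\<le>n. single (replicate p (E i) @ [E j] @ replicate (n - p) (E i))
          ((-1) ^ p * quantum_binomial (root_power (dot \<Omega>) v1 i) n p))
     (\<Sum>p\<le>n. single (replicate (n - p) (E i) @ [E j] @ replicate p (E i))
          (serre2_coeff \<Omega> i j p (n - p)))"
proof -
  let ?v = "root_power (dot \<Omega>) v2 i"
  \<comment> \<open>[n]! clears the divided powers and (-1)^n comes from reversing the sum. The form
    of E_i with itself is -\<Omega>_ii, so twisting contributes +\<Omega>_ii n(n-1)/2 where the
    two-parameter coefficients contribute the negative of it; hence the doubled triangular
    term.\<close>
  let ?c = "(- 1) ^ n * quantum_fact ?v n * t2 powi (2 * \<Omega> i i * triangle n - int n * \<Omega> i j)"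
  have "twist_map \<Omega> (\<Sum>p\<le>n. single (replicate p (E i) @ [E j] @ replicate (n - p) (E i))
          ((-1) ^ p * quantum_binomial (root_power (dot \<Omega>) v1 i) n p))
    = (\<Sum>p\<le>n. twist_map \<Omega> (single (replicate p (E i) @ [E j] @ replicate (n - p) (E i))
          ((-1) ^ p * quantum_binomial (root_power (dot \<Omega>) v1 i) n p)))"
    by (rule twist_map_sum)
  also have "\<dots> = (\<Sum>p\<le>n. scale ?c (single (replicate (n - p) (E i) @ [E j] @ replicate p (E i))
          (serre2_coeff \<Omega> i j p (n - p))))"
  \<comment> \<open>The index p counts the E_i on the left in one algebra and on the right in the
    other.\<close>
  proof (rule sum.reindex_bij_witness[of _ "\<lambda>p. n - p" "\<lambda>p. n - p"])
    fix p assume "p \<in> {..n}"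
    then have "p \<le> n" by simp
    then obtain r where n: "n = p + r" using le_Suc_ex by blast
    let ?e = "twist_exp \<Omega> (replicate p (E i) @ [E j] @ replicate r (E i))"
    have "?e = \<Omega> i i * triangle (p + r) - int p * \<Omega> i j - int r * \<Omega> j i"
      unfolding twist_exp_serre word_form_letters using ij by (simp add: sq_form_def)
    then have e: "?e = (2 * \<Omega> i i * triangle n - int n * \<Omega> i j)
      + (- (int r * (int p * \<Omega> i i - \<Omega> i j + \<Omega> j i)) - \<Omega> i i * triangle r - \<Omega> i i * triangle p)"
      unfolding n triangle_add by (simp add: algebra_simps)
    have s: "(- 1) ^ n * (- 1) ^ r = ((- 1) ^ p :: Qvt)" by (simp add: n power_add mult.assoc uminus_power_if)
    have "t2 powi ?e * Qv_in_Qvt ((-1) ^ p * quantum_binomial (root_power (dot \<Omega>) v1 i) n p)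
      = t2 powi ?e * ((- 1) ^ p * (quantum_fact ?v n / (quantum_fact ?v p * quantum_fact ?v r)))"
      by (simp add: Qv.hom_mult Qv.hom_power Qv.hom_minus hom_quantum_binomial hom_root_power)
        (simp add: quantum_binomial_def n)
    also have "\<dots> = ?c * serre2_coeff \<Omega> i j r p"
      unfolding serre2_coeff_eq s[symmetric] e by (simp add: power_int_add mult_ac)
    finally show "scale ?c (single (replicate (n - (n - p)) (E i) @ [E j] @ replicate (n - p) (E i))
          (serre2_coeff \<Omega> i j (n - p) (n - (n - p))))
      = twist_map \<Omega> (single (replicate p (E i) @ [E j] @ replicate (n - p) (E i))
          ((-1) ^ p * quantum_binomial (root_power (dot \<Omega>) v1 i) n p))"
      unfolding n by simp
  qed auto
  also have "\<dots> = scale ?c (\<Sum>p\<le>n. single (replicate (n - p) (E i) @ [E j] @ replicate p (E i))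
          (serre2_coeff \<Omega> i j p (n - p)))"
    by (rule scale_sum[symmetric])
  finally show ?thesis unfolding matches_def
    using quantum_fact_nonzero2 by (intro exI[of _ ?c]) simp
qed

lemma matches_serre_F:
  assumes ij: "i \<noteq> j"
  shows "matches \<Omega>
     (\<Sum>p\<le>n. single (replicate p (F i) @ [F j] @ replicate (n - p) (F i))
          ((-1) ^ p * quantum_binomial (root_power (dot \<Omega>) v1 i) n p))
     (\<Sum>p\<le>n. single (replicate p (F i) @ [F j] @ replicate (n - p) (F i))
          (serre2_coeff \<Omega> i j p (n - p)))"
proof -
  let ?v = "root_power (dot \<Omega>) v2 i"
  \<comment> \<open>For F the form has the opposite sign, so the triangular exponents of the two
    sides agree, and both sums run in the same order; no sign and no triangular term remain.\<close>
  let ?c = "quantum_fact ?v n * t2 powi (int n * \<Omega> j i)"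
  have "twist_map \<Omega> (single (replicate p (F i) @ [F j] @ replicate (n - p) (F i))
          ((-1) ^ p * quantum_binomial (root_power (dot \<Omega>) v1 i) n p))
    = scale ?c (single (replicate p (F i) @ [F j] @ replicate (n - p) (F i))
          (serre2_coeff \<Omega> i j p (n - p)))" if le: "p \<le> n" for p
  proof -
    obtain r where n: "n = p + r" using le_Suc_ex[OF le] by blast
    let ?e = "twist_exp \<Omega> (replicate p (F i) @ [F j] @ replicate r (F i))"
    have "?e = - \<Omega> i i * triangle (p + r) + int p * \<Omega> i j + int r * \<Omega> j i"
      unfolding twist_exp_serre word_form_letters using ij by (simp add: sq_form_def)
    then have e: "?e = int n * \<Omega> j i
      + (- (int p * (int r * \<Omega> i i - \<Omega> i j + \<Omega> j i)) - \<Omega> i i * triangle p - \<Omega> i i * triangle r)"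
      unfolding n triangle_add by (simp add: algebra_simps)
    have "t2 powi ?e * Qv_in_Qvt ((-1) ^ p * quantum_binomial (root_power (dot \<Omega>) v1 i) n p)
      = t2 powi ?e * ((- 1) ^ p * (quantum_fact ?v n / (quantum_fact ?v p * quantum_fact ?v r)))"
      by (simp add: Qv.hom_mult Qv.hom_power Qv.hom_minus hom_quantum_binomial hom_root_power)
        (simp add: quantum_binomial_def n)
    also have "\<dots> = ?c * serre2_coeff \<Omega> i j p r"
      unfolding serre2_coeff_eq e by (simp add: power_int_add mult_ac)
    finally show ?thesis unfolding n by simp
  qed
  then have "twist_map \<Omega> (\<Sum>p\<le>n. single (replicate p (F i) @ [F j] @ replicate (n - p) (F i))
          ((-1) ^ p * quantum_binomial (root_power (dot \<Omega>) v1 i) n p))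
    = scale ?c (\<Sum>p\<le>n. single (replicate p (F i) @ [F j] @ replicate (n - p) (F i))
          (serre2_coeff \<Omega> i j p (n - p)))"
    unfolding twist_map_sum scale_sum by (intro sum.cong) auto
  then show ?thesis unfolding matches_def
    using quantum_fact_nonzero2 by (intro exI[of _ ?c]) simp
qed

theorem matches_rels: "rel_set (matches \<Omega>) (rels1 (dot \<Omega>)) (rels2 \<Omega>)"
proof -
  let ?n = "\<lambda>i j. nat (1 - cartan_int (dot \<Omega>) i j)"
  have serre: "{(\<Sum>p\<le>n. single (replicate p (Z i) @ [Z j] @ replicate (n - p) (Z i))
          ((-1) ^ p * quantum_binomial (root_power (dot \<Omega>) v1 i) n p))
      | Z i j n. Z \<in> {E, F} \<and> i \<noteq> j \<and> n = ?n i j} =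
    {(\<Sum>p\<le>n. single (replicate p (E i) @ [E j] @ replicate (n - p) (E i))
          ((-1) ^ p * quantum_binomial (root_power (dot \<Omega>) v1 i) n p)) | i j n. i \<noteq> j \<and> n = ?n i j} \<union>
    {(\<Sum>p\<le>n. single (replicate p (F i) @ [F j] @ replicate (n - p) (F i))
          ((-1) ^ p * quantum_binomial (root_power (dot \<Omega>) v1 i) n p)) | i j n. i \<noteq> j \<and> n = ?n i j}"
    (is "?l = ?r")
  proof
    show "?l \<subseteq> ?r" by blast
    show "?r \<subseteq> ?l" by blast
  qed
  have a: "A \<union> (B \<union> C) = A \<union> B \<union> C" for A B C :: "('i gen list \<Rightarrow>\<^sub>0 Qv) set" by blast
  show ?thesis unfolding rels1_def rels2_def serre a
  proof (intro rel_set_Un rel_set_family matches_torus matches_commutator matches_serre_E matches_serre_F)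
    fix i j :: 'i
    note simps = v2_power twist_exp_triple word_form_letters word_form_torus torus_gens_def sq_form_diff mult.commute
    show "matches \<Omega> (single [K i, E j, Kinv i] 1 - single [E j] (v1 powi dot \<Omega> i j))
       (single [K i, E j, Kinv i] 1
        - single [E j] (v2 powi dot \<Omega> i j * t2 powi (\<Omega> i j - \<Omega> j i)))"
      using sq_form_diff[of i j] by (intro matches_conj[where e = "\<Omega> i j - \<Omega> j i"]) (simp_all add: simps del: word_deg_single twist_exp.simps)
    show "matches \<Omega> (single [K' i, E j, Kinv' i] 1 - single [E j] (v1 powi (- dot \<Omega> i j)))
       (single [K' i, E j, Kinv' i] 1
        - single [E j] (v2 powi (- dot \<Omega> i j) * t2 powi (\<Omega> i j - \<Omega> j i)))"
      using sq_form_diff[of i j] by (intro matches_conj[where e = "\<Omega> i j - \<Omega> j i"]) (simp_all add: simps del: word_deg_single twist_exp.simps)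
    show "matches \<Omega> (single [K i, F j, Kinv i] 1 - single [F j] (v1 powi (- dot \<Omega> i j)))
       (single [K i, F j, Kinv i] 1
        - single [F j] (v2 powi (- dot \<Omega> i j) * t2 powi (\<Omega> j i - \<Omega> i j)))"
      using sq_form_diff[of i j] by (intro matches_conj[where e = "\<Omega> j i - \<Omega> i j"]) (simp_all add: simps del: word_deg_single twist_exp.simps)
    show "matches \<Omega> (single [K' i, F j, Kinv' i] 1 - single [F j] (v1 powi dot \<Omega> i j))
       (single [K' i, F j, Kinv' i] 1
        - single [F j] (v2 powi dot \<Omega> i j * t2 powi (\<Omega> j i - \<Omega> i j)))"
      using sq_form_diff[of i j] by (intro matches_conj[where e = "\<Omega> j i - \<Omega> i j"]) (simp_all add: simps del: word_deg_single twist_exp.simps)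
  qed
qed

section \<open>Homogeneity of the two-parameter relations\<close>

lemma word_deg_mset: "mset (u :: 'a gen list) = mset w \<Longrightarrow> word_deg u = word_deg w"
proof -
  assume *: "mset u = mset w"
  have "(\<Sum>x\<leftarrow>u. h x) = (\<Sum>x\<leftarrow>w. h x)" for h :: "'a gen \<Rightarrow> int"
    unfolding sum_mset_sum_list[symmetric] mset_map * ..
  then show ?thesis by (simp only: word_deg_def)
qed

lemma word_deg_cancel:
  assumes "gen_deg k = ((\<lambda>m. - fst (gen_deg l) m), (\<lambda>m. - snd (gen_deg l) m))"
  shows "word_deg [k, x, l] = word_deg [x]" "word_deg [k, l] = word_deg []"
  using assms by (simp_all add: word_deg_def)

lemma rels2_homogeneous: "r \<in> rels2 \<Omega> \<Longrightarrow> \<exists>\<delta>. homogeneous \<delta> r"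
proof -
  have two: "\<exists>\<delta>. homogeneous \<delta> (single u a - single w b)"
    if "word_deg u = word_deg w" for u w :: "'i gen list" and a b
    using that by (intro exI homogeneous_diff homogeneous_single) auto
  have conj: "\<exists>\<delta>. homogeneous \<delta> (single [k, x, l] a - single [x] b)"
    if "gen_deg k = ((\<lambda>m. - fst (gen_deg l) m), (\<lambda>m. - snd (gen_deg l) m))" for k x l :: "'i gen" and a b
    by (rule two[OF word_deg_cancel(1)[OF that]])
  have serre: "\<exists>\<delta>. homogeneous \<delta> (\<Sum>p\<le>n. single (f p) (c p))"
    if "\<And>p. p \<le> n \<Longrightarrow> word_deg (f p) = \<delta>" for f :: "nat \<Rightarrow> 'i gen list" and c n \<delta>
    using that by (intro exI homogeneous_sum homogeneous_single) auto
  have comm: "\<exists>\<delta>. homogeneous \<delta> r" if "r \<in> commutator_rels (dot \<Omega>) v2" for r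
  proof -
    from that obtain i j where r: "r = single [E i, F j] 1 - single [F j, E i] 1 -
        (if i = j then (let c = 1 / (root_power (dot \<Omega>) v2 i - inverse (root_power (dot \<Omega>) v2 i)) in
            single [K i] c - single [K' i] c) else 0)"
      by (auto simp: commutator_rels_def)
    have "homogeneous (word_deg [E i, F j]) r" unfolding r Let_def
      by (auto intro!: homogeneous_diff homogeneous_single homogeneous_zero simp: word_deg_def)
    then show ?thesis by blast
  qed
  then have comm': "\<forall>r\<in>commutator_rels (dot \<Omega>) v2. \<exists>\<delta>. homogeneous \<delta> r" by blast
  have torus: "\<forall>r\<in>torus_rels :: ('i gen list \<Rightarrow>\<^sub>0 Qvt) set. \<exists>\<delta>. homogeneous \<delta> r"
    unfolding torus_rels_def ball_Un ball_Collect_pair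
    by (intro conjI allI impI two; (rule word_deg_cancel(2), simp; fail | rule word_deg_mset, simp add: add_mset_commute))
  \<comment> \<open>All words of a Serre sum are permutations of one another.\<close>
  have s: "word_deg (replicate a x @ [y] @ replicate b x) = word_deg (replicate (a + b) x @ [y])" for a b and x y :: "'i gen"
    by (rule word_deg_mset) (simp add: replicate_add)
  have "\<forall>r\<in>rels2 \<Omega>. \<exists>\<delta>. homogeneous \<delta> r"
    unfolding rels2_def ball_Un ball_Collect_pair(1)
  proof (intro conjI torus comm' allI conj ballI)
    fix r assume "r \<in> {(\<Sum>p\<le>n. single (replicate (n - p) (E i) @ [E j] @ replicate p (E i))
          (serre2_coeff \<Omega> i j p (n - p))) | i j n. i \<noteq> j \<and> n = nat (1 - cartan_int (dot \<Omega>) i j)}"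
    then obtain i j n where r: "r = (\<Sum>p\<le>n. single (replicate (n - p) (E i) @ [E j] @ replicate p (E i))
          (serre2_coeff \<Omega> i j p (n - p)))" by blast
    show "\<exists>\<delta>. homogeneous \<delta> r" unfolding r
      by (rule serre[of _ _ "word_deg (replicate n (E i) @ [E j])"]) (subst s, simp)
  next
    fix r assume "r \<in> {(\<Sum>p\<le>n. single (replicate p (F i) @ [F j] @ replicate (n - p) (F i))
          (serre2_coeff \<Omega> i j p (n - p))) | i j n. i \<noteq> j \<and> n = nat (1 - cartan_int (dot \<Omega>) i j)}"
    then obtain i j n where r: "r = (\<Sum>p\<le>n. single (replicate p (F i) @ [F j] @ replicate (n - p) (F i))
          (serre2_coeff \<Omega> i j p (n - p)))" by blast
    show "\<exists>\<delta>. homogeneous \<delta> r" unfolding r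
      by (rule serre[of _ _ "word_deg (replicate n (F i) @ [F j])"]) (subst s, simp)
  qed simp_all
  then show "r \<in> rels2 \<Omega> \<Longrightarrow> \<exists>\<delta>. homogeneous \<delta> r" by blast
qed

end

section \<open>The isomorphism\<close>

context two_parameter
begin

abbreviation "star \<equiv> tw_algebra free_monoid (twist_cocycle \<Omega> 1)"
abbreviation "J2 \<equiv> Idl\<^bsub>free_algebra\<^esub> (rels2 \<Omega>)"

lemma free_algebra_twist: "(free_algebra :: (Qvt, 'i gen list \<Rightarrow>\<^sub>0 Qvt) module) = tw_algebra free_monoid (twist_cocycle \<Omega> 0)"
  by (simp add: free_algebra_eq twist_cocycle_0)

text \<open>\<open>J2\<close> is generated with respect to concatenation but is used with the star
  product. That it is an ideal for the latter makes the product of \<open>U2_star_algebra\<close>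
  well defined on cosets.\<close>

sublocale S: free_quotient "twist_cocycle \<Omega> 1" J2
proof -
  interpret C: cocycle free_monoid "twist_cocycle \<Omega> 1" by (rule cocycle_twist_cocycle)
  interpret A: alg star by unfold_locales (rule C.tw_algebra_assoc_algebra)
  interpret I: ideal J2 star
    unfolding free_algebra_twist by (rule ideal_change_twist[OF rels2_homogeneous])
  show "free_quotient (twist_cocycle \<Omega> 1) J2"
    by (intro free_quotient.intro alg_ideal.intro free_quotient_axioms.intro
        C.cocycle_axioms A.alg_axioms I.ideal_axioms twist_cocycle_nonzero)
qed

text \<open>A homomorphism for the star product that kills the relations kills the ideal they
  generate for that product; this inclusion transfers the vanishing to \<open>J2\<close>.\<close>

lemma ideal_le: "J2 \<subseteq> Idl\<^bsub>star\<^esub> (rels2 \<Omega>)"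
proof -
  interpret C: cocycle free_monoid "twist_cocycle \<Omega> 0" by (rule cocycle_twist_cocycle)
  interpret A: alg "tw_algebra free_monoid (twist_cocycle \<Omega> 0)"
    by unfold_locales (rule C.tw_algebra_assoc_algebra)
  show ?thesis unfolding free_algebra_twist
  proof (rule A.genideal_minimal)
    show "ideal (Idl\<^bsub>star\<^esub> (rels2 \<Omega>)) (tw_algebra free_monoid (twist_cocycle \<Omega> 0))"
      by (rule ideal_change_twist[OF rels2_homogeneous])
    show "rels2 \<Omega> \<subseteq> Idl\<^bsub>star\<^esub> (rels2 \<Omega>)" by (rule S.genideal_self) simp
  qed
qed

lemma rels2_in_ideal: "r \<in> rels2 \<Omega> \<Longrightarrow> r \<in> J2"
proof -
  interpret C: cocycle free_monoid "\<lambda>_ _. 1 :: Qvt" by (rule free_cocycle_trivial)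
  interpret A: alg "tw_algebra free_monoid (\<lambda>_ _. 1 :: Qvt)"
    by unfold_locales (rule C.tw_algebra_assoc_algebra)
  show "r \<in> rels2 \<Omega> \<Longrightarrow> r \<in> J2"
    unfolding free_algebra_eq using A.genideal_self[of "rels2 \<Omega>"] by auto
qed

lemma free_star_eq: "free_star \<Omega> = tw_mult free_monoid (twist_cocycle \<Omega> 1)"
  by (simp add: free_star_def tw_mult_def fun_eq_iff twist_cocycle_def mult.assoc)

lemma coset_star: "J +>\<^bsub>free_algebra\<^esub> f = J +>\<^bsub>star\<^esub> f"
  by (simp add: a_r_coset_def r_coset_def free_algebra_eq)

text \<open>Cosets depend on addition only, and the union over representatives in
  \<open>U2_star_algebra\<close> is the coset product for the star product, so the records agree
  field by field.\<close>

lemma star_algebra_eq: "U2_star_algebra \<Omega> = S.Q"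
proof (rule module.equality)
  have c: "(+>\<^bsub>free_algebra\<^esub>) J2 = (+>\<^bsub>star\<^esub>) J2" by (rule ext) (rule coset_star)
  show "carrier (U2_star_algebra \<Omega>) = carrier S.Q"
    by (simp add: U2_star_algebra_def U2_def presented_def quot_algebra_simps c) (simp add: free_algebra_eq)
  show "monoid.mult (U2_star_algebra \<Omega>) = monoid.mult S.Q"
    by (simp add: U2_star_algebra_def quot_algebra_simps fun_eq_iff rcoset_mult_def coset_star free_star_eq)
  show "\<one>\<^bsub>U2_star_algebra \<Omega>\<^esub> = \<one>\<^bsub>S.Q\<^esub>"
    by (simp add: U2_star_algebra_def U2_def presented_def quot_algebra_simps coset_star) (simp add: free_algebra_eq)
  show "\<zero>\<^bsub>U2_star_algebra \<Omega>\<^esub> = \<zero>\<^bsub>S.Q\<^esub>"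
    by (simp add: U2_star_algebra_def U2_def presented_def quot_algebra_simps)
  show "ring.add (U2_star_algebra \<Omega>) = ring.add S.Q"
    by (simp add: U2_star_algebra_def U2_def presented_def quot_algebra_simps fun_eq_iff set_add_def set_mult_def free_algebra_eq)
  show "module.smult (U2_star_algebra \<Omega>) = module.smult S.Q"
    by (simp add: U2_star_algebra_def U2_def presented_def quot_algebra_simps fun_eq_iff coset_star) (simp add: free_algebra_eq)
qed simp

lemma U2_gen_eq: "U2_gen \<Omega> = S.gen"
  by (simp add: fun_eq_iff U2_gen_def presented_gen_def coset_star)

text \<open>The inverse power of t attached to each word cancels the one introduced by
  \<open>twist_map\<close>, leaving an ordinary evaluation of the one-parameter element.\<close>

lemma eval_twist_map:
  assumes C: "assoc_algebra C" and h: "\<And>x. h x \<in> carrier C"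
  shows "lin_ext C (\<lambda>w. inverse (t2 powi twist_exp \<Omega> w) \<odot>\<^bsub>C\<^esub> word_prod C h w) (twist_map \<Omega> r)
    = lin_ext (restrict_scalars Qv_in_Qvt C) (word_prod C h) r"
proof -
  interpret C: alg C by unfold_locales fact
  interpret R: alg "restrict_scalars Qv_in_Qvt C"
    by unfold_locales (rule Qv.restrict_scalars_assoc_algebra[OF C])
  have w: "word_prod C h w \<in> carrier C" for w using h by auto
  then have p: "word_prod C h \<in> UNIV \<rightarrow> carrier (restrict_scalars Qv_in_Qvt C)"
    "(\<lambda>w. inverse (t2 powi twist_exp \<Omega> w) \<odot>\<^bsub>C\<^esub> word_prod C h w) \<in> UNIV \<rightarrow> carrier C" by auto
  show ?thesis using subset_UNIV[of "keys r"]
  proof (induction r rule: poly_mapping_keys_induct)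
    case zero
    then show ?case using R.lin_ext_zero by simp
  next
    case (single u c)
    have k: "t2 powi twist_exp \<Omega> u * Qv_in_Qvt c * inverse (t2 powi twist_exp \<Omega> u) = Qv_in_Qvt c"
      by (simp add: field_simps)
    show ?case using R.lin_ext_single[of "word_prod C h" u c] w by (simp add: k)
  next
    case (add r s)
    then show ?case using R.lin_ext_add[OF _ _ p(1), of r s] C.lin_ext_add[OF _ _ p(2), of "twist_map \<Omega> r" "twist_map \<Omega> s"]
      by (simp add: twist_map_add)
  qed
qed

text \<open>In the star algebra the product of the letters of w is t^\<sigma>(w) times w, so
  dividing by this power returns the coset of the word.\<close>

lemma eval_star_quotient: "lin_ext S.Q (\<lambda>w. inverse (t2 powi twist_exp \<Omega> w) \<odot>\<^bsub>S.Q\<^esub> word_prod S.Q S.gen w) f = S.\<pi> f"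
proof -
  have b: "inverse (t2 powi twist_exp \<Omega> w) \<odot>\<^bsub>S.Q\<^esub> word_prod S.Q S.gen w = S.\<pi> (single w 1)" for w
    using S.\<pi>_single[of w 1] by (simp add: twist_twist_cocycle inverse_eq_divide)
  have p: "(\<lambda>w. S.\<pi> (single w 1)) \<in> UNIV \<rightarrow> carrier S.Q" by auto
  show ?thesis unfolding b using subset_UNIV[of "keys f"]
  proof (induction f rule: poly_mapping_keys_induct)
    case zero
    then show ?case using S.\<pi>_eq_zero[OF S.zero_closed] by simp
  next
    case (single w c)
    then show ?case using S.\<pi>(5)[of c "single w 1"] by simp
  next
    case (add f g)
    then show ?case by (simp add: S.Q.lin_ext_add[OF _ _ p] S.\<pi>(2))
  qed
qed

lemma quotient_to_extension:
  obtains \<phi> where "\<phi> \<in> alg_hom S.Q (U1_vt (dot \<Omega>))" "\<And>x. \<phi> (S.gen x) = U1_vt_gen (dot \<Omega>) x"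
proof -
  interpret D: root_datum "dot \<Omega>" by (rule root_datum_dot)
  let ?H = "U1 (dot \<Omega>)" and ?L = "U1_vt (dot \<Omega>)" and ?g = "U1_vt_gen (dot \<Omega>)"
  interpret H: hopf_gens ?H D.gen1 by unfold_locales (rule D.U1_hopf_generated)
  interpret L: hopf_gens ?L ?g by unfold_locales (rule D.U1_vt_hopf_generated)
  interpret X: scalar_extension ?H Qv_in_Qvt by unfold_locales
  \<comment> \<open>By \<open>twist_exp_append\<close> the factor t^(-\<sigma>(w)) makes this a
    projective representation with the cocycle of the star product, as
    \<open>lin_ext_alg_hom\<close> demands.\<close>
  let ?\<beta> = "\<lambda>w. inverse (t2 powi twist_exp \<Omega> w) \<odot>\<^bsub>?L\<^esub> word_prod ?L ?g w"
  let ?h = "lin_ext ?L ?\<beta>"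
  have h: "?h \<in> alg_hom star ?L"
  proof (rule lin_ext_alg_hom[OF cocycle_twist_cocycle L.H.assoc_algebra])
    fix u w :: "'i gen list"
    have "twist_cocycle \<Omega> 1 u w * inverse (t2 powi twist_exp \<Omega> (u @ w))
      = inverse (t2 powi twist_exp \<Omega> u) * inverse (t2 powi twist_exp \<Omega> w)"
      by (simp add: twist_cocycle_def twist_exp_append power_int_minus[symmetric] power_int_add[symmetric])
    then show "twist_cocycle \<Omega> 1 u w \<odot>\<^bsub>?L\<^esub> ?\<beta> (u \<otimes>\<^bsub>free_monoid\<^esub> w) = ?\<beta> u \<otimes>\<^bsub>?L\<^esub> ?\<beta> w"
      by (simp add: L.H.word_prod_append mult.commute)
  qed auto
  have \<iota>: "X.\<iota> \<in> alg_hom (presented (rels1 (dot \<Omega>))) (restrict_scalars Qv_in_Qvt ?L)"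
  proof -
    interpret same_algebra ?H "presented (rels1 (dot \<Omega>))" by unfold_locales (simp_all add: U1_def)
    show ?thesis using X.elem_alg_hom unfolding same_alg_hom
      by (simp add: alg_hom_def ring_hom_def U1_vt_def)
  qed
  have R: "assoc_algebra (restrict_scalars Qv_in_Qvt ?L)"
    by (rule Qv.restrict_scalars_assoc_algebra[OF L.H.assoc_algebra])
  have wp: "word_prod (restrict_scalars Qv_in_Qvt ?L) f w = word_prod ?L f w" for f :: "'i gen \<Rightarrow> _" and w
    by (induction w) simp_all
  have g: "(\<lambda>x. X.\<iota> (D.gen1 x)) = ?g" by (simp add: fun_eq_iff U1_vt_gen_def)
  have "lin_ext (restrict_scalars Qv_in_Qvt ?L) (word_prod ?L ?g) r = \<zero>\<^bsub>?L\<^esub>" if "r \<in> rels1 (dot \<Omega>)" for r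
  proof -
    have "lin_ext (restrict_scalars Qv_in_Qvt ?L) (word_prod ?L ?g) r
      = X.\<iota> (lin_ext D.U.P (word_prod D.U.P D.gen1) r)"
      unfolding lin_ext_alg_hom_comp[OF \<iota> D.U.P.assoc_algebra R D.U.P.word_prod_closed[OF D.U.presented_gen_closed]]
        word_prod_alg_hom[OF \<iota> D.U.P.assoc_algebra D.U.presented_gen_closed] g wp ..
    also have "\<dots> = \<zero>\<^bsub>?L\<^esub>"
      unfolding D.U.relation_holds[OF that] using alg_hom_zero[OF \<iota> D.U.P.assoc_algebra R] by simp
    finally show ?thesis .
  qed
  note vanish1 = this
  have "?h r = \<zero>\<^bsub>?L\<^esub>" if r: "r \<in> rels2 \<Omega>" for r
  proof -
    obtain r1 c where r1: "r1 \<in> rels1 (dot \<Omega>)" "c \<noteq> 0" "twist_map \<Omega> r1 = scale c r"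
      using rel_setD2[OF matches_rels r] by (auto simp: matches_def)
    \<comment> \<open>The evaluation of the twisted relation is that of the one-parameter relation,
      which holds in the extension; since c \<noteq> 0, it can be divided out.\<close>
    have "?h (scale c r) = \<zero>\<^bsub>?L\<^esub>"
      unfolding r1(3)[symmetric] eval_twist_map[OF L.H.assoc_algebra L.g_closed] by (rule vanish1[OF r1(1)])
    then have "inverse c \<odot>\<^bsub>?L\<^esub> ?h (scale c r) = \<zero>\<^bsub>?L\<^esub>" by simp
    moreover have "?h (scale c r) = c \<odot>\<^bsub>?L\<^esub> ?h r" "?h r \<in> carrier ?L"
      using alg_homD(5)[OF h, of r c] alg_homD(1)[OF h, of r] by simp_all
    ultimately show ?thesis using r1(2) by simp
  qed
  then have "Idl\<^bsub>star\<^esub> (rels2 \<Omega>) \<subseteq> {f \<in> carrier star. ?h f = \<zero>\<^bsub>?L\<^esub>}"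
    using alg_hom_kernel_ideal[OF S.assoc_algebra L.H.assoc_algebra h] by (intro S.genideal_minimal) auto
  then have "?h f = \<zero>\<^bsub>?L\<^esub>" if "f \<in> J2" for f using that ideal_le by blast
  from S.quot_lift[OF L.H.assoc_algebra h this] obtain \<phi> where \<phi>: "\<phi> \<in> alg_hom S.Q ?L" "\<And>f. \<phi> (S.\<pi> f) = ?h f"
    by auto
  show thesis
  proof
    show "\<phi> \<in> alg_hom S.Q ?L" by (rule \<phi>(1))
    show "\<phi> (S.gen x) = ?g x" for x
      unfolding \<phi>(2) by (subst L.H.lin_ext_single) (simp_all add: word_form_Nil del: word_deg_Nil word_deg_single)
  qed
qed

lemma extension_to_quotient:
  obtains \<psi> where "\<psi> \<in> alg_hom (U1_vt (dot \<Omega>)) S.Q" "\<And>x. \<psi> (U1_vt_gen (dot \<Omega>) x) = S.gen x"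
proof -
  interpret D: root_datum "dot \<Omega>" by (rule root_datum_dot)
  let ?H = "U1 (dot \<Omega>)"
  interpret H: hopf_gens ?H D.gen1 by unfold_locales (rule D.U1_hopf_generated)
  interpret X: scalar_extension ?H Qv_in_Qvt by unfold_locales
  have R: "assoc_algebra (restrict_scalars Qv_in_Qvt S.Q)"
    by (rule Qv.restrict_scalars_assoc_algebra[OF S.Q.assoc_algebra])
  have wp: "word_prod (restrict_scalars Qv_in_Qvt S.Q) S.gen = word_prod S.Q S.gen"
  proof
    show "word_prod (restrict_scalars Qv_in_Qvt S.Q) S.gen w = word_prod S.Q S.gen w" for w
      by (induction w) simp_all
  qed
  have "lin_ext (restrict_scalars Qv_in_Qvt S.Q) (word_prod (restrict_scalars Qv_in_Qvt S.Q) S.gen) r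
      = \<zero>\<^bsub>restrict_scalars Qv_in_Qvt S.Q\<^esub>" if r: "r \<in> rels1 (dot \<Omega>)" for r
  proof -
    obtain r2 c where r2: "r2 \<in> rels2 \<Omega>" "twist_map \<Omega> r = scale c r2"
      using rel_setD1[OF matches_rels r] by (auto simp: matches_def)
    have "r2 \<in> J2"
      using r2(1) by (rule rels2_in_ideal)
    have "lin_ext (restrict_scalars Qv_in_Qvt S.Q) (word_prod (restrict_scalars Qv_in_Qvt S.Q) S.gen) r = S.\<pi> (scale c r2)"
      unfolding wp eval_twist_map[OF S.Q.assoc_algebra S.\<pi>_closed, symmetric] eval_star_quotient r2(2) ..
    also have "\<dots> = \<zero>\<^bsub>S.Q\<^esub>"
      using S.\<pi>_eq_zero[OF \<open>r2 \<in> J2\<close>] S.\<pi>(5)[of c r2] by simp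
    finally show ?thesis by simp
  qed
  \<comment> \<open>The lift is made over Q(v), into the star algebra with restricted scalars, and
    extended linearly to Q(v,t) afterwards.\<close>
  then obtain h where h: "h \<in> alg_hom D.U.P (restrict_scalars Qv_in_Qvt S.Q)" "\<And>x. h (D.gen1 x) = S.gen x"
    using D.U.presented_lift[OF R, of S.gen] by auto
  have h': "h \<in> alg_hom ?H (restrict_scalars Qv_in_Qvt S.Q)"
  proof -
    interpret same_algebra ?H D.U.P by unfold_locales (simp_all add: U1_def)
    show ?thesis unfolding same_alg_hom by (rule h(1))
  qed
  note \<psi> = X.tensor_lift_extension[OF S.Q.assoc_algebra h']
  interpret same_algebra "U1_vt (dot \<Omega>)" X.B by unfold_locales (simp_all add: U1_vt_def)
  show thesis
    by (rule that[OF \<psi>(1)[folded same_alg_hom]]) (simp add: U1_vt_gen_def \<psi>(2) h(2))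
qed

end

theorem theorem4:
  fixes \<Omega> :: "'i::finite \<Rightarrow> 'i \<Rightarrow> int"
  assumes "cartan_matrix_datum \<Omega>"
  shows "hopf_algebra (U2_star \<Omega>) \<and> hopf_algebra (U1_vt (dot \<Omega>)) \<and>
    (\<exists>\<phi> \<in> hopf_iso (U2_star \<Omega>) (U1_vt (dot \<Omega>)).
      \<forall>x. \<phi> (U2_gen \<Omega> x) = U1_vt_gen (dot \<Omega>) x)"
proof -
  interpret two_parameter \<Omega> by unfold_locales fact
  note L = root_datum.U1_vt_hopf_generated[OF root_datum_dot]
  obtain \<phi> where \<phi>: "\<phi> \<in> alg_hom S.Q (U1_vt (dot \<Omega>))" "\<And>x. \<phi> (S.gen x) = U1_vt_gen (dot \<Omega>) x"
    by (rule quotient_to_extension) blast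
  obtain \<psi> where \<psi>: "\<psi> \<in> alg_hom (U1_vt (dot \<Omega>)) S.Q" "\<And>x. \<psi> (U1_vt_gen (dot \<Omega>) x) = S.gen x"
    by (rule extension_to_quotient) blast
  have U2: "U2_star \<Omega> = hopf_on_gens S.Q S.gen"
    by (simp add: U2_star_def star_algebra_eq U2_gen_eq)
  have H: "hopf_generated (U2_star \<Omega>) S.gen"
    \<comment> \<open>Here the descriptions in \<open>U2_star\<close> receive their
      witnesses.\<close>
    unfolding U2 by (rule hopf_generated_transfer[OF L S.Q.assoc_algebra S.generates_gen \<phi> \<psi>])
  have L': "assoc_algebra (U1_vt (dot \<Omega>))" "generates (U1_vt (dot \<Omega>)) (U1_vt_gen (dot \<Omega>))"
    using L by (simp_all add: hopf_generated_def)
  interpret same_algebra "U2_star \<Omega>" S.Q by unfold_locales (simp_all add: U2)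
  have "bij_betw \<phi> (carrier (U2_star \<Omega>)) (carrier (U1_vt (dot \<Omega>)))"
    using alg_hom_bij[OF S.Q.assoc_algebra L'(1) S.generates_gen L'(2) \<phi> \<psi>] by simp
  then have "\<phi> \<in> hopf_iso (U2_star \<Omega>) (U1_vt (dot \<Omega>))"
    using \<phi>(1) by (intro hopf_isoI[OF H L _ _ \<phi>(2)]) (simp_all add: same_alg_hom)
  moreover have "hopf_algebra (U2_star \<Omega>)" "hopf_algebra (U1_vt (dot \<Omega>))"
    using hopf_gens.hopf_algebra[OF hopf_gens.intro[OF H]] hopf_gens.hopf_algebra[OF hopf_gens.intro[OF L]] .
  ultimately show ?thesis using \<phi>(2) unfolding U2_gen_eq by blast
qed

end
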